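(* Let $\lambda_1\le\lambda_2\le\cdots$ be the eigenvalues (counted with multiplicity) of the Stokes eigenvalue problem: find $\mathbf{u}\in\mathbf{V}\setminus\{0\}$ and $\lambda\in\mathbb{R}$ such that $(\nabla\mathbf{u},\nabla\mathbf{v})=\lambda(\mathbf{u},\mathbf{v})$ for all $\mathbf{v}\in\mathbf{V}$. Let $\lambda_{h,1}\le\cdots\le\lambda_{h,n}$, $n=\dim(\mathbf{V}_h)$, be the eigenvalues (counted with multiplicity) of the discrete problem: find $\mathbf{u}_h\in\mathbf{V}_h\setminus\{0\}$ and $\lambda_h\in\mathbb{R}$ such that $(\nabla\mathbf{u}_h,\nabla\mathbf{v}_h)=\lambda_h(\mathbf{u}_h,\mathbf{v}_h)$ for all $\mathbf{v}_h\in\mathbf{V}_h$. Let $C_h=\sqrt{C_{0,h}^2+\kappa_h^2}$. Then $$\lambda_i\ \ge\ \frac{\lambda_{h,i}}{1+C_h^2\lambda_{h,i}},\qquad i=1,2,\dots,\dim(\mathbf{V}_h).$$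
   Context: $\Omega\subset\mathbb{R}^3$ is a bounded Lipschitz polyhedral domain and $\mathcal{T}^h$ is a regular tetrahedral subdivision of $\Omega$. $(\cdot,\cdot)$ and $\|\cdot\|$ denote the $L^2(\Omega)$ inner product and norm (componentwise for vector and tensor fields). $\mathbf{V}=\{\mathbf{v}\in (H_0^1(\Omega))^3 : \mathrm{div}\,\mathbf{v}=0\}$. $H(\mathrm{div};\Omega)=\{p\in (L^2(\Omega))^3 : \mathrm{div}\,p\in L^2(\Omega)\}$. For a tensor field $\mathbf{p}=(p_1,p_2,p_3)$ with $p_i\in H(\mathrm{div};\Omega)$, $\mathrm{div}\,\mathbf{p}:=(\mathrm{div}\,p_1,\mathrm{div}\,p_2,\mathrm{div}\,p_3)$; $\nabla\mathbf{u}=(\nabla u_1,\nabla u_2,\nabla u_3)$. Finite element spaces: $P^m(K)$ is the set of polynomials of degree up to $m$ on $K\in\mathcal{T}^h$. The degrees are integers $k\ge 3$ and $d=m=k-1$. - $X_h$: the space of (discontinuous) piecewise polynomials of degree up to $d$ on $\mathcal{T}^h$; $\mathbf{X}_h=(X_h)^3$. - $U_h$: the space of functions in $H^1(\Omega)$ that are piecewise polynomials of degree up to $k$ on $\mathcal{T}^h$; $U_{h,0}=\{u_h\in U_h : u_h=0\text{ on }\partial\Omega\}$; $\mathbf{U}_{h,0}=(U_{h,0})^3$. - $\mathbf{V}_h=\{\mathbf{v}_h\in\mathbf{U}_{h,0} : \mathrm{div}\,\mathbf{v}_h=0\}\subset\mathbf{V}$. - $RT_h=\{p_h\in H(\mathrm{div};\Omega)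 : p_h|_K=\mathbf{a}_K+b_K\mathbf{x},\ \mathbf{a}_K\in(P^m(K))^3,\ b_K\in P^m(K),\ \forall K\in\mathcal{T}^h\}$ (Raviart–Thomas space); $\mathbf{RT}_h=(RT_h)^3$. $\pi_h:(L^2(\Omega))^3\to\mathbf{X}_h$ is the $L^2$-orthogonal projection. $C_{0,h}$ is a constant such that $\|\mathbf{w}-\pi_h\mathbf{w}\|\le C_{0,h}\|\nabla\mathbf{w}\|$ for all $\mathbf{w}\in\mathbf{V}$. The quantity $\kappa_h$ is $$\kappa_h=\max_{\mathbf{f}_h\in\mathbf{X}_h,\ \mathbf{f}_h\ne0}\ \min_{\mathbf{p}_h\in\mathbf{RT}_h,\ \mathbf{v}_h\in\mathbf{V}_h}\frac{\|\mathbf{p}_h-\nabla\mathbf{v}_h\|}{\|\mathbf{f}_h\|},$$ where the minimization over $\mathbf{p}_h$ is subject to the condition that $\mathrm{div}\,\mathbf{p}_h+\nabla\phi_h+\mathbf{f}_h=0$ for some $\phi_h\in U_h$. *)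

theory Defs
  imports "HOL-Analysis.Analysis"
begin

type_synonym pt = "real ^ 3"

section \<open>Domain and mesh\<close>

definition polyhedral_domain :: "pt set \<Rightarrow> bool" where
  "polyhedral_domain \<Omega> \<longleftrightarrow> open \<Omega> \<and> connected \<Omega> \<and> \<Omega> \<noteq> {} \<and> bounded \<Omega> \<and>
     (\<exists>\<P>. finite \<P> \<and> (\<forall>P\<in>\<P>. polytope P) \<and> closure \<Omega> = \<Union>\<P>)"

text \<open>Near each boundary point, \<open>\<Omega>\<close> is the region above the graph of a Lipschitz function
  \<open>\<gamma>\<close> over the plane orthogonal to some unit vector \<open>e\<close>.\<close>

definition lipschitz_boundary :: "pt set \<Rightarrow> bool" where
  "lipschitz_boundary \<Omega> \<longleftrightarrow>
     (\<forall>x\<in>frontier \<Omega>. \<exists>e L r. \<exists>\<gamma>::pt \<Rightarrow> real.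
        norm e = 1 \<and> r > 0 \<and> L-lipschitz_on {z. z \<bullet> e = 0} \<gamma> \<and>
        \<Omega> \<inter> ball x r = {y \<in> ball x r. \<gamma> (y - (y \<bullet> e) *\<^sub>R e) < y \<bullet> e})"

text \<open>The library notion \<open>triangulation\<close> demands that two elements meet in a common
  (possibly empty) face. The elements are closed tetrahedra.\<close>

definition tetrahedral_mesh :: "pt set \<Rightarrow> pt set set \<Rightarrow> bool" where
  "tetrahedral_mesh \<Omega> \<T> \<longleftrightarrow>
     triangulation \<T> \<and> (\<forall>K\<in>\<T>. 3 simplex K) \<and> \<Union>\<T> = closure \<Omega>"

section \<open>Square-integrable functions\<close>

text \<open>Elements of \<open>L\<^sup>2(\<Omega>)\<close> are represented by functions on the whole space, of which only the
  values on \<open>\<Omega>\<close>, up to null sets, matter. The value type is \<open>real\<close>, \<open>real ^ 3\<close> or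
  \<open>real ^ 3 ^ 3\<close>; its inner product is the componentwise one.\<close>

definition L2 :: "pt set \<Rightarrow> (pt \<Rightarrow> 'b::euclidean_space) set" where
  "L2 \<Omega> = {f. f \<in> borel_measurable (lebesgue_on \<Omega>) \<and>
               integrable (lebesgue_on \<Omega>) (\<lambda>x. (norm (f x))\<^sup>2)}"

definition L2_inner ::
    "pt set \<Rightarrow> (pt \<Rightarrow> 'b::euclidean_space) \<Rightarrow> (pt \<Rightarrow> 'b) \<Rightarrow> real" where
  "L2_inner \<Omega> f g = (LINT x|lebesgue_on \<Omega>. f x \<bullet> g x)"

definition L2_norm :: "pt set \<Rightarrow> (pt \<Rightarrow> 'b::euclidean_space) \<Rightarrow> real" where
  "L2_norm \<Omega> f = sqrt (L2_inner \<Omega> f f)"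

text \<open>Linear independence and dimension are those of the classes modulo equality almost
  everywhere in \<open>\<Omega>\<close>.\<close>

definition L2_independent ::
    "pt set \<Rightarrow> nat \<Rightarrow> (nat \<Rightarrow> pt \<Rightarrow> 'b::euclidean_space) \<Rightarrow> bool" where
  "L2_independent \<Omega> n u \<longleftrightarrow>
     (\<forall>c::nat \<Rightarrow> real. (AE x in lebesgue_on \<Omega>. (\<Sum>i<n. c i *\<^sub>R u i x) = 0)
        \<longrightarrow> (\<forall>i<n. c i = 0))"

definition L2_dim :: "pt set \<Rightarrow> (pt \<Rightarrow> 'b::euclidean_space) set \<Rightarrow> enat" where
  "L2_dim \<Omega> S =
     (SUP n \<in> {n. \<exists>u. (\<forall>i<n. u i \<in> S) \<and> L2_independent \<Omega> n u}. enat n)"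

text \<open>For \<open>w\<close> in \<open>L\<^sup>2\<close> and a finite-dimensional \<open>S\<close> the projection exists and is unique up to
  null sets.\<close>

definition L2_proj ::
    "pt set \<Rightarrow> (pt \<Rightarrow> 'b::euclidean_space) set \<Rightarrow> (pt \<Rightarrow> 'b) \<Rightarrow> (pt \<Rightarrow> 'b)" where
  "L2_proj \<Omega> S w = (SOME p. p \<in> S \<and> (\<forall>q\<in>S. L2_inner \<Omega> (\<lambda>x. w x - p x) q = 0))"

section \<open>Weak derivatives and Sobolev spaces\<close>

definition partial_deriv :: "3 \<Rightarrow> (pt \<Rightarrow> real) \<Rightarrow> pt \<Rightarrow> real" where
  "partial_deriv j f x = frechet_derivative f (at x) (axis j 1)"

definition classical_grad :: "(pt \<Rightarrow> real) \<Rightarrow> pt \<Rightarrow> real ^ 3" where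
  "classical_grad f x = (\<chi> j. partial_deriv j f x)"

primrec C_k :: "nat \<Rightarrow> (pt \<Rightarrow> real) \<Rightarrow> bool" where
  "C_k 0 f \<longleftrightarrow> continuous_on UNIV f"
| "C_k (Suc n) f \<longleftrightarrow> (\<forall>x. f differentiable (at x)) \<and> (\<forall>j. C_k n (partial_deriv j f))"

definition test_functions :: "pt set \<Rightarrow> (pt \<Rightarrow> real) set" where
  "test_functions \<Omega> = {\<psi>. (\<forall>n. C_k n \<psi>) \<and>
     compact (closure {x. \<psi> x \<noteq> 0}) \<and> closure {x. \<psi> x \<noteq> 0} \<subseteq> \<Omega>}"

definition has_weak_grad :: "pt set \<Rightarrow> (pt \<Rightarrow> real) \<Rightarrow> (pt \<Rightarrow> real ^ 3) \<Rightarrow> bool" where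
  "has_weak_grad \<Omega> u g \<longleftrightarrow>
     (\<forall>\<psi>\<in>test_functions \<Omega>. \<forall>j.
        (LINT x|lebesgue_on \<Omega>. u x * partial_deriv j \<psi> x)
          = - (LINT x|lebesgue_on \<Omega>. g x $ j * \<psi> x))"

definition has_weak_div :: "pt set \<Rightarrow> (pt \<Rightarrow> real ^ 3) \<Rightarrow> (pt \<Rightarrow> real) \<Rightarrow> bool" where
  "has_weak_div \<Omega> p g \<longleftrightarrow>
     (\<forall>\<psi>\<in>test_functions \<Omega>.
        (LINT x|lebesgue_on \<Omega>. p x \<bullet> classical_grad \<psi> x)
          = - (LINT x|lebesgue_on \<Omega>. g x * \<psi> x))"

definition H1 :: "pt set \<Rightarrow> (pt \<Rightarrow> real) set" where
  "H1 \<Omega> = {u \<in> L2 \<Omega>. \<exists>g \<in> L2 \<Omega>. has_weak_grad \<Omega> u g}"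

definition Hdiv :: "pt set \<Rightarrow> (pt \<Rightarrow> real ^ 3) set" where
  "Hdiv \<Omega> = {p \<in> L2 \<Omega>. \<exists>g \<in> L2 \<Omega>. has_weak_div \<Omega> p g}"

text \<open>On \<open>H1\<close> and \<open>Hdiv\<close> respectively, these are determined up to null sets.\<close>

definition wgrad :: "pt set \<Rightarrow> (pt \<Rightarrow> real) \<Rightarrow> pt \<Rightarrow> real ^ 3" where
  "wgrad \<Omega> u = (SOME g. g \<in> L2 \<Omega> \<and> has_weak_grad \<Omega> u g)"

definition wdiv :: "pt set \<Rightarrow> (pt \<Rightarrow> real ^ 3) \<Rightarrow> pt \<Rightarrow> real" where
  "wdiv \<Omega> p = (SOME g. g \<in> L2 \<Omega> \<and> has_weak_div \<Omega> p g)"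

text \<open>Row \<open>i\<close> of a tensor field is its \<open>i\<close>-th vector field.\<close>

definition tgrad :: "pt set \<Rightarrow> (pt \<Rightarrow> real ^ 3) \<Rightarrow> pt \<Rightarrow> real ^ 3 ^ 3" where
  "tgrad \<Omega> u x = (\<chi> i. wgrad \<Omega> (\<lambda>y. u y $ i) x)"

definition tdiv :: "pt set \<Rightarrow> (pt \<Rightarrow> real ^ 3 ^ 3) \<Rightarrow> pt \<Rightarrow> real ^ 3" where
  "tdiv \<Omega> p x = (\<chi> i. wdiv \<Omega> (\<lambda>y. p y $ i) x)"

definition H10 :: "pt set \<Rightarrow> (pt \<Rightarrow> real) set" where
  "H10 \<Omega> = {u \<in> H1 \<Omega>. \<exists>\<psi>. (\<forall>n::nat. \<psi> n \<in> test_functions \<Omega>) \<and>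
     (\<lambda>n. L2_norm \<Omega> (\<lambda>x. u x - \<psi> n x)) \<longlonglongrightarrow> 0 \<and>
     (\<lambda>n. L2_norm \<Omega> (\<lambda>x. wgrad \<Omega> u x - classical_grad (\<psi> n) x)) \<longlonglongrightarrow> 0}"

definition V_space :: "pt set \<Rightarrow> (pt \<Rightarrow> real ^ 3) set" where
  "V_space \<Omega> = {v. (\<forall>i. (\<lambda>x. v x $ i) \<in> H10 \<Omega>) \<and>
     (AE x in lebesgue_on \<Omega>. wdiv \<Omega> v x = 0)}"

section \<open>Finite element spaces\<close>

definition polys :: "nat \<Rightarrow> (pt \<Rightarrow> real) set" where
  "polys r = {q. \<exists>c. \<forall>x. q x =
     (\<Sum>\<alpha> \<in> {\<alpha>::3 \<Rightarrow> nat. (\<Sum>i\<in>UNIV. \<alpha> i) \<le> r}. c \<alpha> * (\<Prod>i\<in>UNIV. (x $ i) ^ \<alpha> i))}"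

text \<open>The discontinuous spaces only constrain a function on the interiors of the elements,
  since neighbouring closed elements share points.\<close>

definition X_h :: "pt set set \<Rightarrow> nat \<Rightarrow> (pt \<Rightarrow> real) set" where
  "X_h \<T> d = {f. \<forall>K\<in>\<T>. \<exists>q \<in> polys d. \<forall>x \<in> interior K. f x = q x}"

definition X_h3 :: "pt set set \<Rightarrow> nat \<Rightarrow> (pt \<Rightarrow> real ^ 3) set" where
  "X_h3 \<T> d = {f. \<forall>i. (\<lambda>x. f x $ i) \<in> X_h \<T> d}"

definition RT_h :: "pt set \<Rightarrow> pt set set \<Rightarrow> nat \<Rightarrow> (pt \<Rightarrow> real ^ 3) set" where
  "RT_h \<Omega> \<T> m = {p \<in> Hdiv \<Omega>. \<forall>K\<in>\<T>. \<exists>a b. (\<forall>i. (\<lambda>x. a x $ i) \<in> polys m) \<and> b \<in> polys m \<and>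
     (\<forall>x \<in> interior K. p x = a x + b x *\<^sub>R x)}"

definition RT_h3 :: "pt set \<Rightarrow> pt set set \<Rightarrow> nat \<Rightarrow> (pt \<Rightarrow> real ^ 3 ^ 3) set" where
  "RT_h3 \<Omega> \<T> m = {p. \<forall>i. (\<lambda>x. p x $ i) \<in> RT_h \<Omega> \<T> m}"

text \<open>A piecewise polynomial in \<open>H\<^sup>1(\<Omega>)\<close> has a representative that is continuous on the closure
  of \<open>\<Omega>\<close>. Asking for agreement with a polynomial on each closed element selects it, so that
  the boundary condition below can be read pointwise.\<close>

definition U_h :: "pt set \<Rightarrow> pt set set \<Rightarrow> nat \<Rightarrow> (pt \<Rightarrow> real) set" where
  "U_h \<Omega> \<T> k = {u \<in> H1 \<Omega>. \<forall>K\<in>\<T>. \<exists>q \<in> polys k. \<forall>x \<in> K. u x = q x}"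

definition U_h0 :: "pt set \<Rightarrow> pt set set \<Rightarrow> nat \<Rightarrow> (pt \<Rightarrow> real) set" where
  "U_h0 \<Omega> \<T> k = {u \<in> U_h \<Omega> \<T> k. \<forall>x \<in> frontier \<Omega>. u x = 0}"

definition V_h :: "pt set \<Rightarrow> pt set set \<Rightarrow> nat \<Rightarrow> (pt \<Rightarrow> real ^ 3) set" where
  "V_h \<Omega> \<T> k = {v. (\<forall>i. (\<lambda>x. v x $ i) \<in> U_h0 \<Omega> \<T> k) \<and>
     (AE x in lebesgue_on \<Omega>. wdiv \<Omega> v x = 0)}"

section \<open>The constants\<close>

definition admissible ::
    "pt set \<Rightarrow> pt set set \<Rightarrow> nat \<Rightarrow> nat \<Rightarrow> (pt \<Rightarrow> real ^ 3) \<Rightarrow> (pt \<Rightarrow> real ^ 3 ^ 3) set" where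
  "admissible \<Omega> \<T> k m f = {p \<in> RT_h3 \<Omega> \<T> m. \<exists>\<phi> \<in> U_h \<Omega> \<T> k.
     AE x in lebesgue_on \<Omega>. tdiv \<Omega> p x + wgrad \<Omega> \<phi> x + f x = 0}"

text \<open>Extended reals make supremum and infimum total, with value \<open>\<infinity>\<close> for a minimum over an
  empty set. For \<open>d = m\<close> the divergence maps \<open>RT_h3\<close> onto \<open>X_h3\<close>, so that \<open>kappa_h\<close>
  is in fact finite and both extrema are attained.\<close>

definition kappa_h :: "pt set \<Rightarrow> pt set set \<Rightarrow> nat \<Rightarrow> nat \<Rightarrow> nat \<Rightarrow> ereal" where
  "kappa_h \<Omega> \<T> k d m =
     (SUP f \<in> {f \<in> X_h3 \<T> d. L2_norm \<Omega> f \<noteq> 0}.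
        INF (p, v) \<in> admissible \<Omega> \<T> k m f \<times> V_h \<Omega> \<T> k.
          ereal (L2_norm \<Omega> (\<lambda>x. p x - tgrad \<Omega> v x) / L2_norm \<Omega> f))"

definition ereal_sqrt :: "ereal \<Rightarrow> ereal" where
  "ereal_sqrt z = (if z = \<infinity> then \<infinity> else ereal (sqrt (real_of_ereal z)))"

definition C_h :: "pt set \<Rightarrow> pt set set \<Rightarrow> nat \<Rightarrow> nat \<Rightarrow> nat \<Rightarrow> real \<Rightarrow> ereal" where
  "C_h \<Omega> \<T> k d m C0 = ereal_sqrt ((ereal C0)\<^sup>2 + (kappa_h \<Omega> \<T> k d m)\<^sup>2)"

section \<open>Eigenvalues\<close>

text \<open>The eigenspace contains zero; \<open>\<mu>\<close> is an eigenvalue iff the dimension is positive.\<close>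

definition eigenspace ::
    "pt set \<Rightarrow> (pt \<Rightarrow> real ^ 3) set \<Rightarrow> real \<Rightarrow> (pt \<Rightarrow> real ^ 3) set" where
  "eigenspace \<Omega> W \<mu> =
     {u \<in> W. \<forall>v\<in>W. L2_inner \<Omega> (tgrad \<Omega> u) (tgrad \<Omega> v) = \<mu> * L2_inner \<Omega> u v}"

text \<open>\<open>ev\<close>, indexed by \<open>I\<close>, lists in nondecreasing order all eigenvalues of the problem
  posed on \<open>W\<close>, each as often as its multiplicity.\<close>

definition lists_eigenvalues ::
    "pt set \<Rightarrow> (pt \<Rightarrow> real ^ 3) set \<Rightarrow> nat set \<Rightarrow> (nat \<Rightarrow> real) \<Rightarrow> bool" where
  "lists_eigenvalues \<Omega> W I ev \<longleftrightarrow> mono_on I ev \<and>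
     (\<forall>\<mu>. finite {i \<in> I. ev i = \<mu>} \<and>
          L2_dim \<Omega> (eigenspace \<Omega> W \<mu>) = enat (card {i \<in> I. ev i = \<mu>}))"

end

theory Submission
  imports Defs
begin

text \<open>For a nonzero \<open>v\<close> in the span of the first \<open>i\<close> eigenfunctions, \<open>(\<nabla>v, \<nabla>v) \<le> \<lambda>\<^sub>i (v, v)\<close>.
Let \<open>P\<close> be the energy projection of \<open>v\<close> onto \<open>V_h\<close>. By a count of dimensions \<open>v\<close> can
be chosen such that \<open>P\<close> has no components along the first \<open>i - 1\<close> discrete eigenfunctions, and then
\<open>\<lambda>\<^bsub>h,i\<^esub> (P, P) \<le> (\<nabla>P, \<nabla>P)\<close>. If the Galerkin error \<open>e = v - P\<close> satisfies
\<open>(e, e) \<le> C\<^sup>2 (\<nabla>e, \<nabla>e)\<close>, the orthogonality of \<open>P\<close> and \<open>e\<close> in the energy gives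
\<open>(v, v) \<le> (1 / \<lambda>\<^bsub>h,i\<^esub> + C\<^sup>2) (\<nabla>v, \<nabla>v)\<close>, hence
\<open>1 \<le> (1 / \<lambda>\<^bsub>h,i\<^esub> + C\<^sup>2) \<lambda>\<^sub>i\<close>, which is the claim for
positive \<open>\<lambda>\<^bsub>h,i\<^esub>\<close> and finite \<open>C\<close> (\<open>eigenvalue_lower_bound\<close>). In the other cases the asserted
lower bound is zero.

The error estimate with \<open>C = C_h\<close> (\<open>galerkin_error\<close>) is direct. Split
\<open>e\<close> orthogonally by its projection \<open>f\<close> onto the discontinuous finite elements. The part
\<open>e - f\<close> is measured by \<open>C0\<close>. For \<open>f\<close>, take a stress \<open>p\<close> with
\<open>div p + \<nabla>\<phi> + f = 0\<close>: since \<open>e\<close> is divergence-free with zero boundary values,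
\<open>(f, f) = (f, e) = (p, \<nabla>e)\<close>, and since \<open>e\<close> is orthogonal to \<open>V_h\<close> in the energy, \<open>p\<close>
may be replaced by \<open>p - \<nabla>v\<close> for any \<open>v\<close> in \<open>V_h\<close>. This is the quantity that
\<open>\<kappa>\<^sub>h\<close> bounds.

What remains is analysis. Gradients and divergences are chosen representatives of weak
derivatives; they behave linearly because test functions separate square-integrable functions
(\<open>test_functions_separate\<close>). Integration by parts against a field in \<open>V_space\<close> holds because
test functions approximate it (\<open>equilibrated_stress_identity\<close>). Finally \<open>V_h\<close> is contained in
\<open>V_space\<close>: a continuous piecewise polynomial with zero boundary values, extended by zero, is
Lipschitz, and a Lipschitz function vanishing outside \<open>\<Omega>\<close> becomes a test function when it is
flattened near the boundary and mollified (\<open>H10_of_Lipschitz\<close>, \<open>U_h0_subset_H10\<close>).\<close>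

section \<open>Semi-inner products on spaces of functions\<close>

definition lin_closed :: "('x \<Rightarrow> 'b::real_vector) set \<Rightarrow> bool" where
  "lin_closed S \<longleftrightarrow> (\<lambda>x. 0) \<in> S \<and> (\<forall>f\<in>S. \<forall>g\<in>S. (\<lambda>x. f x + g x) \<in> S) \<and>
     (\<forall>c. \<forall>f\<in>S. (\<lambda>x. c *\<^sub>R f x) \<in> S)"

lemma lin_closedI:
  assumes "(\<lambda>x. 0) \<in> S" "\<And>f g. f \<in> S \<Longrightarrow> g \<in> S \<Longrightarrow> (\<lambda>x. f x + g x) \<in> S"
    "\<And>c f. f \<in> S \<Longrightarrow> (\<lambda>x. c *\<^sub>R f x) \<in> S"
  shows "lin_closed S"
  using assms unfolding lin_closed_def by auto

lemma lin_closed_0: "lin_closed S \<Longrightarrow> (\<lambda>x. 0) \<in> S"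
  and lin_closed_add: "lin_closed S \<Longrightarrow> f \<in> S \<Longrightarrow> g \<in> S \<Longrightarrow> (\<lambda>x. f x + g x) \<in> S"
  and lin_closed_scale: "lin_closed S \<Longrightarrow> f \<in> S \<Longrightarrow> (\<lambda>x. c *\<^sub>R f x) \<in> S"
  unfolding lin_closed_def by auto

lemma lin_closed_sum:
  assumes "lin_closed S" "\<And>i. i \<in> I \<Longrightarrow> u i \<in> S"
  shows "(\<lambda>x. \<Sum>i\<in>I. c i *\<^sub>R u i x) \<in> S"
  using assms(2)
proof (induction I rule: infinite_finite_induct)
  case (insert i I)
  then show ?case
    using lin_closed_add[OF assms(1) lin_closed_scale[OF assms(1), of "u i" "c i"]] by simp
qed (use lin_closed_0[OF assms(1)] in auto)

lemma lin_closed_diff: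
  assumes "lin_closed S" "f \<in> S" "g \<in> S"
  shows "(\<lambda>x. f x - g x) \<in> S"
  using lin_closed_add[OF assms(1,2) lin_closed_scale[OF assms(1,3), of "-1"]] by simp

lemma lin_closed_Int:
  assumes "lin_closed A" "lin_closed B" shows "lin_closed (A \<inter> B)"
  using assms unfolding lin_closed_def by blast

lemma lin_closed_componentwise:
  assumes "lin_closed U"
  shows "lin_closed {u :: 'x \<Rightarrow> real ^ 'n. \<forall>i. (\<lambda>x. u x $ i) \<in> U}"
  using lin_closed_0[OF assms] lin_closed_add[OF assms] lin_closed_scale[OF assms]
  by (intro lin_closedI) simp_all

text \<open>The elements are functions, not classes modulo null sets, so the forms of interest, the
\<open>L\<^sup>2\<close> inner product and the energy, are only semidefinite: a function that vanishes almost
everywhere has length zero. The Cauchy--Schwarz inequality still makes such functions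
orthogonal to everything.\<close>

locale semi_inner =
  fixes S :: "('x \<Rightarrow> 'b::real_vector) set" and B :: "('x \<Rightarrow> 'b) \<Rightarrow> ('x \<Rightarrow> 'b) \<Rightarrow> real"
  assumes lin: "lin_closed S"
    and sym: "\<And>f g. f \<in> S \<Longrightarrow> g \<in> S \<Longrightarrow> B f g = B g f"
    and add_left: "\<And>f g h. f \<in> S \<Longrightarrow> g \<in> S \<Longrightarrow> h \<in> S \<Longrightarrow> B (\<lambda>x. f x + g x) h = B f h + B g h"
    and scale_left: "\<And>c f h. f \<in> S \<Longrightarrow> h \<in> S \<Longrightarrow> B (\<lambda>x. c *\<^sub>R f x) h = c * B f h"
    and nonneg: "\<And>f. f \<in> S \<Longrightarrow> 0 \<le> B f f"
begin

lemmas closed_add = lin_closed_add[OF lin] and closed_scale = lin_closed_scale[OF lin]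
  and closed_sum = lin_closed_sum[OF lin] and closed_diff = lin_closed_diff[OF lin]
  and closed_0 = lin_closed_0[OF lin]

lemma add_right: "f \<in> S \<Longrightarrow> g \<in> S \<Longrightarrow> h \<in> S \<Longrightarrow> B h (\<lambda>x. f x + g x) = B h f + B h g"
  using add_left[of f g h] closed_add[of f g] sym[of h f] sym[of h g] sym[of h "\<lambda>x. f x + g x"]
  by simp

lemma scale_right: "f \<in> S \<Longrightarrow> h \<in> S \<Longrightarrow> B h (\<lambda>x. c *\<^sub>R f x) = c * B h f"
  using scale_left[of f h c] closed_scale[of f c] sym[of h f] sym[of h "\<lambda>x. c *\<^sub>R f x"] by simp

lemma diff_left: "f \<in> S \<Longrightarrow> g \<in> S \<Longrightarrow> h \<in> S \<Longrightarrow> B (\<lambda>x. f x - g x) h = B f h - B g h"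
  using add_left[of f "\<lambda>x. (-1) *\<^sub>R g x" h] scale_left[of g h "-1"] closed_scale[of g "-1"] by simp

lemma diff_right: "f \<in> S \<Longrightarrow> g \<in> S \<Longrightarrow> h \<in> S \<Longrightarrow> B h (\<lambda>x. f x - g x) = B h f - B h g"
  using diff_left[of f g h] closed_diff[of f g] sym[of h f] sym[of h g] sym[of h "\<lambda>x. f x - g x"]
  by simp

lemma zero_left: "f \<in> S \<Longrightarrow> B (\<lambda>x. 0) f = 0"
  using scale_left[of f f 0] by simp

lemma sum_left:
  assumes "\<And>i. i \<in> I \<Longrightarrow> u i \<in> S" "h \<in> S"
  shows "B (\<lambda>x. \<Sum>i\<in>I. c i *\<^sub>R u i x) h = (\<Sum>i\<in>I. c i * B (u i) h)"
  using assms(1)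
proof (induction I rule: infinite_finite_induct)
  case (insert i I)
  then have "(\<lambda>x. c i *\<^sub>R u i x) \<in> S" "(\<lambda>x. \<Sum>i\<in>I. c i *\<^sub>R u i x) \<in> S"
    by (auto intro!: closed_scale closed_sum)
  then show ?case
    using insert add_left scale_left assms(2) by simp
qed (use zero_left assms(2) in auto)

lemma sum_right:
  assumes "\<And>i. i \<in> I \<Longrightarrow> u i \<in> S" "h \<in> S"
  shows "B h (\<lambda>x. \<Sum>i\<in>I. c i *\<^sub>R u i x) = (\<Sum>i\<in>I. c i * B h (u i))"
proof -
  have "B h (\<lambda>x. \<Sum>i\<in>I. c i *\<^sub>R u i x) = B (\<lambda>x. \<Sum>i\<in>I. c i *\<^sub>R u i x) h"
    using assms by (intro sym closed_sum) auto
  also have "\<dots> = (\<Sum>i\<in>I. c i * B (u i) h)"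
    using assms by (rule sum_left)
  also have "\<dots> = (\<Sum>i\<in>I. c i * B h (u i))"
    using assms by (intro sum.cong) (auto simp: sym)
  finally show ?thesis .
qed

lemma Cauchy_Schwarz:
  assumes "f \<in> S" "g \<in> S"
  shows "(B f g)\<^sup>2 \<le> B f f * B g g"
proof -
  \<comment> \<open>The squared length of \<open>f - t g\<close>, a quadratic polynomial in \<open>t\<close> that is nowhere negative.\<close>
  define q where "q t = B f f - 2 * t * B f g + t\<^sup>2 * B g g" for t
  have q: "0 \<le> q t" for t
  proof -
    have tg: "(\<lambda>x. t *\<^sub>R g x) \<in> S" using assms closed_scale by auto
    then have d: "(\<lambda>x. f x - t *\<^sub>R g x) \<in> S" using assms closed_diff by auto
    have "B (\<lambda>x. f x - t *\<^sub>R g x) (\<lambda>x. f x - t *\<^sub>R g x) = q t"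
      using assms tg d unfolding q_def
      by (simp add: diff_left diff_right scale_left scale_right sym power2_eq_square algebra_simps)
    then show ?thesis using nonneg[OF d] by simp
  qed
  show ?thesis
  proof (cases "B g g = 0")
    case True
    show ?thesis
    proof (cases "B f g = 0")
      case False
      then show ?thesis
        using q[of "(B f f + 1) / (2 * B f g)"] nonneg[OF assms(1)] True by (simp add: q_def)
    qed (simp add: True)
  next
    case False
    then have "B g g > 0" using nonneg[OF assms(2)] by simp
    moreover have "B f f - (B f g)\<^sup>2 / B g g = q (B f g / B g g)"
      using False by (simp add: q_def power2_eq_square field_simps)
    ultimately show ?thesis using q[of "B f g / B g g"] by (simp add: field_simps)
  qed
qed

lemma Cauchy_Schwarz_sqrt:
  assumes "f \<in> S" "g \<in> S"
  shows "B f g \<le> sqrt (B f f) * sqrt (B g g)"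
  using Cauchy_Schwarz[OF assms] real_le_rsqrt by (simp flip: real_sqrt_mult)

lemma null_orthogonal: "f \<in> S \<Longrightarrow> g \<in> S \<Longrightarrow> B g g = 0 \<Longrightarrow> B f g = 0"
  using Cauchy_Schwarz[of f g] by simp

lemma triangle:
  assumes "f \<in> S" "g \<in> S"
  shows "sqrt (B (\<lambda>x. f x + g x) (\<lambda>x. f x + g x)) \<le> sqrt (B f f) + sqrt (B g g)"
proof -
  have "B (\<lambda>x. f x + g x) (\<lambda>x. f x + g x) = B f f + 2 * B f g + B g g"
    using assms closed_add by (simp add: add_left add_right sym)
  also have "\<dots> \<le> (sqrt (B f f) + sqrt (B g g))\<^sup>2"
    using Cauchy_Schwarz_sqrt[OF assms] nonneg assms by (simp add: power2_sum)
  finally show ?thesis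
    using nonneg assms by (simp add: real_le_lsqrt)
qed

text \<open>Least squares without a basis: the span of a finite family need not be definite, so one
  member after the other is added and a member whose residual has length zero is skipped
  (division by zero yields the coefficient zero).\<close>

lemma projection_exists:
  fixes N :: nat
  assumes "\<And>l. l < N \<Longrightarrow> g l \<in> S" "w \<in> S"
  shows "\<exists>c. \<forall>j<N. B (\<lambda>x. w x - (\<Sum>l<N. c l *\<^sub>R g l x)) (g j) = 0"
  using assms
proof (induction N arbitrary: w)
  case 0
  then show ?case by auto
next
  case (Suc N)
  let ?sp = "\<lambda>c x. \<Sum>l<N. c l *\<^sub>R g l x"
  have gS: "\<And>l. l < N \<Longrightarrow> g l \<in> S" "g N \<in> S" using Suc.prems by auto
  obtain d where d: "\<forall>j<N. B (\<lambda>x. g N x - ?sp d x) (g j) = 0" using Suc.IH[of "g N"] gS by auto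
  obtain c where c: "\<forall>j<N. B (\<lambda>x. w x - ?sp c x) (g j) = 0" using Suc.IH[of w] gS Suc.prems by auto
  have spS: "?sp e \<in> S" for e using closed_sum[of "{..<N}" g e] gS by auto
  define r where "r = (\<lambda>x. g N x - ?sp d x)"
  define p where "p = (\<lambda>x. w x - ?sp c x)"
  have rS: "r \<in> S" and pS: "p \<in> S" unfolding r_def p_def using closed_diff spS gS Suc.prems by auto
  define t where "t = B p r / B r r"
  have tr: "t * B r r = B p r" using null_orthogonal[OF pS rS] by (simp add: t_def)
  have trS: "(\<lambda>x. t *\<^sub>R r x) \<in> S" using rS closed_scale by auto
  define c' where "c' = (\<lambda>l. if l = N then t else c l - t * d l)"
  have eq: "(\<lambda>x. w x - (\<Sum>l<Suc N. c' l *\<^sub>R g l x)) = (\<lambda>x. p x - t *\<^sub>R r x)"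
  proof
    fix x
    have "(\<Sum>l<N. c' l *\<^sub>R g l x) = ?sp c x - t *\<^sub>R ?sp d x"
      by (simp add: c'_def scaleR_diff_left sum_subtractf scaleR_sum_right)
    then show "w x - (\<Sum>l<Suc N. c' l *\<^sub>R g l x) = p x - t *\<^sub>R r x"
      by (simp add: c'_def p_def r_def algebra_simps)
  qed
  have low: "B (\<lambda>x. p x - t *\<^sub>R r x) (g j) = 0" if "j < N" for j
    using c d that gS pS rS trS by (simp add: diff_left scale_left p_def[symmetric] r_def[symmetric])
  have qS: "(\<lambda>x. p x - t *\<^sub>R r x) \<in> S" using pS trS closed_diff by auto
  have "B (\<lambda>x. p x - t *\<^sub>R r x) r = 0"
    using tr pS rS trS by (simp add: diff_left scale_left)
  moreover have "B (\<lambda>x. p x - t *\<^sub>R r x) (?sp d) = 0"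
    using low gS qS by (subst sum_right) auto
  moreover have "g N = (\<lambda>x. r x + ?sp d x)" by (auto simp: r_def)
  ultimately have "B (\<lambda>x. p x - t *\<^sub>R r x) (g N) = 0"
    using add_right[OF rS spS qS] by simp
  with low have "\<forall>j<Suc N. B (\<lambda>x. p x - t *\<^sub>R r x) (g j) = 0" by (auto simp: less_Suc_eq)
  then show ?case using eq by (intro exI[of _ c']) simp
qed

lemma projection_exists_finite:
  assumes "finite J" "\<And>l. l \<in> J \<Longrightarrow> g l \<in> S" "w \<in> S"
  shows "\<exists>c. \<forall>j\<in>J. B (\<lambda>x. w x - (\<Sum>l\<in>J. c l *\<^sub>R g l x)) (g j) = 0"
proof -
  obtain h where h: "bij_betw h {..<card J} J"
    using ex_bij_betw_nat_finite[OF assms(1)] by (auto simp: lessThan_atLeast0)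
  then have "g (h l) \<in> S" if "l < card J" for l using that assms(2) bij_betwE by blast
  then obtain c where c: "\<forall>j<card J. B (\<lambda>x. w x - (\<Sum>l<card J. c l *\<^sub>R g (h l) x)) (g (h j)) = 0"
    using projection_exists[of "card J" "\<lambda>l. g (h l)" w] assms(3) by blast
  let ?c = "\<lambda>j. c (inv_into {..<card J} h j)"
  have eq: "(\<Sum>l<card J. c l *\<^sub>R g (h l) x) = (\<Sum>l\<in>J. ?c l *\<^sub>R g l x)" for x
  proof -
    have "(\<Sum>l\<in>J. ?c l *\<^sub>R g l x) = (\<Sum>l<card J. ?c (h l) *\<^sub>R g (h l) x)"
      using sum.reindex_bij_betw[OF h, of "\<lambda>l. ?c l *\<^sub>R g l x"] by simp
    also have "\<dots> = (\<Sum>l<card J. c l *\<^sub>R g (h l) x)"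
      using bij_betw_inv_into_left[OF h] by (intro sum.cong) auto
    finally show ?thesis by simp
  qed
  have "B (\<lambda>x. w x - (\<Sum>l\<in>J. ?c l *\<^sub>R g l x)) (g j) = 0" if "j \<in> J" for j
  proof -
    have "j \<in> h ` {..<card J}" using h that by (simp add: bij_betw_def)
    then obtain i where "i < card J" "j = h i" by blast
    then show ?thesis using c by (simp only: eq)
  qed
  then show ?thesis by (intro exI[of _ ?c] ballI)
qed

text \<open>Gram--Schmidt. The last conjunct carries the induction: it makes the next residual,
  which is orthogonal to the given functions, orthogonal to the new ones too.\<close>

lemma orthonormalise:
  fixes m :: nat
  assumes "lin_closed W" "W \<subseteq> S" "\<And>l. l < m \<Longrightarrow> u l \<in> W"
    and "\<And>c. B (\<lambda>x. \<Sum>l<m. c l *\<^sub>R u l x) (\<lambda>x. \<Sum>l<m. c l *\<^sub>R u l x) = 0 \<Longrightarrow> \<forall>l<m. c l = 0"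
  shows "\<exists>e. (\<forall>l<m. e l \<in> W) \<and> (\<forall>l<m. \<forall>j<m. B (e l) (e j) = of_bool (l = j)) \<and>
    (\<forall>h\<in>S. (\<forall>l<m. B h (u l) = 0) \<longrightarrow> (\<forall>l<m. B h (e l) = 0))"
  using assms(3,4)
proof (induction m)
  case 0
  then show ?case by auto
next
  case (Suc m)
  let ?sp = "\<lambda>c x. \<Sum>l<m. c l *\<^sub>R u l x"
  have uW: "\<And>l. l < m \<Longrightarrow> u l \<in> W" "u m \<in> W" using Suc.prems by auto
  have uS: "\<And>l. l < m \<Longrightarrow> u l \<in> S" "u m \<in> S" using uW assms(2) by auto
  have ind: "\<forall>l<m. c l = 0" if "B (?sp c) (?sp c) = 0" for c
  proof -
    define c' where "c' l = (if l < m then c l else 0)" for l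
    have "(\<Sum>l<m. c' l *\<^sub>R u l x) = ?sp c x" for x
      by (intro sum.cong) (simp_all add: c'_def)
    then have eq: "(\<lambda>x. \<Sum>l<Suc m. c' l *\<^sub>R u l x) = ?sp c" by (simp add: c'_def)
    have "\<forall>l<Suc m. c' l = 0" by (rule Suc.prems(2)) (simp only: eq that)
    then show ?thesis by (auto simp: c'_def less_Suc_eq)
  qed
  obtain e where e: "\<forall>l<m. e l \<in> W" "\<forall>l<m. \<forall>j<m. B (e l) (e j) = of_bool (l = j)"
    "\<forall>h\<in>S. (\<forall>l<m. B h (u l) = 0) \<longrightarrow> (\<forall>l<m. B h (e l) = 0)"
    using Suc.IH[OF uW(1) ind] by auto
  obtain d where d: "\<forall>j<m. B (\<lambda>x. u m x - ?sp d x) (u j) = 0"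
    using projection_exists[of m u "u m"] uS by auto
  define r where "r = (\<lambda>x. u m x - ?sp d x)"
  have spW: "?sp d \<in> W" using lin_closed_sum[OF assms(1), of "{..<m}" u d] uW by auto
  have rW: "r \<in> W" unfolding r_def using lin_closed_diff[OF assms(1) uW(2) spW] .
  then have rS: "r \<in> S" using assms(2) by auto
  have "B r r \<noteq> 0"
  proof
    assume 0: "B r r = 0"
    define c' where "c' l = (if l = m then 1 else - d l)" for l
    have "(\<Sum>l<m. c' l *\<^sub>R u l x) = - ?sp d x" for x
      unfolding sum_negf[symmetric] by (intro sum.cong) (simp_all add: c'_def)
    then have eq: "(\<lambda>x. \<Sum>l<Suc m. c' l *\<^sub>R u l x) = r" by (simp add: c'_def r_def)
    have "\<forall>l<Suc m. c' l = 0" by (rule Suc.prems(2)) (simp only: eq 0)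
    then have "c' m = 0" by simp
    then show False by (simp add: c'_def)
  qed
  then have pos: "B r r > 0" using nonneg[OF rS] by simp
  define a where "a = 1 / sqrt (B r r)"
  define em where "em = (\<lambda>x. a *\<^sub>R r x)"
  define e' where "e' l = (if l = m then em else e l)" for l
  have emW: "em \<in> W" unfolding em_def using lin_closed_scale[OF assms(1) rW] .
  then have emS: "em \<in> S" using assms(2) by auto
  have eS: "e l \<in> S" if "l < m" for l using e(1) that assms(2) by auto
  have "B em em = a * (a * B r r)"
    using scale_left[OF rS emS, of a] scale_right[OF rS rS, of a] by (simp add: em_def)
  also have "\<dots> = 1" using pos by (simp add: a_def field_simps)
  finally have em1: "B em em = 1" .
  have em0: "B em (e l) = 0" if "l < m" for l
  proof -
    have "\<forall>l<m. B r (u l) = 0" using d by (simp add: r_def)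
    then have "B r (e l) = 0" using e(3) rS that by auto
    then show ?thesis unfolding em_def using scale_left[OF rS eS[OF that]] by simp
  qed
  have h0: "B h em = 0" if h: "h \<in> S" "\<forall>l<Suc m. B h (u l) = 0" for h
  proof -
    have "B h (?sp d) = 0" using h uS by (subst sum_right) auto
    then have "B h r = 0" unfolding r_def
      using diff_right[of "u m" "?sp d" h] spW assms(2) uS h by auto
    then show ?thesis unfolding em_def using scale_right[OF rS h(1)] by simp
  qed
  have em0': "B (e l) em = 0" if "l < m" for l
    using em0[OF that] sym[OF eS[OF that] emS] by simp
  show ?case
  proof (intro exI[of _ e'] conjI allI impI ballI)
    fix l assume "l < Suc m" then show "e' l \<in> W" using e emW by (auto simp: e'_def)
  next
    fix l j assume "l < Suc m" "j < Suc m" then show "B (e' l) (e' j) = of_bool (l = j)"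
      using e em1 em0 em0' by (auto simp: e'_def less_Suc_eq)
  next
    fix h l assume "h \<in> S" "\<forall>l<Suc m. B h (u l) = 0" "l < Suc m"
    then show "B h (e' l) = 0" using h0 e(3) by (auto simp: e'_def less_Suc_eq)
  qed
qed

end

text \<open>Each equation is used to eliminate one unknown that occurs in it.\<close>

lemma underdetermined_system:
  fixes A :: "'j \<Rightarrow> 'i \<Rightarrow> real"
  assumes "finite J" "finite I" "card J < card I"
  shows "\<exists>c. (\<exists>i\<in>I. c i \<noteq> 0) \<and> (\<forall>j\<in>J. (\<Sum>i\<in>I. A j i * c i) = 0)"
  using assms
proof (induction J arbitrary: I A rule: finite_induct)
  case empty
  then obtain i where "i \<in> I" by fastforce
  then show ?case by (intro exI[of _ "\<lambda>_. 1"]) auto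
next
  case (insert j J)
  show ?case
  proof (cases "\<forall>i\<in>I. A j i = 0")
    case True
    have "card J < card I" using insert by simp
    then obtain c where "\<exists>i\<in>I. c i \<noteq> 0" "\<forall>j\<in>J. (\<Sum>i\<in>I. A j i * c i) = 0"
      using insert.IH[of I A] insert.prems by blast
    then show ?thesis using True by (intro exI[of _ c]) auto
  next
    case False
    then obtain k where k: "k \<in> I" "A j k \<noteq> 0" by auto
    define A' where "A' l i = A l i - A l k * A j i / A j k" for l i
    have "card J < card (I - {k})" using insert k by simp
    then obtain c where c: "\<exists>i\<in>I-{k}. c i \<noteq> 0" "\<forall>l\<in>J. (\<Sum>i\<in>I-{k}. A' l i * c i) = 0"
      using insert.IH[of "I-{k}" A'] insert.prems by blast
    define s where "s = (\<Sum>i\<in>I-{k}. A j i * c i)"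
    define c' where "c' = c(k := - s / A j k)"
    have split: "(\<Sum>i\<in>I. A l i * c' i) = (\<Sum>i\<in>I-{k}. A l i * c i) - A l k * s / A j k" for l
    proof -
      have "(\<Sum>i\<in>I-{k}. A l i * c' i) = (\<Sum>i\<in>I-{k}. A l i * c i)"
        by (intro sum.cong) (auto simp: c'_def)
      then show ?thesis using sum.remove[OF insert.prems(1) k(1), of "\<lambda>i. A l i * c' i"]
        by (simp add: c'_def)
    qed
    have "(\<Sum>i\<in>I-{k}. A l i * c i) - A l k * s / A j k = (\<Sum>i\<in>I-{k}. A' l i * c i)" for l
      unfolding A'_def s_def
      by (simp add: algebra_simps sum_subtractf sum_distrib_left sum_divide_distrib)
    then have "(\<Sum>i\<in>I. A l i * c' i) = 0" if "l \<in> J" for l using split c(2) that by simp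
    moreover have "(\<Sum>i\<in>I. A j i * c' i) = 0" using split[of j] k by (simp add: s_def)
    moreover have "\<exists>i\<in>I. c' i \<noteq> 0" using c(1) by (auto simp: c'_def)
    ultimately show ?thesis by (intro exI[of _ c']) auto
  qed
qed

section \<open>Square-integrable functions\<close>

lemma L2_measurable: "f \<in> L2 \<Omega> \<Longrightarrow> f \<in> borel_measurable (lebesgue_on \<Omega>)"
  and L2_integrable: "f \<in> L2 \<Omega> \<Longrightarrow> integrable (lebesgue_on \<Omega>) (\<lambda>x. (norm (f x))\<^sup>2)"
  unfolding L2_def by auto

lemma L2_integrable_inner:
  assumes "f \<in> L2 \<Omega>" "g \<in> L2 \<Omega>"
  shows "integrable (lebesgue_on \<Omega>) (\<lambda>x. f x \<bullet> g x)"
proof (rule Bochner_Integration.integrable_bound)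
  show "integrable (lebesgue_on \<Omega>) (\<lambda>x. (norm (f x))\<^sup>2 + (norm (g x))\<^sup>2)"
    using assms L2_integrable by (intro Bochner_Integration.integrable_add) auto
  show "(\<lambda>x. f x \<bullet> g x) \<in> borel_measurable (lebesgue_on \<Omega>)"
    using assms L2_measurable by (intro borel_measurable_inner) auto
  show "AE x in lebesgue_on \<Omega>. norm (f x \<bullet> g x) \<le> norm ((norm (f x))\<^sup>2 + (norm (g x))\<^sup>2)"
  proof (rule AE_I2)
    fix x
    have "\<bar>f x \<bullet> g x\<bar> \<le> norm (f x) * norm (g x)" by (rule Cauchy_Schwarz_ineq2)
    also have "\<dots> \<le> (norm (f x))\<^sup>2 + (norm (g x))\<^sup>2"
      using sum_squares_bound[of "norm (f x)" "norm (g x)"]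
        mult_nonneg_nonneg[OF norm_ge_zero[of "f x"] norm_ge_zero[of "g x"]]
      by linarith
    finally show "norm (f x \<bullet> g x) \<le> norm ((norm (f x))\<^sup>2 + (norm (g x))\<^sup>2)" by simp
  qed
qed

lemma lin_closed_L2: "lin_closed (L2 \<Omega> :: (pt \<Rightarrow> 'b::euclidean_space) set)"
proof (rule lin_closedI)
  fix f g :: "pt \<Rightarrow> 'b" assume fg: "f \<in> L2 \<Omega>" "g \<in> L2 \<Omega>"
  have "integrable (lebesgue_on \<Omega>) (\<lambda>x. (norm (f x))\<^sup>2 + 2 * (f x \<bullet> g x) + (norm (g x))\<^sup>2)"
    using fg L2_integrable L2_integrable_inner
    by (intro Bochner_Integration.integrable_add integrable_mult_right) auto
  moreover have "(norm (f x + g x))\<^sup>2 = (norm (f x))\<^sup>2 + 2 * (f x \<bullet> g x) + (norm (g x))\<^sup>2" for x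
    by (simp add: power2_norm_eq_inner inner_add inner_commute)
  ultimately have "integrable (lebesgue_on \<Omega>) (\<lambda>x. (norm (f x + g x))\<^sup>2)" by (simp only:)
  moreover have "(\<lambda>x. f x + g x) \<in> borel_measurable (lebesgue_on \<Omega>)"
    using fg by (intro borel_measurable_add L2_measurable)
  ultimately show "(\<lambda>x. f x + g x) \<in> L2 \<Omega>" unfolding L2_def by blast
next
  fix c :: real and f :: "pt \<Rightarrow> 'b" assume f: "f \<in> L2 \<Omega>"
  have "integrable (lebesgue_on \<Omega>) (\<lambda>x. c\<^sup>2 * (norm (f x))\<^sup>2)"
    using f by (intro integrable_mult_right L2_integrable)
  moreover have "(\<lambda>x. c *\<^sub>R f x) \<in> borel_measurable (lebesgue_on \<Omega>)"
    using f by (intro borel_measurable_scaleR borel_measurable_const L2_measurable)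
  ultimately show "(\<lambda>x. c *\<^sub>R f x) \<in> L2 \<Omega>" by (simp add: L2_def power_mult_distrib)
qed (simp add: L2_def)

interpretation L2: semi_inner "L2 \<Omega> :: (pt \<Rightarrow> 'b::euclidean_space) set" "L2_inner \<Omega>"
proof
  show "lin_closed (L2 \<Omega> :: (pt \<Rightarrow> 'b) set)" by (rule lin_closed_L2)
  show "L2_inner \<Omega> f g = L2_inner \<Omega> g f" for f g :: "pt \<Rightarrow> 'b"
    by (simp add: L2_inner_def inner_commute)
  show "L2_inner \<Omega> (\<lambda>x. f x + g x) h = L2_inner \<Omega> f h + L2_inner \<Omega> g h"
    if "f \<in> L2 \<Omega>" "g \<in> L2 \<Omega>" "h \<in> L2 \<Omega>" for f g h :: "pt \<Rightarrow> 'b"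
    using that by (simp add: L2_inner_def inner_add_left L2_integrable_inner)
qed (simp_all add: L2_inner_def)

lemma L2_norm_square: "f \<in> L2 \<Omega> \<Longrightarrow> (L2_norm \<Omega> f)\<^sup>2 = L2_inner \<Omega> f f"
  unfolding L2_norm_def using L2.nonneg by simp

lemma L2_norm_nonneg: "f \<in> L2 \<Omega> \<Longrightarrow> 0 \<le> L2_norm \<Omega> f"
  unfolding L2_norm_def using L2.nonneg by simp

lemma L2_inner_self_eq_0:
  assumes "f \<in> L2 \<Omega>"
  shows "L2_inner \<Omega> f f = 0 \<longleftrightarrow> (AE x in lebesgue_on \<Omega>. f x = 0)"
  using integral_nonneg_eq_0_iff_AE[OF L2_integrable_inner[OF assms assms]]
  by (simp add: L2_inner_def)

lemma L2_inner_cong_AE: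
  assumes "f \<in> L2 \<Omega>" "f' \<in> L2 \<Omega>" "g \<in> L2 \<Omega>" "AE x in lebesgue_on \<Omega>. f x = f' x"
  shows "L2_inner \<Omega> f g = L2_inner \<Omega> f' g"
  unfolding L2_inner_def
  by (intro integral_cong_AE) (use assms in \<open>auto intro!: borel_measurable_inner dest: L2_measurable\<close>)

lemma L2_cong_AE:
  assumes "f \<in> L2 \<Omega>" "g \<in> borel_measurable (lebesgue_on \<Omega>)" "AE x in lebesgue_on \<Omega>. f x = g x"
  shows "g \<in> L2 \<Omega>"
proof -
  have "integrable (lebesgue_on \<Omega>) (\<lambda>x. (norm (g x))\<^sup>2) = integrable (lebesgue_on \<Omega>) (\<lambda>x. (norm (f x))\<^sup>2)"
    by (intro integrable_cong_AE) (use assms in \<open>auto dest: L2_measurable\<close>)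
  then show ?thesis using assms by (auto simp: L2_def)
qed

text \<open>The sequence enters through the distance to its limit, which is how the definition of
  \<open>H10\<close> provides it.\<close>

lemma L2_inner_tendsto:
  assumes "f \<in> L2 \<Omega>" "g \<in> L2 \<Omega>" "\<And>n. h n \<in> L2 \<Omega>"
    and lim: "(\<lambda>n. L2_norm \<Omega> (\<lambda>x. g x - h n x)) \<longlonglongrightarrow> 0"
  shows "(\<lambda>n. L2_inner \<Omega> f (h n)) \<longlonglongrightarrow> L2_inner \<Omega> f g"
proof -
  have "(\<lambda>n. L2_norm \<Omega> f * L2_norm \<Omega> (\<lambda>x. g x - h n x)) \<longlonglongrightarrow> 0"
    using tendsto_mult[OF tendsto_const lim, of "L2_norm \<Omega> f"] by simp
  moreover have "norm (L2_inner \<Omega> f (h n) - L2_inner \<Omega> f g)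
      \<le> L2_norm \<Omega> f * L2_norm \<Omega> (\<lambda>x. g x - h n x)" for n
  proof -
    have d: "(\<lambda>x. g x - h n x) \<in> L2 \<Omega>" using assms L2.closed_diff by auto
    have "L2_inner \<Omega> f (\<lambda>x. g x - h n x) = L2_inner \<Omega> f g - L2_inner \<Omega> f (h n)"
      using assms by (simp add: L2.diff_right)
    then have "(L2_inner \<Omega> f (h n) - L2_inner \<Omega> f g)\<^sup>2
        \<le> (L2_norm \<Omega> f * L2_norm \<Omega> (\<lambda>x. g x - h n x))\<^sup>2"
      using L2.Cauchy_Schwarz[OF assms(1) d] assms(1) d
      by (simp add: power_mult_distrib L2_norm_square power2_commute)
    then show ?thesis
      using L2_norm_nonneg assms(1) d by (metis abs_le_square_iff abs_of_nonneg mult_nonneg_nonneg real_norm_def)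
  qed
  ultimately have "(\<lambda>n. L2_inner \<Omega> f (h n) - L2_inner \<Omega> f g) \<longlonglongrightarrow> 0"
    by (metis (mono_tags, lifting) Lim_null_comparison always_eventually)
  then show ?thesis by (simp add: LIM_zero_iff)
qed

lemma L2_bounded:
  assumes "\<Omega> \<in> lmeasurable" "f \<in> borel_measurable (lebesgue_on \<Omega>)"
    "AE x in lebesgue_on \<Omega>. norm (f x) \<le> M"
  shows "f \<in> L2 \<Omega>"
proof -
  have "finite_measure (lebesgue_on \<Omega>)"
    using assms(1) by (rule finite_measure_lebesgue_on)
  then have "integrable (lebesgue_on \<Omega>) (\<lambda>x. M\<^sup>2)" by (simp add: finite_measure.integrable_const)
  then have "integrable (lebesgue_on \<Omega>) (\<lambda>x. (norm (f x))\<^sup>2)"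
    by (rule Bochner_Integration.integrable_bound) (use assms in \<open>auto elim!: eventually_mono intro!: power_mono\<close>)
  then show ?thesis using assms by (simp add: L2_def)
qed

text \<open>On a set of finite measure a constant is an admissible dominating function.\<close>

lemma L2_norm_dominated:
  assumes "\<Omega> \<in> lmeasurable" "\<And>n. h n \<in> borel_measurable (lebesgue_on \<Omega>)"
    "\<And>n. AE x in lebesgue_on \<Omega>. norm (h n x) \<le> M"
    "AE x in lebesgue_on \<Omega>. (\<lambda>n. h n x) \<longlonglongrightarrow> 0"
  shows "(\<lambda>n. L2_norm \<Omega> (h n)) \<longlonglongrightarrow> 0"
proof -
  interpret finite_measure "lebesgue_on \<Omega>"
    using assms(1) by (rule finite_measure_lebesgue_on)
  have "(\<lambda>n. LINT x|lebesgue_on \<Omega>. h n x \<bullet> h n x) \<longlonglongrightarrow> (LINT x|lebesgue_on \<Omega>. 0)"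
  proof (rule integral_dominated_convergence)
    show "integrable (lebesgue_on \<Omega>) (\<lambda>x. M\<^sup>2)" by (simp add: integrable_const)
    show "AE x in lebesgue_on \<Omega>. (\<lambda>n. h n x \<bullet> h n x) \<longlonglongrightarrow> 0"
      using assms(4) by eventually_elim (auto intro!: tendsto_eq_intros)
    show "AE x in lebesgue_on \<Omega>. norm (h n x \<bullet> h n x) \<le> M\<^sup>2" for n
      using assms(3)[of n] by eventually_elim (auto simp: dot_square_norm intro!: power_mono)
  qed (use assms(2) in \<open>auto intro!: borel_measurable_inner\<close>)
  then have "(\<lambda>n. sqrt (L2_inner \<Omega> (h n) (h n))) \<longlonglongrightarrow> sqrt 0"
    by (intro tendsto_real_sqrt) (simp add: L2_inner_def)
  then show ?thesis by (simp add: L2_norm_def)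
qed

lemma L2_component: "f \<in> L2 \<Omega> \<Longrightarrow> (\<lambda>x. f x $ j) \<in> L2 \<Omega>"
  for f :: "pt \<Rightarrow> 'b::euclidean_space ^ 'n"
proof -
  assume f: "f \<in> L2 \<Omega>"
  have m: "(\<lambda>x. f x $ j) \<in> borel_measurable (lebesgue_on \<Omega>)"
    by (rule borel_measurable_continuous_on[OF continuous_on_component[OF continuous_on_id] L2_measurable[OF f]])
  have "integrable (lebesgue_on \<Omega>) (\<lambda>x. (norm (f x $ j))\<^sup>2)"
    by (rule Bochner_Integration.integrable_bound[OF L2_integrable[OF f]])
      (use m in \<open>auto intro!: power_mono Finite_Cartesian_Product.norm_nth_le\<close>)
  then show ?thesis using m by (simp add: L2_def)
qed

lemma borel_measurable_vec_components:
  fixes f :: "'a \<Rightarrow> 'b::euclidean_space ^ 'n"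
  assumes "\<And>j. (\<lambda>x. f x $ j) \<in> borel_measurable M"
  shows "f \<in> borel_measurable M"
proof (subst borel_measurable_euclidean_space, rule ballI)
  fix b :: "'b^'n" assume "b \<in> Basis"
  then obtain j v where "b = axis j v" by (auto simp: Basis_vec_def)
  then show "(\<lambda>x. f x \<bullet> b) \<in> borel_measurable M"
    using assms[of j] by (simp add: inner_axis borel_measurable_inner)
qed

lemma L2_vec:
  fixes f :: "pt \<Rightarrow> 'b::euclidean_space ^ 'n"
  assumes "\<And>j. (\<lambda>x. f x $ j) \<in> L2 \<Omega>"
  shows "f \<in> L2 \<Omega>"
proof -
  have "integrable (lebesgue_on \<Omega>) (\<lambda>x. \<Sum>j\<in>UNIV. f x $ j \<bullet> f x $ j)"
    by (intro Bochner_Integration.integrable_sum L2_integrable_inner assms)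
  then have "integrable (lebesgue_on \<Omega>) (\<lambda>x. (norm (f x))\<^sup>2)"
    by (simp add: power2_norm_eq_inner inner_vec_def)
  then show ?thesis
    using borel_measurable_vec_components[of f] assms L2_measurable by (auto simp: L2_def)
qed

lemma L2_inner_components:
  fixes f g :: "pt \<Rightarrow> 'b::euclidean_space ^ 'n"
  assumes "f \<in> L2 \<Omega>" "g \<in> L2 \<Omega>"
  shows "L2_inner \<Omega> f g = (\<Sum>j\<in>UNIV. L2_inner \<Omega> (\<lambda>x. f x $ j) (\<lambda>x. g x $ j))"
  unfolding L2_inner_def inner_vec_def
  by (rule Bochner_Integration.integral_sum) (use assms L2_component L2_integrable_inner in blast)

section \<open>Smooth functions\<close>

lemma partial_deriv_eq:
  "(f has_derivative D) (at x) \<Longrightarrow> partial_deriv j f x = D (axis j 1)"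
  by (simp add: partial_deriv_def frechet_derivative_at[symmetric])

text \<open>The derivative \<open>D\<close> is supplied by the rules of calculus; uniqueness of the derivative
turns the partial derivatives, which \<open>C_k\<close> mentions, into components of \<open>D\<close>.\<close>

lemma C_k_SucI:
  assumes "\<And>x. (f has_derivative D x) (at x)" "\<And>j. C_k n (\<lambda>x. D x (axis j 1))"
  shows "C_k (Suc n) f"
proof -
  have "partial_deriv j f = (\<lambda>x. D x (axis j 1))" for j
    using partial_deriv_eq[OF assms(1)] by auto
  then show ?thesis using assms by (auto simp: differentiable_def)
qed

lemma C_k_has_derivative:
  "C_k (Suc n) f \<Longrightarrow> (f has_derivative frechet_derivative f (at x)) (at x)"
  by (simp add: frechet_derivative_works[symmetric])

lemma C_k_partial: "C_k (Suc n) f \<Longrightarrow> C_k n (\<lambda>x. frechet_derivative f (at x) (axis j 1))"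
  by (simp add: partial_deriv_def[abs_def])

lemma C_k_SucD: "C_k (Suc n) f \<Longrightarrow> C_k n f"
proof (induction n arbitrary: f)
  case 0
  then show ?case
    by (auto simp: continuous_on_eq_continuous_at intro: differentiable_imp_continuous_within)
next
  case (Suc n)
  have "\<forall>x. f differentiable at x" using Suc.prems by simp
  moreover have "\<forall>j. C_k n (partial_deriv j f)" using Suc.IH Suc.prems by auto
  ultimately show ?case by simp
qed

lemma C_k_continuous: "C_k n f \<Longrightarrow> continuous_on A f"
proof -
  have "C_k n f \<Longrightarrow> C_k 0 f" by (induction n) (use C_k_SucD in blast)+
  then show "C_k n f \<Longrightarrow> continuous_on A f" by (auto intro: continuous_on_subset)
qed

lemma C_k_const: "C_k n (\<lambda>x. c)"
proof (induction n arbitrary: c)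
  case (Suc n)
  show ?case by (rule C_k_SucI[where D = "\<lambda>_ _. 0"]) (use Suc in auto)
qed simp

lemma C_k_component: "C_k n (\<lambda>x. x $ i)"
proof (cases n)
  case (Suc m)
  show ?thesis unfolding Suc
    by (rule C_k_SucI[where D = "\<lambda>_ h. h $ i"])
      (auto intro: C_k_const bounded_linear_imp_has_derivative bounded_linear_vec_nth)
qed (auto intro: continuous_intros)

lemma C_k_add: "C_k n f \<Longrightarrow> C_k n g \<Longrightarrow> C_k n (\<lambda>x. f x + g x)"
proof (induction n arbitrary: f g)
  case (Suc n)
  show ?case
  proof (rule C_k_SucI)
    show "((\<lambda>x. f x + g x) has_derivative
        (\<lambda>h. frechet_derivative f (at x) h + frechet_derivative g (at x) h)) (at x)" for x
      using Suc.prems C_k_has_derivative by (intro has_derivative_add) blast+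
  qed (intro Suc.IH C_k_partial Suc.prems)
qed (auto intro: continuous_on_add)

lemma C_k_mult: "C_k n f \<Longrightarrow> C_k n g \<Longrightarrow> C_k n (\<lambda>x. f x * g x)"
proof (induction n arbitrary: f g)
  case (Suc n)
  show ?case
  proof (rule C_k_SucI)
    show "((\<lambda>x. f x * g x) has_derivative
        (\<lambda>h. f x * frechet_derivative g (at x) h + frechet_derivative f (at x) h * g x)) (at x)" for x
      using Suc.prems C_k_has_derivative by (intro has_derivative_mult) blast+
  qed (intro C_k_add Suc.IH C_k_partial Suc.prems C_k_SucD)
qed (auto intro: continuous_on_mult)

lemma C_k_sum: "(\<And>i. i \<in> I \<Longrightarrow> C_k n (f i)) \<Longrightarrow> C_k n (\<lambda>x. \<Sum>i\<in>I. f i x)"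
  by (induction I rule: infinite_finite_induct) (auto intro: C_k_const C_k_add)

lemma C_k_prod: "(\<And>i. i \<in> I \<Longrightarrow> C_k n (f i)) \<Longrightarrow> C_k n (\<lambda>x. \<Prod>i\<in>I. f i x)"
  by (induction I rule: infinite_finite_induct) (auto intro: C_k_const C_k_mult)

lemma C_k_power: "C_k n f \<Longrightarrow> C_k n (\<lambda>x. f x ^ m)"
  by (induction m) (auto intro: C_k_const C_k_mult)

lemma polys_C_k: "q \<in> polys r \<Longrightarrow> C_k n q"
proof -
  assume "q \<in> polys r"
  then obtain c where "q = (\<lambda>x. \<Sum>\<alpha>\<in>{\<alpha>::3 \<Rightarrow> nat. (\<Sum>i\<in>UNIV. \<alpha> i) \<le> r}. c \<alpha> * (\<Prod>i\<in>UNIV. (x $ i) ^ \<alpha> i))"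
    unfolding polys_def by auto
  then show "C_k n q"
    by (simp only:) (intro C_k_sum C_k_mult C_k_const C_k_prod C_k_power C_k_component)
qed

lemma classical_grad_eqI:
  "(f has_derivative (\<lambda>h. l \<bullet> h)) (at x) \<Longrightarrow> classical_grad f x = l"
  by (simp add: classical_grad_def vec_eq_iff partial_deriv_eq inner_axis)

lemma has_derivative_classical_grad:
  assumes "f differentiable (at x)"
  shows "(f has_derivative (\<lambda>h. classical_grad f x \<bullet> h)) (at x)"
proof -
  let ?D = "frechet_derivative f (at x)"
  have D: "(f has_derivative ?D) (at x)" using assms frechet_derivative_works by blast
  then have lin: "linear ?D" using has_derivative_linear by blast
  have "?D h = classical_grad f x \<bullet> h" for h
  proof -
    have "?D h = ?D (\<Sum>j\<in>UNIV. (h $ j) *\<^sub>R axis j 1)"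
      using basis_expansion[of h] by (simp add: scalar_mult_eq_scaleR)
    also have "\<dots> = (\<Sum>j\<in>UNIV. h $ j * ?D (axis j 1))"
      using lin by (simp add: linear_sum linear_scale)
    finally show ?thesis
      by (simp add: classical_grad_def partial_deriv_def inner_vec_def mult.commute)
  qed
  then have "?D = (\<lambda>h. classical_grad f x \<bullet> h)" by auto
  then show ?thesis using D by simp
qed

lemma classical_grad_continuous:
  assumes "C_k (Suc n) f"
  shows "continuous_on A (classical_grad f)"
proof -
  have "continuous_on A (\<lambda>x. \<chi> j. partial_deriv j f x)"
    by (intro continuous_on_vec_lambda C_k_continuous[of n]) (use assms in simp)
  then show ?thesis by (simp add: classical_grad_def[abs_def])
qed

text \<open>The functions \<open>t \<mapsto> p(1/t) exp(-c/t)\<close>, cut off at zero: admitting every polynomial \<open>p\<close>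
  makes the family closed under differentiation, so that smoothness is a plain induction.\<close>

definition edge :: "real \<Rightarrow> real poly \<Rightarrow> real \<Rightarrow> real" where
  "edge c p t = (if t > 0 then poly p (1 / t) * exp (- c / t) else 0)"

lemma poly_times_exp_tendsto_0:
  assumes "c > 0"
  shows "((\<lambda>s::real. poly p s * exp (- c * s)) \<longlongrightarrow> 0) at_top"
proof -
  have "((\<lambda>s. s ^ k * exp (- c * s)) \<longlongrightarrow> 0) at_top" for k
  proof -
    have "((\<lambda>s. (c * s) ^ k / exp (c * s)) \<longlongrightarrow> 0) at_top"
      by (rule filterlim_compose[OF tendsto_power_div_exp_0])
        (use assms in \<open>auto intro: filterlim_tendsto_pos_mult_at_top[OF tendsto_const _ filterlim_ident]\<close>)
    then have "((\<lambda>s. inverse (c ^ k) * ((c * s) ^ k / exp (c * s))) \<longlongrightarrow> inverse (c ^ k) * 0) at_top"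
      by (intro tendsto_mult tendsto_const)
    then show ?thesis using assms by (simp add: power_mult_distrib exp_minus field_simps)
  qed
  then have "((\<lambda>s. \<Sum>i\<le>degree p. coeff p i * (s ^ i * exp (- c * s))) \<longlongrightarrow> (\<Sum>i\<le>degree p. coeff p i * 0)) at_top"
    by (intro tendsto_sum tendsto_mult tendsto_const)
  then show ?thesis by (simp add: poly_altdef sum_distrib_right mult.assoc)
qed

lemma edge_has_derivative:
  assumes "c > 0"
  shows "(edge c p has_real_derivative edge c ([:0, 0, 1:] * (smult c p - pderiv p)) t) (at t)"
proof -
  consider "t > 0" | "t < 0" | "t = 0" by linarith
  then show ?thesis
  proof cases
    case 1
    have "((\<lambda>t. poly p (1 / t) * exp (- c / t)) has_real_derivative
        edge c ([:0, 0, 1:] * (smult c p - pderiv p)) t) (at t)"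
      using 1 by (auto intro!: derivative_eq_intros DERIV_chain2[OF poly_DERIV]
          simp: edge_def field_simps power2_eq_square)
    then show ?thesis
      by (rule has_field_derivative_transform_within_open[of _ _ _ "{0<..}"])
        (use 1 in \<open>auto simp: edge_def\<close>)
  next
    case 2
    have "((\<lambda>_. 0) has_real_derivative edge c ([:0, 0, 1:] * (smult c p - pderiv p)) t) (at t)"
      using 2 by (simp add: edge_def)
    then show ?thesis
      by (rule has_field_derivative_transform_within_open[of _ _ _ "{..<0}"])
        (use 2 in \<open>auto simp: edge_def\<close>)
  next
    case 3
    have "((\<lambda>s. poly (pCons 0 p) s * exp (- c * s)) \<longlongrightarrow> 0) at_top"
      by (rule poly_times_exp_tendsto_0[OF assms])
    then have "((\<lambda>s. edge c p (inverse s) / inverse s) \<longlongrightarrow> 0) at_top"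
      by (rule Lim_transform_eventually)
        (use eventually_gt_at_top[of 0] in \<open>eventually_elim, auto simp: edge_def field_simps\<close>)
    then have right: "((\<lambda>h. edge c p h / h) \<longlongrightarrow> 0) (at_right 0)"
      by (simp add: filterlim_at_right_to_top)
    have "((\<lambda>h::real. 0::real) \<longlongrightarrow> 0) (at_left 0)" by simp
    then have left: "((\<lambda>h. edge c p h / h) \<longlongrightarrow> 0) (at_left 0)"
      by (rule Lim_transform_eventually) (auto simp: edge_def eventually_at_filter)
    have "((\<lambda>h. edge c p h / h) \<longlongrightarrow> 0) (at 0)"
      using left right by (rule filterlim_split_at_real)
    then show ?thesis using 3 by (simp add: edge_def has_field_derivative_iff)
  qed
qed

lemma C_k_edge:
  assumes "c > 0" "C_k n f"
  shows "C_k n (\<lambda>x. edge c p (f x))"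
  using assms(2)
proof (induction n arbitrary: p)
  case 0
  have "continuous_on UNIV (edge c p)"
    by (simp add: continuous_on_eq_continuous_at DERIV_isCont[OF edge_has_derivative[OF assms(1)]])
  then show ?case using 0 by (auto intro: continuous_on_compose2)
next
  case (Suc n)
  let ?q = "[:0, 0, 1:] * (smult c p - pderiv p)"
  show ?case
  proof (rule C_k_SucI)
    show "((\<lambda>x. edge c p (f x)) has_derivative
        (\<lambda>h. edge c ?q (f x) * frechet_derivative f (at x) h)) (at x)" for x
      using has_derivative_compose[OF C_k_has_derivative[OF Suc.prems]
          edge_has_derivative[OF assms(1), of p "f x", unfolded has_field_derivative_def]] .
  qed (intro C_k_mult Suc.IH C_k_partial Suc.prems C_k_SucD[OF Suc.prems])
qed

text \<open>For \<open>c \<rightarrow> 0\<close> these bumps increase to the indicator function of the open box.\<close>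

definition box_bump :: "real \<Rightarrow> pt \<Rightarrow> pt \<Rightarrow> pt \<Rightarrow> real" where
  "box_bump c a b x = (\<Prod>i\<in>UNIV. edge c 1 (x $ i - a $ i) * edge c 1 (b $ i - x $ i))"

lemma C_k_box_bump: "c > 0 \<Longrightarrow> C_k n (box_bump c a b)"
proof -
  assume c: "c > 0"
  have "C_k n (\<lambda>x. x $ i - a $ i)" for i
    using C_k_add[OF C_k_component C_k_const[of _ "- a $ i"], of n i] by simp
  moreover have "C_k n (\<lambda>x. b $ i - x $ i)" for i
    using C_k_add[OF C_k_const[of n "b $ i"] C_k_mult[OF C_k_const[of n "-1"] C_k_component[of n i]]] by simp
  ultimately show ?thesis
    unfolding box_bump_def[abs_def] using c by (intro C_k_prod C_k_mult C_k_edge)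
qed

lemma edge_1_bounds: "c > 0 \<Longrightarrow> 0 \<le> edge c 1 t \<and> edge c 1 t \<le> 1"
  by (simp add: edge_def)

lemma box_bump_bounds: "c > 0 \<Longrightarrow> 0 \<le> box_bump c a b x \<and> box_bump c a b x \<le> 1"
  unfolding box_bump_def
  by (intro conjI prod_nonneg prod_le_1) (auto simp: edge_1_bounds intro!: mult_le_one)

lemma box_bump_outside: "x \<notin> box a b \<Longrightarrow> box_bump c a b x = 0"
  by (auto simp: box_bump_def mem_box_cart edge_def)

lemma box_bump_inside: "x \<in> box a b \<Longrightarrow> 0 < box_bump c a b x"
  by (auto simp: box_bump_def mem_box_cart edge_def intro!: prod_pos)

lemma box_bump_tendsto_indicator:
  "(\<lambda>n. box_bump (inverse (real (Suc n))) a b x) \<longlonglongrightarrow> indicator (box a b) x"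
proof (cases "x \<in> box a b")
  case True
  have "(\<lambda>n. edge (inverse (real (Suc n))) 1 t) \<longlonglongrightarrow> 1" if "t > 0" for t :: real
  proof -
    have "(\<lambda>n. exp (- inverse (real (Suc n)) / t)) \<longlonglongrightarrow> exp (- 0 / t)"
      by (intro tendsto_intros LIMSEQ_inverse_real_of_nat) (use that in auto)
    then show ?thesis using that by (simp add: edge_def)
  qed
  then have "(\<lambda>n. box_bump (inverse (real (Suc n))) a b x) \<longlonglongrightarrow> (\<Prod>i\<in>(UNIV::3 set). 1 * 1)"
    unfolding box_bump_def using True by (intro tendsto_prod tendsto_mult) (auto simp: mem_box_cart)
  then show ?thesis using True by simp
qed (simp add: box_bump_outside)

lemma compact_closure_subset:
  fixes A :: "'a::t2_space set"
  assumes "closure A \<subseteq> K" "compact K"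
  shows "compact (closure A)"
  using compact_Int_closed[OF assms(2) closed_closure[of A]] assms(1) by (simp add: Int_absorb1)

lemma closure_support_cbox:
  assumes "\<And>x. x \<notin> cbox a b \<Longrightarrow> \<psi> x = 0"
  shows "compact (closure {x. \<psi> x \<noteq> 0})" "closure {x. \<psi> x \<noteq> 0} \<subseteq> cbox a b"
proof -
  have "{x. \<psi> x \<noteq> 0} \<subseteq> cbox a b" using assms by auto
  then show sub: "closure {x. \<psi> x \<noteq> 0} \<subseteq> cbox a b" by (intro closure_minimal) auto
  then show "compact (closure {x. \<psi> x \<noteq> 0})"
    by (rule compact_closure_subset) simp
qed

lemma box_bump_test_function:
  assumes "c > 0" "cbox a b \<subseteq> \<Omega>"
  shows "box_bump c a b \<in> test_functions \<Omega>"
  using assms closure_support_cbox[of a b "box_bump c a b"] C_k_box_bump box_bump_outside box_subset_cbox[of a b]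
  unfolding test_functions_def by blast

section \<open>Test functions separate square-integrable functions\<close>

lemma test_function_C_k: "\<psi> \<in> test_functions \<Omega> \<Longrightarrow> C_k n \<psi>"
  by (simp add: test_functions_def)

lemma test_function_outside:
  "\<psi> \<in> test_functions \<Omega> \<Longrightarrow> x \<notin> \<Omega> \<Longrightarrow> \<psi> x = 0"
  using closure_subset[of "{x. \<psi> x \<noteq> 0}"] unfolding test_functions_def by blast

lemma test_function_bounded:
  assumes "\<psi> \<in> test_functions \<Omega>"
  shows "\<exists>M. \<forall>x. \<bar>\<psi> x\<bar> \<le> M"
proof -
  let ?S = "closure {x. \<psi> x \<noteq> 0}"
  have "compact (\<psi> ` ?S)"
    using assms C_k_continuous[OF test_function_C_k[OF assms, of 0]]
    by (intro compact_continuous_image) (auto simp: test_functions_def)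
  then obtain M where M: "\<And>y. y \<in> \<psi> ` ?S \<Longrightarrow> norm y \<le> M"
    using compact_imp_bounded bounded_iff by metis
  have "\<bar>\<psi> x\<bar> \<le> max M 0" for x
  proof (cases "\<psi> x = 0")
    case False
    then have "\<psi> x \<in> \<psi> ` ?S" using closure_subset[of "{x. \<psi> x \<noteq> 0}"] by blast
    then show ?thesis using M[of "\<psi> x"] by simp
  qed simp
  then show ?thesis by blast
qed

lemma continuous_imp_measurable_lebesgue_on:
  fixes f :: "pt \<Rightarrow> 'b::euclidean_space"
  assumes "continuous_on UNIV f"
  shows "f \<in> borel_measurable (lebesgue_on \<Omega>)"
proof -
  have "f \<in> borel_measurable borel" using assms by (rule borel_measurable_continuous_onI)
  then have "f \<in> borel_measurable lebesgue" by (simp add: measurable_completion)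
  then show ?thesis by (rule measurable_restrict_space1)
qed

lemma test_function_L2:
  assumes "\<Omega> \<in> lmeasurable" "\<psi> \<in> test_functions \<Omega>"
  shows "\<psi> \<in> L2 \<Omega>"
proof -
  obtain M where "\<forall>x. \<bar>\<psi> x\<bar> \<le> M" using test_function_bounded[OF assms(2)] by auto
  then show ?thesis
    using assms by (intro L2_bounded continuous_imp_measurable_lebesgue_on C_k_continuous test_function_C_k) auto
qed

lemma partial_deriv_test_function:
  assumes "\<psi> \<in> test_functions \<Omega>"
  shows "partial_deriv j \<psi> \<in> test_functions \<Omega>"
proof -
  let ?S = "closure {x. \<psi> x \<noteq> 0}"
  have "partial_deriv j \<psi> x = 0" if "x \<notin> ?S" for x
  proof -
    have "((\<lambda>_. 0) has_derivative (\<lambda>h. 0)) (at x)" by simp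
    then have "(\<psi> has_derivative (\<lambda>h. 0)) (at x)"
      by (rule has_derivative_transform_within_open[where s = "- ?S"])
        (use that closure_subset[of "{x. \<psi> x \<noteq> 0}"] in auto)
    then show ?thesis by (simp add: partial_deriv_eq)
  qed
  then have "{x. partial_deriv j \<psi> x \<noteq> 0} \<subseteq> ?S" by auto
  then have sub: "closure {x. partial_deriv j \<psi> x \<noteq> 0} \<subseteq> ?S" by (intro closure_minimal) auto
  have "compact ?S" "?S \<subseteq> \<Omega>" using assms by (auto simp: test_functions_def)
  then have "compact (closure {x. partial_deriv j \<psi> x \<noteq> 0})"
    using compact_closure_subset[OF sub] by simp
  moreover have "C_k n (partial_deriv j \<psi>)" for n
    using test_function_C_k[OF assms, of "Suc n"] by simp
  ultimately show ?thesis using sub \<open>?S \<subseteq> \<Omega>\<close> by (auto simp: test_functions_def)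
qed

lemma test_function_0: "(\<lambda>x. 0) \<in> test_functions \<Omega>"
  by (simp add: test_functions_def C_k_const)

lemma test_function_mult:
  assumes "\<psi> \<in> test_functions \<Omega>" "\<And>n. C_k n f"
  shows "(\<lambda>x. f x * \<psi> x) \<in> test_functions \<Omega>"
proof -
  have "closure {x. f x * \<psi> x \<noteq> 0} \<subseteq> closure {x. \<psi> x \<noteq> 0}" by (intro closure_mono) auto
  moreover from this have "compact (closure {x. f x * \<psi> x \<noteq> 0})"
    by (rule compact_closure_subset) (use assms(1) in \<open>simp only: test_functions_def mem_Collect_eq\<close>)
  ultimately show ?thesis using assms by (auto simp: test_functions_def intro!: C_k_mult)
qed

lemma test_function_add:
  assumes "\<psi> \<in> test_functions \<Omega>" "\<phi> \<in> test_functions \<Omega>"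
  shows "(\<lambda>x. \<psi> x + \<phi> x) \<in> test_functions \<Omega>"
proof -
  have "closure {x. \<psi> x + \<phi> x \<noteq> 0} \<subseteq> closure ({x. \<psi> x \<noteq> 0} \<union> {x. \<phi> x \<noteq> 0})"
    by (intro closure_mono) auto
  then have sub: "closure {x. \<psi> x + \<phi> x \<noteq> 0} \<subseteq> closure {x. \<psi> x \<noteq> 0} \<union> closure {x. \<phi> x \<noteq> 0}"
    by (simp add: closure_Un)
  moreover have "compact (closure {x. \<psi> x \<noteq> 0} \<union> closure {x. \<phi> x \<noteq> 0})"
    using assms by (intro compact_Un) (auto simp: test_functions_def)
  ultimately have "compact (closure {x. \<psi> x + \<phi> x \<noteq> 0})"
    by (rule compact_closure_subset)
  then show ?thesis using assms sub by (auto simp: test_functions_def intro!: C_k_add)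
qed

lemma indicator_measurable_lebesgue_on:
  fixes A :: "pt set"
  assumes "A \<in> sets borel"
  shows "(indicator A :: pt \<Rightarrow> real) \<in> borel_measurable (lebesgue_on \<Omega>)"
  using assms by (intro measurable_restrict_space1 borel_measurable_indicator) simp

lemma L2_imp_integrable:
  assumes "\<Omega> \<in> lmeasurable" "f \<in> L2 \<Omega>"
  shows "integrable (lebesgue_on \<Omega>) (f :: pt \<Rightarrow> real)"
proof -
  have "(\<lambda>x. 1::real) \<in> L2 \<Omega>" using assms by (intro L2_bounded[where M = 1]) auto
  then show ?thesis using L2_integrable_inner[OF assms(2), of "\<lambda>x. 1"] by simp
qed

text \<open>The box bumps are bounded by one, so dominated convergence carries the hypothesis from the
bumps to the indicator of the box.\<close>

lemma integral_box_eq_0: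
  assumes "\<Omega> \<in> lmeasurable" "f \<in> L2 \<Omega>" "cbox a b \<subseteq> \<Omega>"
    and test: "\<And>\<psi>. \<psi> \<in> test_functions \<Omega> \<Longrightarrow> (LINT x|lebesgue_on \<Omega>. f x * \<psi> x) = 0"
  shows "(LINT x|lebesgue_on \<Omega>. f x * indicator (box a b) x) = (0::real)"
proof -
  let ?c = "\<lambda>n. inverse (real (Suc n))"
  have "(\<lambda>n. LINT x|lebesgue_on \<Omega>. f x * box_bump (?c n) a b x)
      \<longlonglongrightarrow> (LINT x|lebesgue_on \<Omega>. f x * indicator (box a b) x)"
  proof (rule integral_dominated_convergence[where w = "\<lambda>x. \<bar>f x\<bar>"])
    show "integrable (lebesgue_on \<Omega>) (\<lambda>x. \<bar>f x\<bar>)"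
      using L2_imp_integrable[OF assms(1,2)] by (rule integrable_abs)
    have "box_bump (?c n) a b \<in> borel_measurable (lebesgue_on \<Omega>)" for n
      by (intro continuous_imp_measurable_lebesgue_on C_k_continuous C_k_box_bump) simp
    then show "(\<lambda>x. f x * box_bump (?c n) a b x) \<in> borel_measurable (lebesgue_on \<Omega>)" for n
      using L2_measurable[OF assms(2)] by (intro borel_measurable_times)
    show "(\<lambda>x. f x * indicator (box a b) x) \<in> borel_measurable (lebesgue_on \<Omega>)"
      using L2_measurable[OF assms(2)] by (intro borel_measurable_times indicator_measurable_lebesgue_on) auto
    show "AE x in lebesgue_on \<Omega>. norm (f x * box_bump (?c n) a b x) \<le> \<bar>f x\<bar>" for n
      using box_bump_bounds[of "?c n" a b] by (auto simp: abs_mult intro!: mult_left_le)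
    show "AE x in lebesgue_on \<Omega>. (\<lambda>n. f x * box_bump (?c n) a b x) \<longlonglongrightarrow> f x * indicator (box a b) x"
      by (intro AE_I2 tendsto_mult tendsto_const box_bump_tendsto_indicator)
  qed
  moreover have "(LINT x|lebesgue_on \<Omega>. f x * box_bump (?c n) a b x) = 0" for n
    by (rule test[OF box_bump_test_function]) (use assms in auto)
  ultimately show ?thesis by (simp add: LIMSEQ_const_iff)
qed

text \<open>A box meets a fixed box \<open>box a b\<close> in a box that again has its closure in \<open>\<Omega>\<close>. Boxes
form an intersection-stable generator of the Borel sets, so the vanishing of the integral of
\<open>f\<close> over subboxes of \<open>box a b\<close> spreads to its Borel subsets; a Lebesgue measurable set
differs from a Borel set by a null set.\<close>

lemma AE_0_on_box:
  assumes "\<Omega> \<in> lmeasurable" "f \<in> L2 \<Omega>" "cbox a b \<subseteq> \<Omega>"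
    and test: "\<And>\<psi>. \<psi> \<in> test_functions \<Omega> \<Longrightarrow> (LINT x|lebesgue_on \<Omega>. f x * \<psi> x) = 0"
  shows "AE x in lebesgue_on \<Omega>. x \<in> box a b \<longrightarrow> f x = (0::real)"
proof -
  let ?M = "lebesgue_on \<Omega>"
  interpret finite_measure ?M using assms(1) by (rule finite_measure_lebesgue_on)
  \<comment> \<open>After this restriction only boxes with closure inside \<open>\<Omega>\<close> matter.\<close>
  define F where "F x = f x * indicator (box a b) x" for x
  note meas = indicator_measurable_lebesgue_on[of _ \<Omega>]
  have Fm: "F \<in> borel_measurable ?M"
    unfolding F_def using L2_measurable[OF assms(2)] meas[of "box a b"] by (intro borel_measurable_times) auto
  have Fint: "integrable ?M F"
    by (rule Bochner_Integration.integrable_bound[OF L2_imp_integrable[OF assms(1,2)] Fm])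
      (auto simp: F_def indicator_def)
  have FA: "integrable ?M (\<lambda>x. F x * indicator A x)" if "A \<in> sets borel" for A
    by (rule Bochner_Integration.integrable_bound[OF Fint borel_measurable_times[OF Fm meas[OF that]]])
      (auto simp: indicator_def)
  have borel_zero: "(LINT x|?M. F x * indicator A x) = 0" if A: "A \<in> sets borel" for A
  proof -
    have "Int_stable (range (\<lambda>(a, b). box a b :: pt set))"
      by (auto simp: Int_stable_def box_Int_box)
    moreover have "(range (\<lambda>(a, b). box a b :: pt set)) \<subseteq> Pow UNIV" by auto
    moreover have "A \<in> sigma_sets UNIV (range (\<lambda>(a, b). box a b))"
      using A unfolding borel_eq_box by simp
    ultimately show ?thesis
    proof (induction rule: sigma_sets_induct_disjoint)
      case (basic A)
      then obtain p q where A: "A = box p q" by auto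
      obtain p' q' where pq: "box a b \<inter> box p q = box p' q'" using box_Int_box[of a b p q] by blast
      show ?case
      proof (cases "box p' q' = {}")
        case True
        then have "(\<lambda>x. F x * indicator A x) = (\<lambda>x. 0)" using pq A True by (auto simp: F_def indicator_def fun_eq_iff)
        then show ?thesis by (simp only: integral_zero)
      next
        case False
        then have "cbox p' q' = closure (box p' q')" by simp
        also have "\<dots> \<subseteq> cbox a b"
          using pq box_subset_cbox[of a b] by (intro closure_minimal) auto
        finally have "cbox p' q' \<subseteq> \<Omega>" using assms(3) by auto
        then have "(LINT x|?M. f x * indicator (box p' q') x) = 0"
          using integral_box_eq_0 assms by blast
        moreover have "F x * indicator A x = f x * indicator (box p' q') x" for x
          unfolding pq[symmetric] A F_def by (auto simp: indicator_def)
        ultimately show ?thesis by simp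
      qed
    next
      case empty
      then show ?case by simp
    next
      case (compl A)
      then have [measurable]: "A \<in> sets borel" by (simp add: borel_eq_box)
      have "(LINT x|?M. F x * indicator (UNIV - A) x) = (LINT x|?M. F x - F x * indicator A x)"
        by (intro Bochner_Integration.integral_cong) (auto simp: indicator_def)
      also have "\<dots> = (LINT x|?M. F x) - (LINT x|?M. F x * indicator A x)"
        using Fint FA by (intro Bochner_Integration.integral_diff) auto
      also have "(LINT x|?M. F x) = 0"
        unfolding F_def using integral_box_eq_0 assms by blast
      finally show ?case using compl by simp
    next
      case (union A)
      then have Ai: "A i \<in> sets borel" for i by (auto simp: borel_eq_box)
      have "(\<lambda>n. LINT x|?M. F x * indicator (\<Union>i<n. A i) x) \<longlonglongrightarrow> (LINT x|?M. F x * indicator (\<Union>i. A i) x)"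
      proof (rule integral_dominated_convergence[where w = "\<lambda>x. \<bar>F x\<bar>"])
        show "AE x in ?M. (\<lambda>n. F x * indicator (\<Union>i<n. A i) x) \<longlonglongrightarrow> F x * indicator (\<Union>i. A i) x"
          by (intro AE_I2 tendsto_mult tendsto_const LIMSEQ_indicator_UN)
        have m: "(\<Union>i. A i) \<in> sets borel" "(\<Union>i<n. A i) \<in> sets borel" for n
          using Ai by auto
        show "(\<lambda>x. F x * indicator (\<Union>i. A i) x) \<in> borel_measurable ?M"
          using Fm meas[OF m(1)] by (rule borel_measurable_times)
        show "(\<lambda>x. F x * indicator (\<Union>i<n. A i) x) \<in> borel_measurable ?M" for n
          using Fm meas[OF m(2)] by (rule borel_measurable_times)
      qed (use Fint in \<open>auto simp: indicator_def\<close>)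
      moreover have "(LINT x|?M. F x * indicator (\<Union>i<n. A i) x) = 0" for n
      proof -
        have "(\<lambda>x. F x * indicator (\<Union>i<n. A i) x) = (\<lambda>x. \<Sum>i<n. F x * indicator (A i) x)"
        proof
          fix x
          have "disjoint_family_on A {..<n}"
            using union(1) by (auto simp: disjoint_family_on_def)
          then show "F x * indicator (\<Union>i<n. A i) x = (\<Sum>i<n. F x * indicator (A i) x)"
            by (simp add: indicator_UN_disjoint sum_distrib_left)
        qed
        then have "(LINT x|?M. F x * indicator (\<Union>i<n. A i) x) = (\<Sum>i<n. LINT x|?M. F x * indicator (A i) x)"
          by (simp only:) (intro Bochner_Integration.integral_sum FA Ai)
        then show ?thesis using union.IH by simp
      qed
      ultimately show ?case by (simp add: LIMSEQ_const_iff)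
    qed
  qed
  have "AE x in ?M. F x = 0"
  proof (rule density_zero[OF Fint])
    fix A assume "A \<in> sets ?M"
    then obtain A' where A': "A' \<in> sets lebesgue" "A = \<Omega> \<inter> A'" by (auto simp: sets_restrict_space)
    then obtain S N N' where S: "A' = S \<union> N" "N \<subseteq> N'" "N' \<in> null_sets lborel" "S \<in> sets lborel"
      by (elim sets_completionE)
    have "AE x in lebesgue. x \<notin> N'" using S(3) by (intro AE_not_in null_sets_completionI)
    then have ae: "AE x in ?M. x \<notin> N'"
      using assms(1) by (subst AE_restrict_space_iff) auto
    have "(LINT x|?M. indicator A x *\<^sub>R F x) = (LINT x|?M. F x * indicator S x)"
    proof (rule integral_cong_AE)
      show "AE x in ?M. indicator A x *\<^sub>R F x = F x * indicator S x"
        using ae AE_space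
      proof eventually_elim
        case (elim x)
        then show ?case using A' S by (auto simp: indicator_def space_restrict_space)
      qed
      show "(\<lambda>x. indicator A x *\<^sub>R F x) \<in> borel_measurable ?M"
        using Fm \<open>A \<in> sets ?M\<close> by (intro borel_measurable_scaleR borel_measurable_indicator)
      show "(\<lambda>x. F x * indicator S x) \<in> borel_measurable ?M"
        using Fm meas[of S] S by (intro borel_measurable_times) auto
    qed
    also have "\<dots> = 0" using borel_zero[of S] S by simp
    finally show "set_lebesgue_integral ?M A F = 0" by (simp add: set_lebesgue_integral_def)
  qed
  then show ?thesis by eventually_elim (auto simp: F_def)
qed

text \<open>The fundamental lemma of the calculus of variations: an open set is a countable union of
closed boxes, whose faces are null sets. It makes weak gradients and weak divergences unique
up to null sets.\<close>

lemma test_functions_separate: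
  assumes "open \<Omega>" "\<Omega> \<in> lmeasurable" "f \<in> L2 \<Omega>"
    and test: "\<And>\<psi>. \<psi> \<in> test_functions \<Omega> \<Longrightarrow> (LINT x|lebesgue_on \<Omega>. f x * \<psi> x) = 0"
  shows "AE x in lebesgue_on \<Omega>. f x = (0::real)"
proof -
  obtain \<D> where D: "countable \<D>" "\<D> \<subseteq> Pow \<Omega>" "\<And>X. X \<in> \<D> \<Longrightarrow> \<exists>a b. X = cbox a b" "\<Union>\<D> = \<Omega>"
    using open_countable_Union_open_cbox[OF assms(1)] by metis
  have "AE x in lebesgue_on \<Omega>. x \<in> X \<longrightarrow> f x = 0" if XD: "X \<in> \<D>" for X
  proof -
    obtain a b where X: "X = cbox a b" using D(3)[OF XD] by auto
    then have "cbox a b \<subseteq> \<Omega>" using D(2) XD by auto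
    then have "AE x in lebesgue_on \<Omega>. x \<in> box a b \<longrightarrow> f x = 0"
      using AE_0_on_box assms by blast
    moreover have "AE x in lebesgue_on \<Omega>. x \<notin> cbox a b - box a b"
    proof -
      have "cbox a b - box a b \<in> null_sets lebesgue"
        using negligible_frontier_interval[of a b] by (simp add: negligible_iff_null_sets)
      then have "AE x in lebesgue. x \<notin> cbox a b - box a b" by (rule AE_not_in)
      then show ?thesis using assms(2) by (subst AE_restrict_space_iff) auto
    qed
    ultimately show ?thesis by eventually_elim (auto simp: X)
  qed
  then have "AE x in lebesgue_on \<Omega>. \<forall>X\<in>\<D>. x \<in> X \<longrightarrow> f x = 0"
    using D(1) by (intro AE_ball_countable') auto
  then show ?thesis
    using AE_space
  proof eventually_elim
    case (elim x)
    then show ?case using D(4) by (auto simp: space_restrict_space)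
  qed
qed

section \<open>Weak derivatives\<close>

locale open_domain =
  fixes \<Omega> :: "pt set"
  assumes open_dom: "open \<Omega>" and meas_dom: "\<Omega> \<in> lmeasurable"
begin

lemma L2_test_integrable:
  assumes "f \<in> L2 \<Omega>" "\<psi> \<in> test_functions \<Omega>"
  shows "integrable (lebesgue_on \<Omega>) (\<lambda>x. f x * \<psi> x)"
  using L2_integrable_inner[OF assms(1) test_function_L2[OF meas_dom assms(2)]] by simp

lemma classical_grad_test_L2:
  assumes "\<psi> \<in> test_functions \<Omega>"
  shows "classical_grad \<psi> \<in> L2 \<Omega>"
  by (rule L2_vec)
    (simp add: classical_grad_def test_function_L2[OF meas_dom partial_deriv_test_function[OF assms]])

lemma weak_grad_unique:
  assumes "g \<in> L2 \<Omega>" "h \<in> L2 \<Omega>" "has_weak_grad \<Omega> u g" "has_weak_grad \<Omega> u h"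
  shows "AE x in lebesgue_on \<Omega>. g x = h x"
proof -
  have "AE x in lebesgue_on \<Omega>. g x $ j - h x $ j = 0" for j
  proof (rule test_functions_separate[OF open_dom meas_dom])
    show "(\<lambda>x. g x $ j - h x $ j) \<in> L2 \<Omega>" using assms by (intro L2.closed_diff L2_component)
    fix \<psi> assume t: "\<psi> \<in> test_functions \<Omega>"
    have "(LINT x|lebesgue_on \<Omega>. g x $ j * \<psi> x) = (LINT x|lebesgue_on \<Omega>. h x $ j * \<psi> x)"
      using assms(3,4) t unfolding has_weak_grad_def by force
    then show "(LINT x|lebesgue_on \<Omega>. (g x $ j - h x $ j) * \<psi> x) = 0"
      using assms(1,2) t by (simp add: left_diff_distrib L2_test_integrable L2_component)
  qed
  then have "AE x in lebesgue_on \<Omega>. \<forall>j. g x $ j - h x $ j = 0" by (simp add: AE_all_countable)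
  then show ?thesis by eventually_elim (simp add: vec_eq_iff)
qed

lemma weak_div_unique:
  assumes "g \<in> L2 \<Omega>" "h \<in> L2 \<Omega>" "has_weak_div \<Omega> p g" "has_weak_div \<Omega> p h"
  shows "AE x in lebesgue_on \<Omega>. g x = h x"
proof -
  have "AE x in lebesgue_on \<Omega>. g x - h x = 0"
  proof (rule test_functions_separate[OF open_dom meas_dom])
    show "(\<lambda>x. g x - h x) \<in> L2 \<Omega>" using assms by (intro L2.closed_diff)
    fix \<psi> assume t: "\<psi> \<in> test_functions \<Omega>"
    have "(LINT x|lebesgue_on \<Omega>. g x * \<psi> x) = (LINT x|lebesgue_on \<Omega>. h x * \<psi> x)"
      using assms(3,4) t unfolding has_weak_div_def by force
    then show "(LINT x|lebesgue_on \<Omega>. (g x - h x) * \<psi> x) = 0"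
      using assms(1,2) t by (simp add: left_diff_distrib L2_test_integrable)
  qed
  then show ?thesis by eventually_elim simp
qed

lemma has_weak_grad_add:
  assumes "u \<in> L2 \<Omega>" "v \<in> L2 \<Omega>" "g \<in> L2 \<Omega>" "h \<in> L2 \<Omega>" "has_weak_grad \<Omega> u g" "has_weak_grad \<Omega> v h"
  shows "has_weak_grad \<Omega> (\<lambda>x. u x + v x) (\<lambda>x. g x + h x)"
  using assms unfolding has_weak_grad_def
  by (simp add: distrib_right L2_test_integrable L2_component partial_deriv_test_function)

lemma has_weak_grad_scale:
  assumes "has_weak_grad \<Omega> u g"
  shows "has_weak_grad \<Omega> (\<lambda>x. c * u x) (\<lambda>x. c *\<^sub>R g x)"
  using assms unfolding has_weak_grad_def by (simp add: mult.assoc)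

lemma has_weak_grad_null:
  assumes "u \<in> L2 \<Omega>" "AE x in lebesgue_on \<Omega>. u x = 0"
  shows "has_weak_grad \<Omega> u (\<lambda>x. 0)"
  unfolding has_weak_grad_def
proof (intro ballI allI)
  fix \<psi> j assume "\<psi> \<in> test_functions \<Omega>"
  have "AE x in lebesgue_on \<Omega>. u x * partial_deriv j \<psi> x = 0"
    using assms(2) by eventually_elim simp
  then have "(LINT x|lebesgue_on \<Omega>. u x * partial_deriv j \<psi> x) = 0"
    by (rule integral_eq_zero_AE)
  then show "(LINT x|lebesgue_on \<Omega>. u x * partial_deriv j \<psi> x) = - (LINT x|lebesgue_on \<Omega>. 0 $ j * \<psi> x)"
    by simp
qed

lemma H1_wgrad:
  assumes "u \<in> H1 \<Omega>"
  shows "wgrad \<Omega> u \<in> L2 \<Omega>" "has_weak_grad \<Omega> u (wgrad \<Omega> u)" "u \<in> L2 \<Omega>"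
proof -
  have "\<exists>g. g \<in> L2 \<Omega> \<and> has_weak_grad \<Omega> u g" using assms by (auto simp: H1_def)
  from someI_ex[OF this] show "wgrad \<Omega> u \<in> L2 \<Omega>" "has_weak_grad \<Omega> u (wgrad \<Omega> u)"
    by (auto simp: wgrad_def)
  show "u \<in> L2 \<Omega>" using assms by (simp add: H1_def)
qed

lemma H1I: "u \<in> L2 \<Omega> \<Longrightarrow> g \<in> L2 \<Omega> \<Longrightarrow> has_weak_grad \<Omega> u g \<Longrightarrow> u \<in> H1 \<Omega>"
  by (auto simp: H1_def)

lemma wgrad_eqI:
  assumes "u \<in> L2 \<Omega>" "g \<in> L2 \<Omega>" "has_weak_grad \<Omega> u g"
  shows "AE x in lebesgue_on \<Omega>. wgrad \<Omega> u x = g x"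
  using weak_grad_unique H1_wgrad(1,2)[OF H1I[OF assms]] assms by blast

lemma lin_closed_H1: "lin_closed (H1 \<Omega>)"
proof (rule lin_closedI)
  show "(\<lambda>x. 0) \<in> H1 \<Omega>"
    by (rule H1I[where g = "\<lambda>x. 0"]) (auto simp: L2.closed_0 intro: has_weak_grad_null)
  show "(\<lambda>x. u x + v x) \<in> H1 \<Omega>" if "u \<in> H1 \<Omega>" "v \<in> H1 \<Omega>" for u v
    by (rule H1I[where g = "\<lambda>x. wgrad \<Omega> u x + wgrad \<Omega> v x"])
      (intro L2.closed_add has_weak_grad_add H1_wgrad that)+
  show "(\<lambda>x. c *\<^sub>R u x) \<in> H1 \<Omega>" if "u \<in> H1 \<Omega>" for c u
    by (rule H1I[OF L2.closed_scale[OF H1_wgrad(3)[OF that]] L2.closed_scale[OF H1_wgrad(1)[OF that], of c]])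
      (simp add: has_weak_grad_scale[OF H1_wgrad(2)[OF that]])
qed

lemma wgrad_add:
  assumes "u \<in> H1 \<Omega>" "v \<in> H1 \<Omega>"
  shows "AE x in lebesgue_on \<Omega>. wgrad \<Omega> (\<lambda>x. u x + v x) x = wgrad \<Omega> u x + wgrad \<Omega> v x"
  by (rule wgrad_eqI) (intro L2.closed_add has_weak_grad_add H1_wgrad assms)+

lemma wgrad_scale:
  assumes "u \<in> H1 \<Omega>"
  shows "AE x in lebesgue_on \<Omega>. wgrad \<Omega> (\<lambda>x. c * u x) x = c *\<^sub>R wgrad \<Omega> u x"
  using assms L2.closed_scale[of u \<Omega> c]
  by (intro wgrad_eqI) (auto intro: L2.closed_scale has_weak_grad_scale H1_wgrad)

lemma wgrad_null:
  assumes "u \<in> L2 \<Omega>" "AE x in lebesgue_on \<Omega>. u x = 0"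
  shows "AE x in lebesgue_on \<Omega>. wgrad \<Omega> u x = 0"
  using wgrad_eqI[OF assms(1) L2.closed_0 has_weak_grad_null[OF assms]] .

lemma H1_has_weak_div:
  assumes "\<And>i. (\<lambda>x. u x $ i) \<in> H1 \<Omega>"
  shows "has_weak_div \<Omega> u (\<lambda>x. \<Sum>j\<in>UNIV. wgrad \<Omega> (\<lambda>y. u y $ j) x $ j)"
  unfolding has_weak_div_def
proof
  fix \<psi> assume t: "\<psi> \<in> test_functions \<Omega>"
  note int = L2_test_integrable[OF H1_wgrad(3)[OF assms] partial_deriv_test_function[OF t]]
    L2_test_integrable[OF L2_component[OF H1_wgrad(1)[OF assms]] t]
  have "(LINT x|lebesgue_on \<Omega>. u x \<bullet> classical_grad \<psi> x)
      = (\<Sum>j\<in>UNIV. LINT x|lebesgue_on \<Omega>. u x $ j * partial_deriv j \<psi> x)"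
    using int by (simp add: classical_grad_def inner_vec_def)
  also have "\<dots> = (\<Sum>j\<in>UNIV. - (LINT x|lebesgue_on \<Omega>. wgrad \<Omega> (\<lambda>y. u y $ j) x $ j * \<psi> x))"
    using H1_wgrad(2)[OF assms] t unfolding has_weak_grad_def by (intro sum.cong) auto
  also have "\<dots> = - (LINT x|lebesgue_on \<Omega>. (\<Sum>j\<in>UNIV. wgrad \<Omega> (\<lambda>y. u y $ j) x $ j) * \<psi> x)"
    using int by (simp add: sum_distrib_right sum_negf)
  finally show "(LINT x|lebesgue_on \<Omega>. u x \<bullet> classical_grad \<psi> x)
      = - (LINT x|lebesgue_on \<Omega>. (\<Sum>j\<in>UNIV. wgrad \<Omega> (\<lambda>y. u y $ j) x $ j) * \<psi> x)" .
qed

lemma Hdiv_wdiv: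
  assumes "p \<in> Hdiv \<Omega>"
  shows "wdiv \<Omega> p \<in> L2 \<Omega>" "has_weak_div \<Omega> p (wdiv \<Omega> p)" "p \<in> L2 \<Omega>"
proof -
  have "\<exists>g. g \<in> L2 \<Omega> \<and> has_weak_div \<Omega> p g" using assms by (auto simp: Hdiv_def)
  from someI_ex[OF this] show "wdiv \<Omega> p \<in> L2 \<Omega>" "has_weak_div \<Omega> p (wdiv \<Omega> p)"
    by (auto simp: wdiv_def)
  show "p \<in> L2 \<Omega>" using assms by (simp add: Hdiv_def)
qed

lemma wgrad_trace_L2:
  assumes "\<And>i. (\<lambda>x. u x $ i) \<in> H1 \<Omega>"
  shows "(\<lambda>x. \<Sum>j\<in>UNIV. wgrad \<Omega> (\<lambda>y. u y $ j) x $ j) \<in> L2 \<Omega>"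
  using L2.closed_sum[of UNIV "\<lambda>j x. wgrad \<Omega> (\<lambda>y. u y $ j) x $ j" \<Omega> "\<lambda>_. 1"]
    L2_component[OF H1_wgrad(1)[OF assms]] by simp

text \<open>Both sides are square-integrable weak divergences of \<open>u\<close>; uniqueness identifies them.\<close>

lemma wdiv_eq_trace:
  assumes "\<And>i. (\<lambda>x. u x $ i) \<in> H1 \<Omega>"
  shows "AE x in lebesgue_on \<Omega>. wdiv \<Omega> u x = (\<Sum>j\<in>UNIV. wgrad \<Omega> (\<lambda>y. u y $ j) x $ j)"
proof -
  have "u \<in> L2 \<Omega>" using assms H1_wgrad(3) by (intro L2_vec) auto
  then have "u \<in> Hdiv \<Omega>"
    using H1_has_weak_div[OF assms] wgrad_trace_L2[OF assms] by (auto simp: Hdiv_def)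
  then show ?thesis
    using weak_div_unique Hdiv_wdiv H1_has_weak_div[OF assms] wgrad_trace_L2[OF assms] by blast
qed

definition H1v :: "(pt \<Rightarrow> real ^ 3) set" where
  "H1v = {u. \<forall>i. (\<lambda>x. u x $ i) \<in> H1 \<Omega>}"

lemma H1v_component: "u \<in> H1v \<Longrightarrow> (\<lambda>x. u x $ i) \<in> H1 \<Omega>"
  by (simp add: H1v_def)

lemma lin_closed_H1v: "lin_closed H1v"
  unfolding H1v_def by (rule lin_closed_componentwise[OF lin_closed_H1])

lemma H1v_L2: "u \<in> H1v \<Longrightarrow> u \<in> L2 \<Omega>"
  using H1v_component H1_wgrad(3) by (intro L2_vec) auto

lemma tgrad_L2: "u \<in> H1v \<Longrightarrow> tgrad \<Omega> u \<in> L2 \<Omega>"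
  by (rule L2_vec) (auto simp: tgrad_def intro: H1_wgrad(1) H1v_component)

lemma tgrad_add:
  assumes "u \<in> H1v" "v \<in> H1v"
  shows "AE x in lebesgue_on \<Omega>. tgrad \<Omega> (\<lambda>x. u x + v x) x = tgrad \<Omega> u x + tgrad \<Omega> v x"
proof -
  have "AE x in lebesgue_on \<Omega>. \<forall>i. wgrad \<Omega> (\<lambda>x. u x $ i + v x $ i) x
      = wgrad \<Omega> (\<lambda>x. u x $ i) x + wgrad \<Omega> (\<lambda>x. v x $ i) x"
    unfolding AE_all_countable using wgrad_add assms H1v_component by auto
  then show ?thesis by eventually_elim (simp add: tgrad_def vec_eq_iff)
qed

lemma tgrad_scale:
  assumes "u \<in> H1v"
  shows "AE x in lebesgue_on \<Omega>. tgrad \<Omega> (\<lambda>x. c *\<^sub>R u x) x = c *\<^sub>R tgrad \<Omega> u x"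
proof -
  have "AE x in lebesgue_on \<Omega>. \<forall>i. wgrad \<Omega> (\<lambda>x. c * u x $ i) x = c *\<^sub>R wgrad \<Omega> (\<lambda>x. u x $ i) x"
    unfolding AE_all_countable using wgrad_scale assms H1v_component by auto
  then show ?thesis by eventually_elim (simp add: tgrad_def vec_eq_iff)
qed

lemma tgrad_null:
  assumes "u \<in> H1v" "AE x in lebesgue_on \<Omega>. u x = 0"
  shows "AE x in lebesgue_on \<Omega>. tgrad \<Omega> u x = 0"
proof -
  have "AE x in lebesgue_on \<Omega>. u x $ i = 0" for i using assms(2) by eventually_elim simp
  then have "AE x in lebesgue_on \<Omega>. \<forall>i. wgrad \<Omega> (\<lambda>x. u x $ i) x = 0"
    unfolding AE_all_countable
    using wgrad_null H1_wgrad(3) H1v_component[OF assms(1)] by blast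
  then show ?thesis by eventually_elim (simp add: tgrad_def vec_eq_iff)
qed

abbreviation energy :: "(pt \<Rightarrow> real ^ 3) \<Rightarrow> (pt \<Rightarrow> real ^ 3) \<Rightarrow> real" where
  "energy u v \<equiv> L2_inner \<Omega> (tgrad \<Omega> u) (tgrad \<Omega> v)"

sublocale energy: semi_inner H1v energy
proof
  show "lin_closed H1v" by (rule lin_closed_H1v)
  show "energy f g = energy g f" if "f \<in> H1v" "g \<in> H1v" for f g
    using that tgrad_L2 L2.sym by blast
  show "energy (\<lambda>x. f x + g x) h = energy f h + energy g h"
    if "f \<in> H1v" "g \<in> H1v" "h \<in> H1v" for f g h
  proof -
    have "energy (\<lambda>x. f x + g x) h = L2_inner \<Omega> (\<lambda>x. tgrad \<Omega> f x + tgrad \<Omega> g x) (tgrad \<Omega> h)"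
      using that lin_closed_add[OF lin_closed_H1v]
      by (intro L2_inner_cong_AE tgrad_add L2.closed_add tgrad_L2)
    then show ?thesis using L2.add_left[OF tgrad_L2 tgrad_L2 tgrad_L2, of f g h] that by simp
  qed
  show "energy (\<lambda>x. c *\<^sub>R f x) h = c * energy f h" if "f \<in> H1v" "h \<in> H1v" for c f h
  proof -
    have "energy (\<lambda>x. c *\<^sub>R f x) h = L2_inner \<Omega> (\<lambda>x. c *\<^sub>R tgrad \<Omega> f x) (tgrad \<Omega> h)"
      using that lin_closed_scale[OF lin_closed_H1v]
      by (intro L2_inner_cong_AE tgrad_scale L2.closed_scale tgrad_L2)
    then show ?thesis using L2.scale_left[OF tgrad_L2 tgrad_L2, of f h c] that by simp
  qed
  show "0 \<le> energy f f" if "f \<in> H1v" for f using tgrad_L2[OF that] L2.nonneg by blast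
qed

text \<open>\<open>tgrad\<close> chooses a representative for each function separately, so the gradient of \<open>v\<close> need
not vanish everywhere; by uniqueness it vanishes almost everywhere.\<close>

lemma energy_null:
  assumes "u \<in> H1v" "v \<in> H1v" "AE x in lebesgue_on \<Omega>. v x = 0"
  shows "energy u v = 0"
proof -
  have "energy v v = 0"
    using L2_inner_self_eq_0[OF tgrad_L2[OF assms(2)]] tgrad_null[OF assms(2,3)] by simp
  then show ?thesis using energy.null_orthogonal assms by blast
qed

section \<open>Functions with zero boundary values\<close>

lemma H10_H1: "u \<in> H10 \<Omega> \<Longrightarrow> u \<in> H1 \<Omega>"
  by (simp add: H10_def)

lemma H10_approximation:
  assumes "u \<in> H10 \<Omega>"
  obtains \<psi> where "\<And>n::nat. \<psi> n \<in> test_functions \<Omega>"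
    "(\<lambda>n. L2_norm \<Omega> (\<lambda>x. u x - \<psi> n x)) \<longlonglongrightarrow> 0"
    "(\<lambda>n. L2_norm \<Omega> (\<lambda>x. wgrad \<Omega> u x - classical_grad (\<psi> n) x)) \<longlonglongrightarrow> 0"
  using assms unfolding H10_def by blast

text \<open>For a test function this is the definition of the weak divergence. Both sides are continuous
along the sequence of test functions that \<open>H10\<close> provides.\<close>

lemma div_by_parts:
  assumes "p \<in> Hdiv \<Omega>" "u \<in> H10 \<Omega>"
  shows "L2_inner \<Omega> p (wgrad \<Omega> u) = - L2_inner \<Omega> (wdiv \<Omega> p) u"
proof -
  note p = Hdiv_wdiv[OF assms(1)] and u = H1_wgrad[OF H10_H1[OF assms(2)]]
  obtain \<psi> where \<psi>: "\<And>n::nat. \<psi> n \<in> test_functions \<Omega>"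
    "(\<lambda>n. L2_norm \<Omega> (\<lambda>x. u x - \<psi> n x)) \<longlonglongrightarrow> 0"
    "(\<lambda>n. L2_norm \<Omega> (\<lambda>x. wgrad \<Omega> u x - classical_grad (\<psi> n) x)) \<longlonglongrightarrow> 0"
    using H10_approximation[OF assms(2)] by blast
  have "(\<lambda>n. L2_inner \<Omega> p (classical_grad (\<psi> n))) \<longlonglongrightarrow> L2_inner \<Omega> p (wgrad \<Omega> u)"
    using p u \<psi> classical_grad_test_L2 by (intro L2_inner_tendsto) auto
  moreover have "(\<lambda>n. - L2_inner \<Omega> (wdiv \<Omega> p) (\<psi> n)) \<longlonglongrightarrow> - L2_inner \<Omega> (wdiv \<Omega> p) u"
    using p u \<psi> test_function_L2[OF meas_dom] by (intro tendsto_minus L2_inner_tendsto) auto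
  moreover have "L2_inner \<Omega> p (classical_grad (\<psi> n)) = - L2_inner \<Omega> (wdiv \<Omega> p) (\<psi> n)" for n
    using p(2) \<psi>(1) unfolding has_weak_div_def L2_inner_def by simp
  ultimately show ?thesis using LIMSEQ_unique by simp
qed

lemma grad_by_parts:
  assumes "\<phi> \<in> H1 \<Omega>" "u \<in> H10 \<Omega>"
  shows "L2_inner \<Omega> \<phi> (\<lambda>x. wgrad \<Omega> u x $ j) = - L2_inner \<Omega> (\<lambda>x. wgrad \<Omega> \<phi> x $ j) u"
proof -
  note p = H1_wgrad[OF assms(1)] and u = H1_wgrad[OF H10_H1[OF assms(2)]]
  obtain \<psi> where \<psi>: "\<And>n::nat. \<psi> n \<in> test_functions \<Omega>"
    "(\<lambda>n. L2_norm \<Omega> (\<lambda>x. u x - \<psi> n x)) \<longlonglongrightarrow> 0"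
    "(\<lambda>n. L2_norm \<Omega> (\<lambda>x. wgrad \<Omega> u x - classical_grad (\<psi> n) x)) \<longlonglongrightarrow> 0"
    using H10_approximation[OF assms(2)] by blast
  let ?p = "\<lambda>x. \<phi> x *\<^sub>R axis j 1 :: real ^ 3"
  have pL: "?p \<in> L2 \<Omega>"
    using p(3) L2.closed_0 by (intro L2_vec) (auto simp: axis_def)
  have comp: "L2_inner \<Omega> ?p g = L2_inner \<Omega> \<phi> (\<lambda>x. g x $ j)" for g
    unfolding L2_inner_def by (simp add: inner_axis')
  have "(\<lambda>n. L2_inner \<Omega> ?p (classical_grad (\<psi> n))) \<longlonglongrightarrow> L2_inner \<Omega> ?p (wgrad \<Omega> u)"
    using pL u \<psi> classical_grad_test_L2 by (intro L2_inner_tendsto) auto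
  moreover have "(\<lambda>n. - L2_inner \<Omega> (\<lambda>x. wgrad \<Omega> \<phi> x $ j) (\<psi> n)) \<longlonglongrightarrow> - L2_inner \<Omega> (\<lambda>x. wgrad \<Omega> \<phi> x $ j) u"
    using L2_component[OF p(1)] u \<psi> test_function_L2[OF meas_dom]
    by (intro tendsto_minus L2_inner_tendsto) auto
  moreover have "L2_inner \<Omega> ?p (classical_grad (\<psi> n)) = - L2_inner \<Omega> (\<lambda>x. wgrad \<Omega> \<phi> x $ j) (\<psi> n)" for n
    using p(2) \<psi>(1) unfolding comp unfolding has_weak_grad_def L2_inner_def classical_grad_def by simp
  ultimately show ?thesis using LIMSEQ_unique unfolding comp by simp
qed

lemma L2_norm_limit_cong_AE:
  assumes "\<And>n. f n \<in> L2 \<Omega>" "\<And>n. g n \<in> L2 \<Omega>" "\<And>n::nat. AE x in lebesgue_on \<Omega>. f n x = g n x"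
    "(\<lambda>n. L2_norm \<Omega> (g n)) \<longlonglongrightarrow> 0"
  shows "(\<lambda>n. L2_norm \<Omega> (f n)) \<longlonglongrightarrow> 0"
proof -
  have "L2_norm \<Omega> (f n) = L2_norm \<Omega> (g n)" for n
  proof -
    have "L2_inner \<Omega> (f n) (f n) = L2_inner \<Omega> (g n) (f n)"
      using assms by (intro L2_inner_cong_AE)
    also have "\<dots> = L2_inner \<Omega> (f n) (g n)" using assms by (intro L2.sym)
    also have "\<dots> = L2_inner \<Omega> (g n) (g n)" using assms by (intro L2_inner_cong_AE)
    finally show ?thesis by (simp add: L2_norm_def)
  qed
  then show ?thesis using assms(4) by simp
qed

lemma L2_norm_limit_add:
  assumes "\<And>n. f n \<in> L2 \<Omega>" "\<And>n. g n \<in> L2 \<Omega>"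
    "(\<lambda>n::nat. L2_norm \<Omega> (f n)) \<longlonglongrightarrow> 0" "(\<lambda>n. L2_norm \<Omega> (g n)) \<longlonglongrightarrow> 0"
  shows "(\<lambda>n. L2_norm \<Omega> (\<lambda>x. f n x + g n x)) \<longlonglongrightarrow> 0"
proof (rule Lim_null_comparison)
  show "(\<lambda>n. L2_norm \<Omega> (f n) + L2_norm \<Omega> (g n)) \<longlonglongrightarrow> 0" using tendsto_add[OF assms(3,4)] by simp
  have "L2_norm \<Omega> (\<lambda>x. f n x + g n x) \<le> L2_norm \<Omega> (f n) + L2_norm \<Omega> (g n)" for n
    unfolding L2_norm_def using L2.triangle assms by blast
  moreover have "0 \<le> L2_norm \<Omega> (\<lambda>x. f n x + g n x)" for n
    using L2_norm_nonneg L2.closed_add assms by blast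
  ultimately show "\<forall>\<^sub>F n in sequentially. norm (L2_norm \<Omega> (\<lambda>x. f n x + g n x))
      \<le> L2_norm \<Omega> (f n) + L2_norm \<Omega> (g n)"
    by (intro always_eventually allI) simp
qed

lemma L2_norm_limit_scale:
  assumes "\<And>n. f n \<in> L2 \<Omega>" "(\<lambda>n::nat. L2_norm \<Omega> (f n)) \<longlonglongrightarrow> 0"
  shows "(\<lambda>n. L2_norm \<Omega> (\<lambda>x. c *\<^sub>R f n x)) \<longlonglongrightarrow> 0"
proof -
  have "L2_norm \<Omega> (\<lambda>x. c *\<^sub>R f n x) = \<bar>c\<bar> * L2_norm \<Omega> (f n)" for n
    using L2.closed_scale[OF assms(1), of c n]
    by (simp add: L2_norm_def L2.scale_left L2.scale_right assms(1) real_sqrt_mult flip: power2_eq_square mult.assoc)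
  then show ?thesis using tendsto_mult[OF tendsto_const assms(2), of "\<bar>c\<bar>"] by simp
qed

lemma classical_grad_add:
  assumes "f differentiable at x" "g differentiable at x"
  shows "classical_grad (\<lambda>x. f x + g x) x = classical_grad f x + classical_grad g x"
  using has_derivative_add[OF assms[THEN has_derivative_classical_grad]]
  by (intro classical_grad_eqI) (simp add: inner_add_left)

lemma classical_grad_scale:
  assumes "f differentiable at x"
  shows "classical_grad (\<lambda>x. c * f x) x = c *\<^sub>R classical_grad f x"
  using has_derivative_mult_right[OF has_derivative_classical_grad[OF assms], of c]
  by (intro classical_grad_eqI) simp

lemma test_function_differentiable: "\<psi> \<in> test_functions \<Omega> \<Longrightarrow> \<psi> differentiable at x"
  using test_function_C_k[of \<psi> \<Omega> "Suc 0"] by simp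

lemma lin_closed_H10: "lin_closed (H10 \<Omega>)"
proof (rule lin_closedI)
  have 0: "(\<lambda>x. 0::real) \<in> L2 \<Omega>" "(\<lambda>x. 0 :: real ^ 3) \<in> L2 \<Omega>" by (simp_all add: lin_closed_0[OF lin_closed_L2])
  have 1: "(\<lambda>x. 0) \<in> H1 \<Omega>" by (rule lin_closed_0[OF lin_closed_H1])
  have g0: "classical_grad (\<lambda>x. 0) = (\<lambda>x. 0)" by (auto intro!: classical_grad_eqI)
  have "(\<lambda>n::nat. L2_norm \<Omega> (\<lambda>x. wgrad \<Omega> (\<lambda>x. 0) x - 0)) \<longlonglongrightarrow> 0"
    by (rule L2_norm_limit_cong_AE[where g = "\<lambda>_ _. 0"])
      (use 0 1 H1_wgrad(1) wgrad_null[OF 0(1)] in \<open>auto simp: L2_norm_def L2_inner_def\<close>)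
  then show "(\<lambda>x. 0) \<in> H10 \<Omega>"
    unfolding H10_def using 1 g0
    by (auto intro!: exI[of _ "\<lambda>_ _. 0"] test_function_0 simp: L2_norm_def[of _ "\<lambda>x. 0"] L2_inner_def[of _ "\<lambda>x. 0"])
next
  fix u v assume u: "u \<in> H10 \<Omega>" and v: "v \<in> H10 \<Omega>"
  obtain \<psi> where \<psi>: "\<And>n::nat. \<psi> n \<in> test_functions \<Omega>"
    "(\<lambda>n. L2_norm \<Omega> (\<lambda>x. u x - \<psi> n x)) \<longlonglongrightarrow> 0"
    "(\<lambda>n. L2_norm \<Omega> (\<lambda>x. wgrad \<Omega> u x - classical_grad (\<psi> n) x)) \<longlonglongrightarrow> 0"
    using H10_approximation[OF u] by blast
  obtain \<phi> where \<phi>: "\<And>n::nat. \<phi> n \<in> test_functions \<Omega>"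
    "(\<lambda>n. L2_norm \<Omega> (\<lambda>x. v x - \<phi> n x)) \<longlonglongrightarrow> 0"
    "(\<lambda>n. L2_norm \<Omega> (\<lambda>x. wgrad \<Omega> v x - classical_grad (\<phi> n) x)) \<longlonglongrightarrow> 0"
    using H10_approximation[OF v] by blast
  note uv = H1_wgrad[OF H10_H1[OF u]] H1_wgrad[OF H10_H1[OF v]]
  have uvH: "(\<lambda>x. u x + v x) \<in> H1 \<Omega>" using lin_closed_add[OF lin_closed_H1] H10_H1 u v by blast
  define \<xi> where "\<xi> n x = \<psi> n x + \<phi> n x" for n x
  have \<xi>: "\<xi> n \<in> test_functions \<Omega>" for n
    using test_function_add[OF \<psi>(1) \<phi>(1)] by (simp add: \<xi>_def[abs_def])
  have grad: "classical_grad (\<xi> n) x = classical_grad (\<psi> n) x + classical_grad (\<phi> n) x" for n x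
    using classical_grad_add[OF test_function_differentiable[OF \<psi>(1)] test_function_differentiable[OF \<phi>(1)]]
    by (simp add: \<xi>_def[abs_def])
  note mem = uv L2.closed_diff L2.closed_add test_function_L2[OF meas_dom] \<psi>(1) \<phi>(1) \<xi> classical_grad_test_L2
  have "(\<lambda>n. L2_norm \<Omega> (\<lambda>x. (u x - \<psi> n x) + (v x - \<phi> n x))) \<longlonglongrightarrow> 0"
    by (intro L2_norm_limit_add \<psi> \<phi> mem)
  then have "(\<lambda>n. L2_norm \<Omega> (\<lambda>x. u x + v x - \<xi> n x)) \<longlonglongrightarrow> 0"
    by (simp add: \<xi>_def algebra_simps)
  moreover have "(\<lambda>n. L2_norm \<Omega> (\<lambda>x. wgrad \<Omega> (\<lambda>x. u x + v x) x - classical_grad (\<xi> n) x)) \<longlonglongrightarrow> 0"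
  proof (rule L2_norm_limit_cong_AE)
    show "(\<lambda>n. L2_norm \<Omega> (\<lambda>x. (wgrad \<Omega> u x - classical_grad (\<psi> n) x)
        + (wgrad \<Omega> v x - classical_grad (\<phi> n) x))) \<longlonglongrightarrow> 0"
      by (intro L2_norm_limit_add \<psi> \<phi> mem)
    show "AE x in lebesgue_on \<Omega>. wgrad \<Omega> (\<lambda>x. u x + v x) x - classical_grad (\<xi> n) x =
        (wgrad \<Omega> u x - classical_grad (\<psi> n) x) + (wgrad \<Omega> v x - classical_grad (\<phi> n) x)" for n
      using wgrad_add[OF H10_H1[OF u] H10_H1[OF v]] by eventually_elim (simp add: grad)
  qed (intro mem H1_wgrad(1)[OF uvH])+
  ultimately show "(\<lambda>x. u x + v x) \<in> H10 \<Omega>" unfolding H10_def using uvH \<xi> by blast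
next
  fix c u assume u: "u \<in> H10 \<Omega>"
  obtain \<psi> where \<psi>: "\<And>n::nat. \<psi> n \<in> test_functions \<Omega>"
    "(\<lambda>n. L2_norm \<Omega> (\<lambda>x. u x - \<psi> n x)) \<longlonglongrightarrow> 0"
    "(\<lambda>n. L2_norm \<Omega> (\<lambda>x. wgrad \<Omega> u x - classical_grad (\<psi> n) x)) \<longlonglongrightarrow> 0"
    using H10_approximation[OF u] by blast
  note uL = H1_wgrad[OF H10_H1[OF u]]
  have uH: "(\<lambda>x. c *\<^sub>R u x) \<in> H1 \<Omega>" using lin_closed_scale[OF lin_closed_H1] H10_H1 u by blast
  define \<xi> where "\<xi> n x = c * \<psi> n x" for n x
  have \<xi>: "\<xi> n \<in> test_functions \<Omega>" for n
    using test_function_mult[OF \<psi>(1), of "\<lambda>_. c"] by (simp add: \<xi>_def[abs_def] C_k_const)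
  have grad: "classical_grad (\<xi> n) x = c *\<^sub>R classical_grad (\<psi> n) x" for n x
    using classical_grad_scale[OF test_function_differentiable[OF \<psi>(1)]] by (simp add: \<xi>_def[abs_def])
  note mem = uL L2.closed_diff L2.closed_scale test_function_L2[OF meas_dom] \<psi>(1) \<xi> classical_grad_test_L2
  have "(\<lambda>n. L2_norm \<Omega> (\<lambda>x. c *\<^sub>R (u x - \<psi> n x))) \<longlonglongrightarrow> 0"
    by (intro L2_norm_limit_scale \<psi> mem)
  then have "(\<lambda>n. L2_norm \<Omega> (\<lambda>x. c *\<^sub>R u x - \<xi> n x)) \<longlonglongrightarrow> 0"
    by (simp add: \<xi>_def algebra_simps)
  moreover have "(\<lambda>n. L2_norm \<Omega> (\<lambda>x. wgrad \<Omega> (\<lambda>x. c *\<^sub>R u x) x - classical_grad (\<xi> n) x)) \<longlonglongrightarrow> 0"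
  proof (rule L2_norm_limit_cong_AE)
    show "(\<lambda>n. L2_norm \<Omega> (\<lambda>x. c *\<^sub>R (wgrad \<Omega> u x - classical_grad (\<psi> n) x))) \<longlonglongrightarrow> 0"
      by (intro L2_norm_limit_scale \<psi> mem)
    show "AE x in lebesgue_on \<Omega>. wgrad \<Omega> (\<lambda>x. c *\<^sub>R u x) x - classical_grad (\<xi> n) x =
        c *\<^sub>R (wgrad \<Omega> u x - classical_grad (\<psi> n) x)" for n
      using wgrad_scale[OF H10_H1[OF u], of c] by eventually_elim (simp add: grad algebra_simps)
  qed (intro mem H1_wgrad(1)[OF uH])+
  ultimately show "(\<lambda>x. c *\<^sub>R u x) \<in> H10 \<Omega>" unfolding H10_def using uH \<xi> by blast
qed

text \<open>The weak divergence is a choice and not literally linear; replacing it by the trace of the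
gradient, which is linear almost everywhere, makes the constraint a linear one.\<close>

lemma lin_closed_solenoidal:
  assumes "lin_closed U" "U \<subseteq> H1 \<Omega>"
  shows "lin_closed {v. (\<forall>i. (\<lambda>x. v x $ i) \<in> U) \<and> (AE x in lebesgue_on \<Omega>. wdiv \<Omega> v x = 0)}"
proof -
  have comp: "(\<lambda>x. v x $ i) \<in> H1 \<Omega>" if "\<forall>i. (\<lambda>x. v x $ i) \<in> U" for v i using that assms(2) by auto
  have iff: "(AE x in lebesgue_on \<Omega>. wdiv \<Omega> v x = 0)
      \<longleftrightarrow> (AE x in lebesgue_on \<Omega>. (\<Sum>j\<in>UNIV. tgrad \<Omega> v x $ j $ j) = 0)" if "\<forall>i. (\<lambda>x. v x $ i) \<in> U" for v
  proof -
    have "AE x in lebesgue_on \<Omega>. wdiv \<Omega> v x = (\<Sum>j\<in>UNIV. tgrad \<Omega> v x $ j $ j)"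
      using wdiv_eq_trace[OF comp[OF that]] by (simp add: tgrad_def)
    then show ?thesis by (intro iffI; elim AE_mp) (auto elim!: eventually_mono)
  qed
  have H1v: "v \<in> H1v" if "\<forall>i. (\<lambda>x. v x $ i) \<in> U" for v using comp[OF that] by (simp add: H1v_def)
  note lc = lin_closed_componentwise[OF assms(1)]
  show ?thesis
  proof (rule lin_closedI, goal_cases)
    case 1
    have u: "\<forall>i. (\<lambda>x. (0 :: real ^ 3) $ i) \<in> U" using lin_closed_0[OF lc] by auto
    moreover have "AE x in lebesgue_on \<Omega>. (\<Sum>j\<in>UNIV. tgrad \<Omega> (\<lambda>x. 0) x $ j $ j) = 0"
      using tgrad_null[OF H1v[OF u]] by (auto elim!: eventually_mono)
    ultimately show ?case using iff[OF u] by simp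
  next
    case (2 f g)
    then have fg: "\<forall>i. (\<lambda>x. f x $ i) \<in> U" "\<forall>i. (\<lambda>x. g x $ i) \<in> U" by auto
    have u: "\<forall>i. (\<lambda>x. (f x + g x) $ i) \<in> U" using lin_closed_add[OF lc, of f g] fg by auto
    have "AE x in lebesgue_on \<Omega>. (\<Sum>j\<in>UNIV. tgrad \<Omega> (\<lambda>x. f x + g x) x $ j $ j) = 0"
      using tgrad_add[OF H1v[OF fg(1)] H1v[OF fg(2)]] 2[simplified, THEN conjunct2, unfolded iff[OF fg(1)] iff[OF fg(2)]]
      by eventually_elim (simp add: sum.distrib)
    then show ?case using iff[OF u] u by simp
  next
    case (3 c f)
    then have f: "\<forall>i. (\<lambda>x. f x $ i) \<in> U" by auto
    have u: "\<forall>i. (\<lambda>x. (c *\<^sub>R f x) $ i) \<in> U" using lin_closed_scale[OF lc, of f c] f by auto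
    have "AE x in lebesgue_on \<Omega>. (\<Sum>j\<in>UNIV. tgrad \<Omega> (\<lambda>x. c *\<^sub>R f x) x $ j $ j) = 0"
      using tgrad_scale[OF H1v[OF f], of c] 3[simplified, THEN conjunct2, unfolded iff[OF f]]
      by eventually_elim (simp flip: sum_distrib_left)
    then show ?case using iff[OF u] u by simp
  qed
qed

lemma lin_closed_V_space: "lin_closed (V_space \<Omega>)"
  unfolding V_space_def using H10_H1 by (intro lin_closed_solenoidal lin_closed_H10) auto

lemma V_space_H1v: "V_space \<Omega> \<subseteq> H1v"
  by (auto simp: V_space_def H1v_def H10_H1)

text \<open>Componentwise integration by parts moves the gradient onto \<open>e\<close>, where it becomes the
divergence.\<close>

lemma gradient_orthogonal_V_space:
  assumes "\<phi> \<in> H1 \<Omega>" "e \<in> V_space \<Omega>"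
  shows "L2_inner \<Omega> (wgrad \<Omega> \<phi>) e = 0"
proof -
  have e: "(\<lambda>x. e x $ j) \<in> H10 \<Omega>" for j using assms(2) by (simp add: V_space_def)
  have eH: "(\<lambda>x. e x $ j) \<in> H1 \<Omega>" for j using H10_H1[OF e] .
  have eL: "e \<in> L2 \<Omega>" using V_space_H1v assms(2) H1v_L2 by blast
  note \<phi> = H1_wgrad[OF assms(1)]
  have "L2_inner \<Omega> (wgrad \<Omega> \<phi>) e = (\<Sum>j\<in>UNIV. L2_inner \<Omega> (\<lambda>x. wgrad \<Omega> \<phi> x $ j) (\<lambda>x. e x $ j))"
    using \<phi> eL by (intro L2_inner_components)
  also have "\<dots> = - (\<Sum>j\<in>UNIV. 1 * L2_inner \<Omega> \<phi> (\<lambda>x. wgrad \<Omega> (\<lambda>y. e y $ j) x $ j))"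
    using grad_by_parts[OF assms(1) e] by (simp add: sum_negf)
  also have "(\<Sum>j\<in>UNIV. 1 * L2_inner \<Omega> \<phi> (\<lambda>x. wgrad \<Omega> (\<lambda>y. e y $ j) x $ j))
      = L2_inner \<Omega> \<phi> (\<lambda>x. \<Sum>j\<in>UNIV. 1 *\<^sub>R wgrad \<Omega> (\<lambda>y. e y $ j) x $ j)"
    using \<phi> L2_component[OF H1_wgrad(1)[OF eH]] by (intro L2.sum_right[symmetric]) auto
  also have "\<dots> = L2_inner \<Omega> (\<lambda>x. \<Sum>j\<in>UNIV. wgrad \<Omega> (\<lambda>y. e y $ j) x $ j) \<phi>"
    using \<phi> wgrad_trace_L2[OF eH] by (simp add: L2.sym)
  also have "\<dots> = L2_inner \<Omega> (\<lambda>x. 0) \<phi>"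
  proof (rule L2_inner_cong_AE)
    have "AE x in lebesgue_on \<Omega>. wdiv \<Omega> e x = 0" using assms(2) by (simp add: V_space_def)
    with wdiv_eq_trace[OF eH]
    show "AE x in lebesgue_on \<Omega>. (\<Sum>j\<in>UNIV. wgrad \<Omega> (\<lambda>y. e y $ j) x $ j) = 0"
      by eventually_elim simp
  qed (use \<phi> wgrad_trace_L2[OF eH] L2.closed_0 in auto)
  finally show ?thesis using L2.zero_left[OF \<phi>(3)] by simp
qed

text \<open>The weak form of the equilibrium equation \<open>div p + \<nabla>\<phi> + f = 0\<close>, tested with a
divergence-free field: the pressure \<open>\<phi>\<close> drops out and the divergence moves onto \<open>e\<close>.\<close>

lemma equilibrated_stress_identity:
  assumes p: "\<And>i. (\<lambda>x. p x $ i) \<in> Hdiv \<Omega>" and "\<phi> \<in> H1 \<Omega>" "f \<in> L2 \<Omega>" "e \<in> V_space \<Omega>"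
    and eq: "AE x in lebesgue_on \<Omega>. tdiv \<Omega> p x + wgrad \<Omega> \<phi> x + f x = 0"
  shows "p \<in> L2 \<Omega>" "L2_inner \<Omega> f e = L2_inner \<Omega> p (tgrad \<Omega> e)"
proof -
  have e: "(\<lambda>x. e x $ j) \<in> H10 \<Omega>" for j using assms(4) by (simp add: V_space_def)
  have eL: "e \<in> L2 \<Omega>" using V_space_H1v assms(4) H1v_L2 by blast
  show pL: "p \<in> L2 \<Omega>" by (rule L2_vec) (rule Hdiv_wdiv(3)[OF p])
  have tL: "tdiv \<Omega> p \<in> L2 \<Omega>" by (rule L2_vec) (simp add: tdiv_def Hdiv_wdiv(1)[OF p])
  note gL = H1_wgrad(1)[OF assms(2)]
  have "L2_inner \<Omega> p (tgrad \<Omega> e) = (\<Sum>i\<in>UNIV. L2_inner \<Omega> (\<lambda>x. p x $ i) (\<lambda>x. tgrad \<Omega> e x $ i))"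
    using pL tgrad_L2 V_space_H1v assms(4) by (intro L2_inner_components) auto
  also have "\<dots> = (\<Sum>i\<in>UNIV. L2_inner \<Omega> (\<lambda>x. p x $ i) (wgrad \<Omega> (\<lambda>x. e x $ i)))"
    by (simp add: tgrad_def)
  also have "\<dots> = - (\<Sum>i\<in>UNIV. L2_inner \<Omega> (\<lambda>x. tdiv \<Omega> p x $ i) (\<lambda>x. e x $ i))"
    using div_by_parts[OF p e] by (simp add: tdiv_def sum_negf)
  also have "\<dots> = - L2_inner \<Omega> (tdiv \<Omega> p) e"
    using tL eL by (simp add: L2_inner_components)
  finally have 1: "L2_inner \<Omega> p (tgrad \<Omega> e) = - L2_inner \<Omega> (tdiv \<Omega> p) e" .
  have "L2_inner \<Omega> (\<lambda>x. tdiv \<Omega> p x + wgrad \<Omega> \<phi> x + f x) e = L2_inner \<Omega> (\<lambda>x. 0) e"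
    using eq eL tL gL assms(3) by (intro L2_inner_cong_AE L2.closed_add L2.closed_0)
  also have "\<dots> = 0" using L2.zero_left[OF eL] .
  also have "L2_inner \<Omega> (\<lambda>x. tdiv \<Omega> p x + wgrad \<Omega> \<phi> x + f x) e
      = L2_inner \<Omega> (tdiv \<Omega> p) e + L2_inner \<Omega> (wgrad \<Omega> \<phi>) e + L2_inner \<Omega> f e"
    using eL tL gL assms(3) L2.closed_add[OF tL gL] by (simp add: L2.add_left)
  finally show "L2_inner \<Omega> f e = L2_inner \<Omega> p (tgrad \<Omega> e)"
    using 1 gradient_orthogonal_V_space[OF assms(2,4)] by simp
qed

end

section \<open>Mollification\<close>

lemma integrable_compact_support:
  fixes f :: "pt \<Rightarrow> real"
  assumes "continuous_on UNIV f" "\<And>y. y \<notin> cbox a b \<Longrightarrow> f y = 0"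
  shows "integrable lborel f"
proof -
  have "integrable lborel (\<lambda>x. indicator (cbox a b) x *\<^sub>R f x)"
    using assms(1) by (intro borel_integrable_compact compact_cbox) (auto intro: continuous_on_subset)
  moreover have "(\<lambda>x. indicator (cbox a b) x *\<^sub>R f x) = f"
    using assms(2) by (auto simp: indicator_def fun_eq_iff)
  ultimately show ?thesis by simp
qed

lemma lborel_integral_reflect:
  fixes f :: "pt \<Rightarrow> real"
  assumes "f \<in> borel_measurable borel"
  shows "(LINT y|lborel. f y) = (LINT z|lborel. f (x - z))"
proof -
  have "lborel = distr lborel borel (\<lambda>z::pt. x + (-1) *\<^sub>R z)"
    using lborel_affine[of "-1" x] by (simp add: density_1)
  then have "(LINT y|lborel. f y) = integral\<^sup>L (distr lborel borel (\<lambda>z::pt. x + (-1) *\<^sub>R z)) f"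
    by simp
  also have "\<dots> = (LINT z|lborel. f (x + (-1) *\<^sub>R z))"
    using assms by (intro integral_distr) auto
  finally show ?thesis by simp
qed

definition conv :: "(pt \<Rightarrow> real) \<Rightarrow> (pt \<Rightarrow> real) \<Rightarrow> pt \<Rightarrow> real" where
  "conv w \<rho> x = (LINT y|lborel. w y * \<rho> (x - y))"

lemma conv_commute:
  assumes "continuous_on UNIV w" "continuous_on UNIV \<rho>"
  shows "conv w \<rho> x = conv \<rho> w x"
proof -
  have "continuous_on UNIV (\<lambda>y. w y * \<rho> (x - y))"
    using assms by (intro continuous_intros continuous_on_compose2[OF assms(2)]) auto
  then have "(\<lambda>y. w y * \<rho> (x - y)) \<in> borel_measurable borel"
    by (rule borel_measurable_continuous_onI)
  from lborel_integral_reflect[OF this, of x] show ?thesis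
    by (simp add: conv_def mult.commute)
qed

text \<open>The support of \<open>w\<close> reduces the convolution to an integral over a fixed box, under which one
may differentiate.\<close>

lemma conv_has_derivative:
  assumes w: "continuous_on UNIV w" "\<And>y. y \<notin> cbox a b \<Longrightarrow> w y = 0"
    and \<rho>: "C_k (Suc 0) \<rho>"
  shows "\<exists>D. (conv w \<rho> has_derivative D) (at x) \<and>
    (\<forall>j. D (axis j 1) = conv w (partial_deriv j \<rho>) x)"
proof -
  have eq: "conv w \<sigma> z = integral (cbox a b) (\<lambda>y. w y * \<sigma> (z - y))" if \<sigma>: "continuous_on UNIV \<sigma>" for \<sigma> z
  proof -
    have "continuous_on UNIV (\<lambda>y. w y * \<sigma> (z - y))"
      using w(1) \<sigma> by (intro continuous_intros continuous_on_compose2[OF \<sigma>]) auto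
    then have "integrable lborel (\<lambda>y. w y * \<sigma> (z - y))"
      by (rule integrable_compact_support[of _ a b]) (simp add: w(2))
    then have "conv w \<sigma> z = integral UNIV (\<lambda>y. w y * \<sigma> (z - y))"
      unfolding conv_def by (rule integral_lborel[symmetric])
    also have "\<dots> = integral UNIV (\<lambda>y. if y \<in> cbox a b then w y * \<sigma> (z - y) else 0)"
      by (rule arg_cong[where f = "integral UNIV"]) (auto simp: w(2))
    also have "\<dots> = integral (cbox a b) (\<lambda>y. w y * \<sigma> (z - y))"
      by (rule integral_restrict_UNIV)
    finally show ?thesis .
  qed
  have \<rho>c: "continuous_on UNIV \<rho>" using \<rho> by (rule C_k_continuous)
  have gc: "continuous_on UNIV (classical_grad \<rho>)" using \<rho> by (rule classical_grad_continuous)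
  define F where "F = (\<lambda>z y. w y *\<^sub>R blinfun_inner_left (classical_grad \<rho> (z - y)))"
  have "((\<lambda>z. integral (cbox a b) (\<lambda>y. w y * \<rho> (z - y))) has_derivative
      blinfun_apply (integral (cbox a b) (F x))) (at x within UNIV)"
  proof (rule leibniz_rule)
    fix z y
    have "((\<lambda>z. \<rho> (z - y)) has_derivative (\<lambda>h. classical_grad \<rho> (z - y) \<bullet> h)) (at z)"
      using \<rho> by (intro has_derivative_compose[where f = "\<lambda>z. z - y" and f' = "\<lambda>h. h",
          OF _ has_derivative_classical_grad]) (auto intro!: derivative_eq_intros)
    then show "((\<lambda>z. w y * \<rho> (z - y)) has_derivative blinfun_apply (F z y)) (at z within UNIV)"
      by (auto simp: F_def scaleR_blinfun.rep_eq inner_commute intro!: derivative_eq_intros)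
  next
    fix z
    have "continuous_on (cbox a b) (\<lambda>y. w y * \<rho> (z - y))"
      by (intro continuous_intros continuous_on_compose2[OF w(1)] continuous_on_compose2[OF \<rho>c]) auto
    then show "(\<lambda>y. w y * \<rho> (z - y)) integrable_on cbox a b" by (rule integrable_continuous)
  next
    show "continuous_on (UNIV \<times> cbox a b) (\<lambda>(z, y). F z y)"
      unfolding F_def split_beta
      by (intro continuous_intros bounded_linear.continuous_on[OF bounded_linear_blinfun_inner_left]
          continuous_on_compose2[OF w(1)] continuous_on_compose2[OF gc]) auto
  qed auto
  moreover have "conv w \<rho> = (\<lambda>z. integral (cbox a b) (\<lambda>y. w y * \<rho> (z - y)))"
    using eq[OF \<rho>c] by (rule ext)
  ultimately have 1: "(conv w \<rho> has_derivative blinfun_apply (integral (cbox a b) (F x))) (at x)"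
    by simp
  have "continuous_on (cbox a b) (F x)"
    unfolding F_def
    by (intro continuous_intros bounded_linear.continuous_on[OF bounded_linear_blinfun_inner_left]
        continuous_on_compose2[OF w(1)] continuous_on_compose2[OF gc]) auto
  then have "F x integrable_on cbox a b" by (rule integrable_continuous)
  then have 2: "blinfun_apply (integral (cbox a b) (F x)) (axis j 1) = conv w (partial_deriv j \<rho>) x" for j
    using \<rho> by (simp add: blinfun_apply_integral F_def scaleR_blinfun.rep_eq inner_axis'
        classical_grad_def eq)
  show ?thesis using 1 2 by blast
qed

lemma conv_smooth:
  assumes w: "continuous_on UNIV w" "\<And>y. y \<notin> cbox a b \<Longrightarrow> w y = 0"
    and \<rho>: "\<And>n. C_k n \<rho>"
  shows "C_k n (conv w \<rho>)"
  using \<rho>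
proof (induction n arbitrary: \<rho>)
  case 0
  have "conv w \<rho> differentiable (at x)" for x
    using conv_has_derivative[OF w, of a b \<rho> x] 0 unfolding differentiable_def by blast
  then show ?case
    by (auto simp: continuous_on_eq_continuous_at intro: differentiable_imp_continuous_within)
next
  case (Suc n)
  obtain D where D: "\<And>x. (conv w \<rho> has_derivative D x) (at x)"
    "\<And>x j. D x (axis j 1) = conv w (partial_deriv j \<rho>) x"
    using conv_has_derivative[OF w, of a b \<rho>] Suc.prems by metis
  show ?case
  proof (rule C_k_SucI[OF D(1)])
    fix j
    have "C_k m (partial_deriv j \<rho>)" for m using Suc.prems[of "Suc m"] by simp
    then show "C_k n (\<lambda>x. D x (axis j 1))" unfolding D(2) by (rule Suc.IH)
  qed
qed

lemma integral_domain_eq_lborel: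
  fixes f :: "pt \<Rightarrow> real"
  assumes "\<Omega> \<in> lmeasurable" "continuous_on UNIV f" "\<And>x. x \<notin> \<Omega> \<Longrightarrow> f x = 0"
  shows "(LINT x|lebesgue_on \<Omega>. f x) = (LINT x|lborel. f x)"
proof -
  have "(LINT x|lebesgue_on \<Omega>. f x) = (LINT x|lebesgue. indicator \<Omega> x *\<^sub>R f x)"
    using assms(1) by (intro integral_restrict_space) auto
  also have "(\<lambda>x. indicator \<Omega> x *\<^sub>R f x) = f" using assms(3) by (auto simp: indicator_def fun_eq_iff)
  also have "integral\<^sup>L lebesgue f = integral\<^sup>L lborel f"
    using borel_measurable_continuous_onI[OF assms(2)] by (intro integral_completion) simp
  finally show ?thesis .
qed

lemma test_function_continuous: "\<psi> \<in> test_functions \<Omega> \<Longrightarrow> continuous_on A \<psi>"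
  using C_k_continuous[OF test_function_C_k[where n = 0]] .

lemma test_function_compact_support:
  assumes "\<psi> \<in> test_functions \<Omega>"
  obtains a b where "\<And>x. x \<notin> cbox a b \<Longrightarrow> \<psi> x = 0"
proof -
  have "bounded (closure {x. \<psi> x \<noteq> 0})"
    using assms compact_imp_bounded by (auto simp: test_functions_def)
  then obtain a where "closure {x. \<psi> x \<noteq> 0} \<subseteq> cbox (-a) a"
    using bounded_subset_cbox_symmetric by blast
  then show ?thesis using that[of "-a" a] closure_subset[of "{x. \<psi> x \<noteq> 0}"] by blast
qed

text \<open>A derivative of the convolution of two smooth functions of compact support may be taken on
either factor, because convolution is commutative. At the origin, with \<open>\<phi>\<close> reflected, this
is integration by parts.\<close>

lemma test_functions_by_parts:
  assumes "\<Omega> \<in> lmeasurable" and \<psi>: "\<psi> \<in> test_functions \<Omega>" and \<phi>: "\<phi> \<in> test_functions \<Omega>"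
  shows "(LINT x|lebesgue_on \<Omega>. \<psi> x * partial_deriv j \<phi> x)
    = - (LINT x|lebesgue_on \<Omega>. partial_deriv j \<psi> x * \<phi> x)"
proof -
  define \<rho> where "\<rho> x = \<phi> (- x)" for x
  note cont = test_function_continuous[where \<Omega> = \<Omega>]
  note \<psi>' = partial_deriv_test_function[OF \<psi>, of j] and \<phi>' = partial_deriv_test_function[OF \<phi>]
  have d\<rho>: "(\<rho> has_derivative (\<lambda>h. - frechet_derivative \<phi> (at (- x)) h)) (at x)" for x
  proof -
    have d: "(\<phi> has_derivative frechet_derivative \<phi> (at (- x))) (at (- x))"
      using C_k_has_derivative[OF test_function_C_k[OF \<phi>]] .
    have "((\<lambda>x. \<phi> (- x)) has_derivative (\<lambda>h. frechet_derivative \<phi> (at (- x)) (- h))) (at x)"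
      by (rule has_derivative_compose[where f = uminus and f' = uminus, OF _ d])
        (auto intro!: derivative_eq_intros)
    then show ?thesis
      by (simp add: \<rho>_def[abs_def] linear_neg[OF has_derivative_linear[OF d]])
  qed
  have p\<rho>: "partial_deriv i \<rho> = (\<lambda>x. - partial_deriv i \<phi> (- x))" for i
    by (rule ext) (simp only: partial_deriv_eq[OF d\<rho>] partial_deriv_def[of i \<phi>])
  have \<rho>1: "C_k (Suc 0) \<rho>"
  proof -
    have "\<rho> differentiable (at x)" for x using d\<rho> unfolding differentiable_def by blast
    moreover have "continuous_on UNIV (\<lambda>x. - partial_deriv i \<phi> (- x))" for i
      by (intro continuous_on_minus continuous_on_compose2[OF cont[OF \<phi>', of UNIV]] continuous_on_id) auto
    ultimately show ?thesis by (simp add: p\<rho>)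
  qed
  have \<psi>1: "C_k (Suc 0) \<psi>" using test_function_C_k[OF \<psi>] .
  have c: "continuous_on UNIV \<rho>" "continuous_on UNIV \<psi>" using C_k_continuous \<rho>1 \<psi>1 by blast+
  obtain a b where s: "\<And>x. x \<notin> cbox a b \<Longrightarrow> \<psi> x = 0" using test_function_compact_support[OF \<psi>] by blast
  obtain a' b' where s'': "\<And>x. x \<notin> cbox a' b' \<Longrightarrow> \<phi> x = 0" using test_function_compact_support[OF \<phi>] by blast
  have s': "\<rho> x = 0" if "x \<notin> cbox (- b') (- a')" for x
  proof -
    have "- x \<notin> cbox a' b'"
    proof
      assume "- x \<in> cbox a' b'"
      then have "a' $ i \<le> - (x $ i) \<and> - (x $ i) \<le> b' $ i" for i by (simp add: mem_box_cart)
      then have "- (b' $ i) \<le> x $ i \<and> x $ i \<le> - (a' $ i)" for i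
        by (metis minus_le_iff le_minus_iff)
      then show False using that by (simp add: mem_box_cart)
    qed
    then show ?thesis unfolding \<rho>_def by (rule s'')
  qed
  obtain D where D: "(conv \<psi> \<rho> has_derivative D) (at 0)" "D (axis j 1) = conv \<psi> (partial_deriv j \<rho>) 0"
    using conv_has_derivative[OF c(2) s \<rho>1] by blast
  obtain D' where D': "(conv \<rho> \<psi> has_derivative D') (at 0)" "D' (axis j 1) = conv \<rho> (partial_deriv j \<psi>) 0"
    using conv_has_derivative[OF c(1) s' \<psi>1] by blast
  have "conv \<psi> \<rho> = conv \<rho> \<psi>" using conv_commute[OF c(2,1)] by auto
  then have "D = D'" using D D' has_derivative_unique by auto
  then have "conv \<psi> (partial_deriv j \<rho>) 0 = conv \<rho> (partial_deriv j \<psi>) 0" using D D' by simp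
  moreover have "conv \<psi> (partial_deriv j \<rho>) 0 = - (LINT x|lborel. \<psi> x * partial_deriv j \<phi> x)"
    by (simp add: conv_def p\<rho>)
  moreover have "conv \<rho> (partial_deriv j \<psi>) 0 = (LINT x|lborel. partial_deriv j \<psi> x * \<phi> x)"
    using conv_commute[OF c(1) cont[OF \<psi>'], of 0] by (simp add: conv_def \<rho>_def)
  moreover have "(LINT x|lebesgue_on \<Omega>. \<psi> x * partial_deriv j \<phi> x) = (LINT x|lborel. \<psi> x * partial_deriv j \<phi> x)"
    by (intro integral_domain_eq_lborel assms(1) continuous_intros cont \<psi> \<phi>')
      (simp add: test_function_outside[OF \<psi>])
  moreover have "(LINT x|lebesgue_on \<Omega>. partial_deriv j \<psi> x * \<phi> x) = (LINT x|lborel. partial_deriv j \<psi> x * \<phi> x)"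
    by (intro integral_domain_eq_lborel assms(1) continuous_intros cont \<psi>' \<phi>)
      (simp add: test_function_outside[OF \<phi>])
  ultimately show ?thesis by simp
qed

definition mollifier :: "real \<Rightarrow> (pt \<Rightarrow> real) \<Rightarrow> bool" where
  "mollifier r \<rho> \<longleftrightarrow> (\<forall>n. C_k n \<rho>) \<and> (\<forall>z. 0 \<le> \<rho> z) \<and> (\<forall>z. \<rho> z \<noteq> 0 \<longrightarrow> norm z < r) \<and>
     integrable lborel \<rho> \<and> (LINT z|lborel. \<rho> z) = 1"

lemma mollifier_exists:
  assumes "r > 0"
  shows "\<exists>\<rho>. mollifier r \<rho>"
proof -
  \<comment> \<open>In three dimensions a cube of half-width \<open>r / 3\<close> lies in the ball of radius \<open>r\<close>.\<close>
  define s where "s = r / 3"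
  let ?a = "vec (- s) :: pt" and ?b = "vec s :: pt"
  let ?\<beta> = "box_bump 1 ?a ?b"
  have s: "s > 0" using assms by (simp add: s_def)
  have cont: "continuous_on UNIV ?\<beta>" using C_k_continuous[OF C_k_box_bump[of 1 0]] by simp
  have int: "integrable lborel ?\<beta>"
    by (rule integrable_compact_support[OF cont, of ?a ?b])
      (use box_subset_cbox[of ?a ?b] box_bump_outside in blast)
  have nn: "0 \<le> ?\<beta> z" for z using box_bump_bounds[of 1] by simp
  define I where "I = (LINT z|lborel. ?\<beta> z)"
  have "I \<noteq> 0"
  proof
    assume "I = 0"
    then have "AE z in lborel. ?\<beta> z = 0"
      using integral_nonneg_eq_0_iff_AE[OF int] nn by (simp add: I_def)
    then obtain N where N: "\<And>z. z \<in> space lborel - N \<Longrightarrow> ?\<beta> z = 0" "N \<in> null_sets lborel"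
      by (elim AE_E3) blast
    have "box ?a ?b \<subseteq> N"
    proof
      fix z assume "z \<in> box ?a ?b"
      then have "?\<beta> z > 0" by (rule box_bump_inside)
      then show "z \<in> N" using N(1)[of z] by auto
    qed
    moreover have "negligible N"
      using null_sets_completionI[OF N(2)] by (simp add: negligible_iff_null_sets)
    ultimately have "negligible (box ?a ?b)" by (rule negligible_subset[rotated])
    moreover have "0 \<in> box ?a ?b" using s by (simp add: mem_box_cart)
    ultimately show False using open_not_negligible[OF open_box] by blast
  qed
  then have I: "I > 0" using Bochner_Integration.integral_nonneg[of lborel ?\<beta>] nn by (simp add: I_def order_less_le)
  have "mollifier r (\<lambda>z. inverse I * ?\<beta> z)"
    unfolding mollifier_def
  proof (intro conjI allI impI)
    show "C_k n (\<lambda>z. inverse I * ?\<beta> z)" for n by (intro C_k_mult C_k_const C_k_box_bump) simp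
    show "0 \<le> inverse I * ?\<beta> z" for z using I nn by simp
    show "norm z < r" if "inverse I * ?\<beta> z \<noteq> 0" for z
    proof -
      have "z \<in> box ?a ?b" using that box_bump_outside by fastforce
      then have "- s < z $ i \<and> z $ i < s" for i by (simp add: mem_box_cart)
      then have "\<bar>z $ i\<bar> < s" for i by (simp only: abs_less_iff) (metis minus_less_iff)
      then have "(\<Sum>i\<in>UNIV. \<bar>z $ i\<bar>) < (\<Sum>i\<in>(UNIV :: 3 set). s)" by (intro sum_strict_mono) auto
      then show ?thesis using norm_le_l1_cart[of z] by (simp add: s_def)
    qed
    show "integrable lborel (\<lambda>z. inverse I * ?\<beta> z)" using int by simp
    show "(LINT z|lborel. inverse I * ?\<beta> z) = 1" using I by (simp flip: I_def)
  qed
  then show ?thesis by blast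
qed

lemma conv_eq_average:
  assumes w: "continuous_on UNIV w" and \<rho>: "mollifier r \<rho>"
  shows "conv w \<rho> x = (LINT z|lborel. w (x - z) * \<rho> z)"
proof -
  have "continuous_on UNIV \<rho>" using \<rho> C_k_continuous[of 0 \<rho>] by (simp add: mollifier_def)
  then show ?thesis by (subst conv_commute[OF w]) (simp_all add: conv_def mult.commute)
qed

lemma conv_average_integrable:
  assumes w: "continuous_on UNIV w" and \<rho>: "mollifier r \<rho>"
  shows "integrable lborel (\<lambda>z. w (x - z) * \<rho> z)"
proof -
  have "continuous_on UNIV (\<lambda>z. w (x - z) * \<rho> z)"
    using \<rho> C_k_continuous[of 0 \<rho> UNIV]
    by (intro continuous_intros continuous_on_compose2[OF w]) (auto simp: mollifier_def)
  moreover have "w (x - z) * \<rho> z = 0" if "z \<notin> cbox (vec (- r)) (vec r)" for z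
  proof -
    have "z \<in> cbox (vec (- r)) (vec r)" if "norm z < r"
    proof -
      have "- r \<le> z $ i \<and> z $ i \<le> r" for i using component_le_norm_cart[of z i] that by linarith
      then show ?thesis by (simp add: mem_box_cart)
    qed
    then show ?thesis using that \<rho> by (auto simp: mollifier_def)
  qed
  ultimately show ?thesis by (rule integrable_compact_support)
qed

text \<open>Mollification is averaging over translates, so an estimate that holds for all translates by
less than \<open>r\<close> survives it. The case \<open>v = 0\<close> controls values, the case \<open>v = w\<close> with a
linear increment for \<open>c\<close> controls difference quotients.\<close>

lemma conv_average_bound:
  assumes w: "continuous_on UNIV w" and v: "continuous_on UNIV v" and \<rho>: "mollifier r \<rho>"
    and bound: "\<And>z. norm z < r \<Longrightarrow> \<bar>w (x - z) - v (y - z) - c\<bar> \<le> B"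
  shows "\<bar>conv w \<rho> x - conv v \<rho> y - c\<bar> \<le> B"
proof -
  have \<rho>i: "integrable lborel \<rho>" and \<rho>1: "(LINT z|lborel. \<rho> z) = 1" using \<rho> by (auto simp: mollifier_def)
  note i = conv_average_integrable[OF w \<rho>, of x] conv_average_integrable[OF v \<rho>, of y]
  have eq: "conv w \<rho> x - conv v \<rho> y - c = (LINT z|lborel. w (x - z) * \<rho> z - v (y - z) * \<rho> z - c * \<rho> z)"
    using i \<rho>i \<rho>1 by (simp add: conv_eq_average[OF w \<rho>] conv_eq_average[OF v \<rho>])
  have "\<bar>LINT z|lborel. w (x - z) * \<rho> z - v (y - z) * \<rho> z - c * \<rho> z\<bar>
      \<le> (LINT z|lborel. B * \<rho> z)"
  proof (rule Bochner_Integration.integral_abs_bound_integral)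
    show "integrable lborel (\<lambda>z. w (x - z) * \<rho> z - v (y - z) * \<rho> z - c * \<rho> z)" using i \<rho>i by simp
    show "integrable lborel (\<lambda>z. B * \<rho> z)" using \<rho>i by simp
    fix z
    have "\<bar>w (x - z) * \<rho> z - v (y - z) * \<rho> z - c * \<rho> z\<bar> = \<bar>w (x - z) - v (y - z) - c\<bar> * \<rho> z"
      using \<rho> by (simp add: mollifier_def abs_mult flip: left_diff_distrib)
    also have "\<dots> \<le> B * \<rho> z"
      using \<rho> bound[of z] by (cases "\<rho> z = 0") (auto simp: mollifier_def intro: mult_right_mono)
    finally show "\<bar>w (x - z) * \<rho> z - v (y - z) * \<rho> z - c * \<rho> z\<bar> \<le> B * \<rho> z" .
  qed
  then show ?thesis using eq \<rho>1 by simp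
qed

text \<open>It suffices to move in the direction of \<open>v\<close> itself.\<close>

lemma gradient_bound:
  fixes F :: "'a::real_inner \<Rightarrow> real"
  assumes F: "(F has_derivative (\<lambda>h. v \<bullet> h)) (at x)" and "0 < d" "0 \<le> c"
    and bound: "\<And>h. norm h < d \<Longrightarrow> \<bar>F (x + h) - F x\<bar> \<le> c * norm h"
  shows "norm v \<le> c"
proof (cases "v = 0")
  case True
  then show ?thesis using assms(3) by simp
next
  case False
  have "((\<lambda>t. F (x + t *\<^sub>R v)) has_derivative (\<lambda>t. v \<bullet> (t *\<^sub>R v))) (at 0)"
    by (rule has_derivative_compose[where f = "\<lambda>t. x + t *\<^sub>R v" and x = 0 and s = UNIV])
      (use F in \<open>auto intro!: derivative_eq_intros\<close>)
  then have "((\<lambda>t. F (x + t *\<^sub>R v)) has_real_derivative v \<bullet> v) (at 0)"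
    by (simp add: has_field_derivative_def mult.commute[of _ "v \<bullet> v"])
  then have lim: "((\<lambda>t. (F (x + t *\<^sub>R v) - F x) / t) \<longlongrightarrow> v \<bullet> v) (at 0)"
    by (simp add: has_field_derivative_iff)
  have "\<forall>\<^sub>F t in at 0. (F (x + t *\<^sub>R v) - F x) / t \<le> c * norm v"
    unfolding eventually_at
  proof (intro exI[of _ "d / norm v"] conjI ballI impI)
    show "0 < d / norm v" using False \<open>0 < d\<close> by simp
    fix t :: real assume t: "t \<noteq> 0 \<and> dist t 0 < d / norm v"
    then have "norm (t *\<^sub>R v) < d" using False by (simp add: field_simps)
    then have "\<bar>F (x + t *\<^sub>R v) - F x\<bar> \<le> c * norm v * \<bar>t\<bar>" using bound[of "t *\<^sub>R v"] by (simp add: mult_ac)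
    then have "\<bar>(F (x + t *\<^sub>R v) - F x) / t\<bar> \<le> c * norm v" using t by (simp add: field_simps)
    then show "(F (x + t *\<^sub>R v) - F x) / t \<le> c * norm v" by linarith
  qed
  then have "v \<bullet> v \<le> c * norm v" by (rule tendsto_upperbound[OF lim]) simp
  then have "norm v * norm v \<le> c * norm v" by (simp add: dot_square_norm power2_eq_square)
  then show ?thesis using False by simp
qed

text \<open>If the increments of \<open>w\<close> near \<open>x\<close> are those of the linear map \<open>l\<close> up to a small multiple
of the step, the same is true after averaging. With \<open>l = 0\<close> this bounds the gradient by a
Lipschitz constant; where \<open>w\<close> is continuously differentiable, it gives the convergence of the
gradients.\<close>

lemma conv_gradient_bound:
  assumes w: "continuous_on UNIV w" "\<And>y. y \<notin> cbox a b \<Longrightarrow> w y = 0"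
    and \<rho>: "mollifier r \<rho>" and "r < R" "0 \<le> c"
    and bound: "\<And>y h. y \<in> ball x R \<Longrightarrow> y + h \<in> ball x R \<Longrightarrow> \<bar>w (y + h) - w y - l \<bullet> h\<bar> \<le> c * norm h"
  shows "norm (classical_grad (conv w \<rho>) x - l) \<le> c"
proof -
  have "C_k (Suc 0) (conv w \<rho>)"
    using conv_smooth[OF w, of a b \<rho>] \<rho> by (auto simp: mollifier_def)
  then have d: "(conv w \<rho> has_derivative (\<lambda>h. classical_grad (conv w \<rho>) x \<bullet> h)) (at x)"
    by (intro has_derivative_classical_grad) simp
  have "((\<lambda>z. conv w \<rho> z - l \<bullet> z) has_derivative (\<lambda>h. (classical_grad (conv w \<rho>) x - l) \<bullet> h)) (at x)"
    using d by (auto intro!: derivative_eq_intros simp: inner_diff_left)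
  then show ?thesis
  proof (rule gradient_bound)
    show "0 < R - r" using assms by simp
    fix h :: pt assume h: "norm h < R - r"
    have "\<bar>conv w \<rho> (x + h) - conv w \<rho> x - l \<bullet> h\<bar> \<le> c * norm h"
    proof (rule conv_average_bound[OF w(1) w(1) \<rho>])
      fix z :: pt assume z: "norm z < r"
      have "norm (h - z) < R" using norm_triangle_ineq4[of h z] h z by linarith
      moreover have "norm z < R" using z \<open>r < R\<close> by simp
      ultimately show "\<bar>w (x + h - z) - w (x - z) - l \<bullet> h\<bar> \<le> c * norm h"
        using bound[of "x - z" h] by (simp add: dist_norm norm_minus_commute algebra_simps)
    qed
    then show "\<bar>conv w \<rho> (x + h) - l \<bullet> (x + h) - (conv w \<rho> x - l \<bullet> x)\<bar> \<le> c * norm h"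
      by (simp add: inner_add_right algebra_simps)
  qed fact
qed

section \<open>Conforming finite elements have zero boundary values\<close>

context open_domain
begin

text \<open>Bounded pointwise convergence is convergence in \<open>L\<^sup>2\<close> on a set of finite measure. The
pointwise limit of the gradients is the weak gradient of \<open>u\<close>, since integration by parts
passes to the limit; so the gradients converge to it in \<open>L\<^sup>2\<close> as well.\<close>

lemma H10_of_pointwise_approximation:
  assumes test: "\<And>n::nat. \<psi> n \<in> test_functions \<Omega>"
    and bound: "\<And>n x. \<bar>\<psi> n x\<bar> \<le> M" "\<And>n x. norm (classical_grad (\<psi> n) x) \<le> M"
    and lim: "\<And>x. x \<in> \<Omega> \<Longrightarrow> (\<lambda>n. \<psi> n x) \<longlonglongrightarrow> u x"
    and grad_lim: "AE x in lebesgue_on \<Omega>. convergent (\<lambda>n. classical_grad (\<psi> n) x)"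
  shows "u \<in> H10 \<Omega>"
proof -
  let ?M = "lebesgue_on \<Omega>"
  define G where "G x = lim (\<lambda>n. classical_grad (\<psi> n) x)" for x
  have gm: "classical_grad (\<psi> n) \<in> borel_measurable ?M" for n
    using L2_measurable classical_grad_test_L2[OF test] by blast
  have \<psi>m: "\<psi> n \<in> borel_measurable ?M" for n
    using L2_measurable test_function_L2[OF meas_dom test] by blast
  have sp: "space ?M = \<Omega>" by (simp add: space_restrict_space)
  have G_lim: "AE x in ?M. (\<lambda>n. classical_grad (\<psi> n) x) \<longlonglongrightarrow> G x"
    using grad_lim by eventually_elim (simp add: G_def convergent_LIMSEQ_iff)
  have Gm: "G \<in> borel_measurable ?M" unfolding G_def using gm by (rule borel_measurable_lim_metric)
  have um: "u \<in> borel_measurable ?M"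
    by (rule borel_measurable_LIMSEQ_metric[where f = \<psi>]) (simp_all add: sp lim \<psi>m)
  have ub: "\<bar>u x\<bar> \<le> M" if "x \<in> \<Omega>" for x
    using LIMSEQ_le_const2[OF tendsto_rabs[OF lim[OF that]]] bound(1) by blast
  have Gb: "AE x in ?M. norm (G x) \<le> M"
    using G_lim by eventually_elim (rule LIMSEQ_le_const2[OF tendsto_norm], use bound(2) in auto)
  have uL: "u \<in> L2 \<Omega>" by (rule L2_bounded[OF meas_dom um]) (use ub in \<open>auto intro!: AE_I2 simp: sp\<close>)
  have GL: "G \<in> L2 \<Omega>" by (rule L2_bounded[OF meas_dom Gm Gb])
  have weak: "has_weak_grad \<Omega> u G"
    unfolding has_weak_grad_def
  proof (intro ballI allI)
    fix \<phi> j assume \<phi>: "\<phi> \<in> test_functions \<Omega>"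
    note \<phi>' = partial_deriv_test_function[OF \<phi>, of j]
    have ti: "integrable ?M (\<lambda>x. M * \<bar>t x\<bar>)" if "t \<in> test_functions \<Omega>" for t
      using L2_imp_integrable[OF meas_dom test_function_L2[OF meas_dom that]] by simp
    have tm: "t \<in> borel_measurable ?M" if "t \<in> test_functions \<Omega>" for t
      using L2_measurable test_function_L2[OF meas_dom that] by blast
    have cm: "(\<lambda>x. f x $ j) \<in> borel_measurable ?M" if "f \<in> borel_measurable ?M" for f :: "pt \<Rightarrow> real^3"
      by (rule borel_measurable_continuous_on[OF continuous_on_component[OF continuous_on_id] that])
    have 1: "(\<lambda>n. LINT x|?M. \<psi> n x * partial_deriv j \<phi> x) \<longlonglongrightarrow> (LINT x|?M. u x * partial_deriv j \<phi> x)"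
    proof (rule integral_dominated_convergence[OF _ _ ti[OF \<phi>']])
      show "AE x in ?M. (\<lambda>n. \<psi> n x * partial_deriv j \<phi> x) \<longlonglongrightarrow> u x * partial_deriv j \<phi> x"
        by (intro AE_I2 tendsto_mult tendsto_const lim) (simp add: sp)
      show "AE x in ?M. norm (\<psi> n x * partial_deriv j \<phi> x) \<le> M * \<bar>partial_deriv j \<phi> x\<bar>" for n
        using bound(1) by (intro AE_I2) (simp add: abs_mult mult_right_mono)
    qed (intro borel_measurable_times um \<psi>m tm \<phi>')+
    have 2: "(\<lambda>n. LINT x|?M. classical_grad (\<psi> n) x $ j * \<phi> x) \<longlonglongrightarrow> (LINT x|?M. G x $ j * \<phi> x)"
    proof (rule integral_dominated_convergence[OF _ _ ti[OF \<phi>]])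
      show "AE x in ?M. (\<lambda>n. classical_grad (\<psi> n) x $ j * \<phi> x) \<longlonglongrightarrow> G x $ j * \<phi> x"
        using G_lim by eventually_elim (intro tendsto_mult tendsto_const tendsto_vec_nth)
      show "AE x in ?M. norm (classical_grad (\<psi> n) x $ j * \<phi> x) \<le> M * \<bar>\<phi> x\<bar>" for n
        using order_trans[OF component_le_norm_cart bound(2)]
        by (intro AE_I2) (simp add: abs_mult mult_right_mono)
    qed (intro borel_measurable_times cm gm Gm tm \<phi>)+
    have "(LINT x|?M. \<psi> n x * partial_deriv j \<phi> x) = - (LINT x|?M. classical_grad (\<psi> n) x $ j * \<phi> x)" for n
      using test_functions_by_parts[OF meas_dom test \<phi>] by (simp add: classical_grad_def)
    then show "(LINT x|?M. u x * partial_deriv j \<phi> x) = - (LINT x|?M. G x $ j * \<phi> x)"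
      using LIMSEQ_unique[OF 1] tendsto_minus[OF 2] by simp
  qed
  have uH: "u \<in> H1 \<Omega>" using H1I[OF uL GL weak] .
  have wg: "AE x in ?M. wgrad \<Omega> u x = G x" using wgrad_eqI[OF uL GL weak] .
  have "(\<lambda>n. L2_norm \<Omega> (\<lambda>x. u x - \<psi> n x)) \<longlonglongrightarrow> 0"
  proof (rule L2_norm_dominated[OF meas_dom])
    show "AE x in ?M. norm (u x - \<psi> n x) \<le> M + M" for n
    proof (rule AE_I2)
      fix x assume "x \<in> space ?M"
      then have "\<bar>u x\<bar> \<le> M" using ub by (simp add: sp)
      then show "norm (u x - \<psi> n x) \<le> M + M" using bound(1)[of n x] by simp
    qed
    show "AE x in ?M. (\<lambda>n. u x - \<psi> n x) \<longlonglongrightarrow> 0"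
    proof (rule AE_I2)
      fix x assume "x \<in> space ?M"
      then have "(\<lambda>n. u x - \<psi> n x) \<longlonglongrightarrow> u x - u x"
        by (intro tendsto_diff tendsto_const lim) (simp add: sp)
      then show "(\<lambda>n. u x - \<psi> n x) \<longlonglongrightarrow> 0" by simp
    qed
  qed (intro borel_measurable_diff um \<psi>m)
  moreover have "(\<lambda>n. L2_norm \<Omega> (\<lambda>x. wgrad \<Omega> u x - classical_grad (\<psi> n) x)) \<longlonglongrightarrow> 0"
  proof (rule L2_norm_limit_cong_AE)
    show "(\<lambda>n. L2_norm \<Omega> (\<lambda>x. G x - classical_grad (\<psi> n) x)) \<longlonglongrightarrow> 0"
    proof (rule L2_norm_dominated[OF meas_dom])
      show "AE x in ?M. norm (G x - classical_grad (\<psi> n) x) \<le> M + M" for n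
        using Gb
      proof eventually_elim
        case (elim x)
        then show ?case using norm_triangle_ineq4[of "G x" "classical_grad (\<psi> n) x"] bound(2)[where n = n and x = x] by linarith
      qed
      show "AE x in ?M. (\<lambda>n. G x - classical_grad (\<psi> n) x) \<longlonglongrightarrow> 0"
        using G_lim
      proof eventually_elim
        case (elim x)
        from tendsto_diff[OF tendsto_const elim] show ?case by (metis diff_self)
      qed
    qed (intro borel_measurable_diff Gm gm)
    show "AE x in ?M. wgrad \<Omega> u x - classical_grad (\<psi> n) x = G x - classical_grad (\<psi> n) x" for n
      using wg by eventually_elim simp
  qed (intro L2.closed_diff H1_wgrad(1)[OF uH] GL classical_grad_test_L2 test)+
  ultimately show ?thesis unfolding H10_def using uH test by blast
qed

end

text \<open>Unlike multiplication by a cut-off function, clamping obeys a Lipschitz estimate without any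
product rule.\<close>

definition clamp_between :: "real \<Rightarrow> real \<Rightarrow> real" where
  "clamp_between g t = max (- g) (min t g)"

lemma clamp_between_Lipschitz:
  "\<bar>clamp_between g t - clamp_between g' t'\<bar> \<le> max \<bar>g - g'\<bar> \<bar>t - t'\<bar>"
  unfolding clamp_between_def by (simp add: max_def min_def abs_if)

text \<open>With \<open>d\<close> the distance to the complement, \<open>u\<close> is clamped between \<open>-g\<close> and \<open>g\<close> for
\<open>g = 2 L max(0, d - e)\<close>. The result vanishes where \<open>d \<le> e\<close> and, because \<open>\<bar>u\<bar> \<le> L d\<close>,
equals \<open>u\<close> where \<open>d \<ge> 2 e\<close>; it has the Lipschitz constant \<open>2 L\<close>. Mollified at a
scale below \<open>e\<close>, it is a test function. As \<open>e\<close> tends to zero, values and gradients remain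
bounded and converge pointwise, the gradients wherever \<open>u\<close> is locally smooth.\<close>

lemma H10_of_Lipschitz:
  fixes u :: "pt \<Rightarrow> real"
  assumes \<Omega>: "open \<Omega>" "bounded \<Omega>"
    and Lip: "L-lipschitz_on UNIV u" and zero: "\<And>x. x \<notin> \<Omega> \<Longrightarrow> u x = 0"
    and smooth: "AE x in lebesgue_on \<Omega>. \<exists>q R. 0 < R \<and> ball x R \<subseteq> \<Omega> \<and> C_k (Suc 0) q \<and> (\<forall>y\<in>ball x R. u y = q y)"
  shows "u \<in> H10 \<Omega>"
proof -
  have meas: "\<Omega> \<in> lmeasurable" using \<Omega> by (rule lmeasurable_open[rotated])
  interpret open_domain \<Omega> by standard (use \<Omega> meas in auto)
  have L0: "0 \<le> L" using lipschitz_on_nonneg[OF Lip] .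
  have uL: "\<bar>u x - u y\<bar> \<le> L * norm (x - y)" for x y
    using lipschitz_onD[OF Lip, of x y] by (simp add: dist_norm)
  define d where "d x = infdist x (- \<Omega>)" for x
  have ne: "- \<Omega> \<noteq> {}"
  proof
    assume "- \<Omega> = {}"
    then have "\<Omega> = UNIV" by blast
    then show False using \<Omega>(2) by simp
  qed
  have cl: "closed (- \<Omega>)" using \<Omega>(1) by (simp add: closed_Compl)
  have dLip: "\<bar>d x - d y\<bar> \<le> norm (x - y)" for x y
    unfolding d_def using infdist_triangle_abs[of x "- \<Omega>" y] by (simp add: dist_norm)
  have d0: "d x = 0" if "x \<notin> \<Omega>" for x using that by (simp add: d_def)
  have dpos: "0 < d x" if "x \<in> \<Omega>" for x
    unfolding d_def using infdist_pos_not_in_closed[OF cl ne] that by simp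
  have dnn: "0 \<le> d x" for x by (simp add: d_def infdist_nonneg)
  have ud: "\<bar>u x\<bar> \<le> L * d x" for x
  proof -
    obtain y where "y \<in> - \<Omega>" "infdist x (- \<Omega>) = dist x y" using infdist_attains_inf[OF cl ne] by blast
    then show ?thesis using uL[of x y] zero[of y] by (simp add: d_def dist_norm)
  qed
  define g where "g e x = 2 * L * max 0 (d x - e)" for e x
  define w where "w e x = clamp_between (g e x) (u x)" for e x
  have wLip: "\<bar>w e x - w e y\<bar> \<le> 2 * L * norm (x - y)" for e x y
  proof -
    have "\<bar>max 0 (d x - e) - max 0 (d y - e)\<bar> \<le> norm (x - y)" using dLip[of x y] by linarith
    then have "\<bar>g e x - g e y\<bar> \<le> 2 * L * norm (x - y)"
      using L0 by (simp add: g_def abs_mult mult_left_mono flip: right_diff_distrib)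
    moreover have "\<bar>u x - u y\<bar> \<le> 2 * L * norm (x - y)"
      using uL[of x y] mult_nonneg_nonneg[OF L0 norm_ge_zero[of "x - y"]] by linarith
    ultimately show ?thesis using clamp_between_Lipschitz[of "g e x" "u x" "g e y" "u y"] by (simp add: w_def)
  qed
  have g0: "0 \<le> g e x" for e x using L0 by (simp add: g_def)
  have w_le: "\<bar>w e x\<bar> \<le> \<bar>u x\<bar>" for e x using g0[of e x] by (auto simp: w_def clamp_between_def)
  have w_supp: "d x > e" if "w e x \<noteq> 0" for e x
  proof (rule ccontr)
    assume "\<not> d x > e"
    then have "g e x = 0" by (simp add: g_def)
    then show False using that by (simp add: w_def clamp_between_def)
  qed
  have w_eq: "w e x = u x" if "2 * e \<le> d x" for e x
  proof -
    have "L * d x \<le> L * (2 * (d x - e))" using L0 that by (intro mult_left_mono) auto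
    also have "\<dots> = 2 * L * (d x - e)" by simp
    also have "\<dots> \<le> g e x" unfolding g_def using L0 by (intro mult_left_mono) auto
    finally show ?thesis using ud[of x] by (auto simp: w_def clamp_between_def)
  qed
  have w_cont: "continuous_on UNIV (w e)" for e
  proof -
    have "(2 * L)-lipschitz_on UNIV (w e)"
      by (rule lipschitz_onI) (use wLip L0 in \<open>auto simp: dist_norm\<close>)
    then show ?thesis by (rule lipschitz_on_continuous_on)
  qed
  obtain c where c: "\<Omega> \<subseteq> cbox (- c) c" using bounded_subset_cbox_symmetric[OF \<Omega>(2)] by blast
  have w_out: "w e x = 0" if "x \<notin> cbox (- c) c" for e x
  proof -
    have "x \<notin> \<Omega>" using that c by blast
    then show ?thesis using w_le[of e x] zero[of x] by simp
  qed
  have "bounded (u ` cbox (- c) c)"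
    using lipschitz_on_continuous_on[OF Lip]
    by (intro compact_imp_bounded compact_continuous_image compact_cbox) (auto intro: continuous_on_subset)
  then obtain B where B: "\<And>x. x \<in> cbox (- c) c \<Longrightarrow> \<bar>u x\<bar> \<le> B" by (auto simp: bounded_iff)
  have uB: "\<bar>u x\<bar> \<le> max B 0" for x
  proof (cases "x \<in> cbox (- c) c")
    case False
    then have "x \<notin> \<Omega>" using c by blast
    then show ?thesis using zero[of x] by simp
  qed (use B[of x] in simp)
  \<comment> \<open>Cut-off distance; the mollification radius is half of it.\<close>
  define \<epsilon> where "\<epsilon> n = inverse (real (Suc n))" for n
  have \<epsilon>: "0 < \<epsilon> n" "\<epsilon> \<longlonglongrightarrow> 0" for n
    using LIMSEQ_inverse_real_of_nat by (simp_all add: \<epsilon>_def[abs_def])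
  have "\<exists>\<rho>. \<forall>n. mollifier (\<epsilon> n / 2) (\<rho> n)"
    using mollifier_exists \<epsilon>(1) by (intro choice) simp
  then obtain \<rho> where \<rho>: "\<And>n. mollifier (\<epsilon> n / 2) (\<rho> n)" by blast
  define \<psi> where "\<psi> n = conv (w (\<epsilon> n)) (\<rho> n)" for n
  define M where "M = max (max B 0) (2 * L)"
  have zc: "continuous_on UNIV (\<lambda>x::pt. 0::real)" by simp
  have near: "\<bar>\<psi> n x - w (\<epsilon> n) x\<bar> \<le> 2 * L * \<epsilon> n" for n x
  proof -
    have "\<bar>conv (w (\<epsilon> n)) (\<rho> n) x - conv (\<lambda>x. 0) (\<rho> n) x - w (\<epsilon> n) x\<bar> \<le> 2 * L * \<epsilon> n"
    proof (rule conv_average_bound[OF w_cont zc \<rho>])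
      fix z :: pt assume "norm z < \<epsilon> n / 2"
      then have "norm z \<le> \<epsilon> n" using \<epsilon>(1)[of n] by linarith
      then have "2 * L * norm z \<le> 2 * L * \<epsilon> n" using L0 by (intro mult_left_mono) auto
      then show "\<bar>w (\<epsilon> n) (x - z) - 0 - w (\<epsilon> n) x\<bar> \<le> 2 * L * \<epsilon> n"
        using wLip[of "\<epsilon> n" "x - z" x] by simp
    qed
    then show ?thesis by (simp add: \<psi>_def conv_def[of "\<lambda>x. 0"])
  qed
  show ?thesis
  proof (rule H10_of_pointwise_approximation)
    show "\<psi> n \<in> test_functions \<Omega>" for n
    proof -
      let ?K = "{x. \<epsilon> n / 2 \<le> d x}"
      have sub: "{x. \<psi> n x \<noteq> 0} \<subseteq> ?K"
      proof
        fix x assume "x \<in> {x. \<psi> n x \<noteq> 0}"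
        then have "(LINT z|lborel. w (\<epsilon> n) (x - z) * \<rho> n z) \<noteq> 0"
          by (simp add: \<psi>_def conv_eq_average[OF w_cont \<rho>])
        then obtain z where "w (\<epsilon> n) (x - z) * \<rho> n z \<noteq> 0"
          by (metis (mono_tags, lifting) integral_zero Bochner_Integration.integral_cong)
        then have "w (\<epsilon> n) (x - z) \<noteq> 0" "norm z < \<epsilon> n / 2" using \<rho>[of n] by (auto simp: mollifier_def)
        then show "x \<in> ?K" using w_supp[of "\<epsilon> n" "x - z"] dLip[of x "x - z"] by simp
      qed
      have "continuous_on UNIV d" unfolding d_def by (intro continuous_on_infdist continuous_on_id)
      then have "closed ?K" by (intro closed_Collect_le continuous_on_const) auto
      then have cl: "closure {x. \<psi> n x \<noteq> 0} \<subseteq> ?K" using sub by (rule closure_minimal[rotated])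
      have "?K \<subseteq> \<Omega>" using d0 \<epsilon>(1)[of n] by force
      then have "compact ?K" using \<open>closed ?K\<close> \<Omega>(2) bounded_subset compact_eq_bounded_closed by blast
      then have "compact (closure {x. \<psi> n x \<noteq> 0})" using cl compact_closure_subset by blast
      moreover have "C_k m (\<psi> n)" for m
        unfolding \<psi>_def using \<rho>[of n] by (intro conv_smooth[OF w_cont w_out]) (auto simp: mollifier_def)
      ultimately show ?thesis using cl \<open>?K \<subseteq> \<Omega>\<close> by (auto simp: test_functions_def)
    qed
    show "\<bar>\<psi> n x\<bar> \<le> M" for n x
    proof -
      have "\<bar>conv (w (\<epsilon> n)) (\<rho> n) x - conv (\<lambda>x. 0) (\<rho> n) x - 0\<bar> \<le> max B 0"
        by (rule conv_average_bound[OF w_cont zc \<rho>]) (use w_le uB order_trans in fastforce)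
      then show ?thesis by (simp add: \<psi>_def conv_def[of "\<lambda>x. 0"] M_def)
    qed
    show "norm (classical_grad (\<psi> n) x) \<le> M" for n x
    proof -
      have "norm (classical_grad (conv (w (\<epsilon> n)) (\<rho> n)) x - 0) \<le> 2 * L"
      proof (rule conv_gradient_bound[OF w_cont w_out \<rho>, where R = "\<epsilon> n"])
        show "\<bar>w (\<epsilon> n) (y + h) - w (\<epsilon> n) y - 0 \<bullet> h\<bar> \<le> 2 * L * norm h" for y h
          using wLip[of "\<epsilon> n" "y + h" y] by simp
      qed (use L0 \<epsilon>(1)[of n] in auto)
      then show ?thesis by (simp add: \<psi>_def M_def)
    qed
    show "(\<lambda>n. \<psi> n x) \<longlonglongrightarrow> u x" if "x \<in> \<Omega>" for x
    proof -
      have "\<forall>\<^sub>F n in sequentially. \<epsilon> n < d x / 2"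
        using order_tendstoD(2)[OF \<epsilon>(2), of "d x / 2"] dpos[OF that] by simp
      then have "\<forall>\<^sub>F n in sequentially. norm (\<psi> n x - u x) \<le> 2 * L * \<epsilon> n"
      proof eventually_elim
        case (elim n)
        then show ?case using near[of n x] w_eq[of "\<epsilon> n" x] by simp
      qed
      moreover have "(\<lambda>n. 2 * L * \<epsilon> n) \<longlonglongrightarrow> 0" using tendsto_mult[OF tendsto_const \<epsilon>(2), of "2 * L"] by simp
      ultimately have "(\<lambda>n. \<psi> n x - u x) \<longlonglongrightarrow> 0" by (rule Lim_null_comparison)
      then show ?thesis by (simp add: LIM_zero_iff)
    qed
    show "AE x in lebesgue_on \<Omega>. convergent (\<lambda>n. classical_grad (\<psi> n) x)"
      using smooth AE_space
    proof eventually_elim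
      case (elim x)
      then obtain q R where q: "0 < R" "ball x R \<subseteq> \<Omega>" "C_k (Suc 0) q" "\<And>y. y \<in> ball x R \<Longrightarrow> u y = q y"
        by auto
      have "x \<in> \<Omega>" using q by auto
      let ?l = "classical_grad q x"
      have "(\<lambda>n. classical_grad (\<psi> n) x) \<longlonglongrightarrow> ?l"
      proof (rule LIMSEQ_I)
        fix e :: real assume "0 < e"
        have "isCont (classical_grad q) x"
          using classical_grad_continuous[OF q(3), of UNIV] by (simp add: continuous_on_eq_continuous_at)
        then obtain s where s: "0 < s" "\<And>y. dist y x < s \<Longrightarrow> dist (classical_grad q y) ?l < e / 2"
          using \<open>0 < e\<close> unfolding continuous_at_eps_delta by (meson half_gt_zero)
        \<comment> \<open>On the ball of radius \<open>r\<close> the distance \<open>d\<close> is at least \<open>d x / 2\<close>, so no clamping occurs there once \<open>\<epsilon> n\<close> is small.\<close>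
        define r where "r = min (min s R) (d x / 2)"
        have r: "0 < r" "r \<le> s" "r \<le> R" "r \<le> d x / 2" using s q dpos[OF \<open>x \<in> \<Omega>\<close>] by (auto simp: r_def)
        have q_diff: "\<bar>q (y + h) - q y - ?l \<bullet> h\<bar> \<le> e / 2 * norm h" if "y \<in> ball x r" "y + h \<in> ball x r" for y h
        proof -
          have "norm ((q (y + h) - ?l \<bullet> (y + h)) - (q y - ?l \<bullet> y)) \<le> e / 2 * norm ((y + h) - y)"
          proof (rule differentiable_bound[where S = "ball x r" and f' = "\<lambda>z h. (classical_grad q z - ?l) \<bullet> h"])
            fix z assume z: "z \<in> ball x r"
            have "(q has_derivative (\<lambda>h. classical_grad q z \<bullet> h)) (at z)"
              using q(3) by (intro has_derivative_classical_grad) simp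
            then have "((\<lambda>z. q z - ?l \<bullet> z) has_derivative (\<lambda>h. (classical_grad q z - ?l) \<bullet> h)) (at z)"
              by (auto intro!: derivative_eq_intros simp: inner_diff_left)
            then show "((\<lambda>z. q z - ?l \<bullet> z) has_derivative (\<lambda>h. (classical_grad q z - ?l) \<bullet> h)) (at z within ball x r)"
              by (rule has_derivative_at_withinI)
            show "onorm (\<lambda>h. (classical_grad q z - ?l) \<bullet> h) \<le> e / 2"
            proof (rule onorm_le)
              fix h
              have "norm (classical_grad q z - ?l) \<le> e / 2" using s(2)[of z] z r by (simp add: dist_norm norm_minus_commute)
              from order_trans[OF Cauchy_Schwarz_ineq2 mult_right_mono[OF this norm_ge_zero]]
              show "norm ((classical_grad q z - ?l) \<bullet> h) \<le> e / 2 * norm h"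
                by (simp only: real_norm_def)
            qed
          qed (use that in auto)
          then show ?thesis by (simp add: inner_add_right algebra_simps)
        qed
        have "\<forall>\<^sub>F n in sequentially. \<epsilon> n < r / 2"
          using order_tendstoD(2)[OF \<epsilon>(2), of "r / 2"] r by simp
        then obtain N where N: "\<And>n. n \<ge> N \<Longrightarrow> \<epsilon> n < r / 2" by (auto simp: eventually_sequentially)
        have "norm (classical_grad (\<psi> n) x - ?l) < e" if "n \<ge> N" for n
        proof -
          have wq: "w (\<epsilon> n) y = q y" if y: "y \<in> ball x r" for y
          proof -
            have "d y \<ge> d x - r" using dLip[of x y] y by (simp add: dist_norm)
            then have "2 * \<epsilon> n \<le> d y" using N[OF \<open>n \<ge> N\<close>] r by linarith
            then show ?thesis using w_eq q(4)[of y] y r by auto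
          qed
          have "norm (classical_grad (conv (w (\<epsilon> n)) (\<rho> n)) x - ?l) \<le> e / 2"
          proof (rule conv_gradient_bound[OF w_cont w_out \<rho>, where R = r])
            show "\<bar>w (\<epsilon> n) (y + h) - w (\<epsilon> n) y - ?l \<bullet> h\<bar> \<le> e / 2 * norm h"
              if "y \<in> ball x r" "y + h \<in> ball x r" for y h
              using q_diff[OF that] wq[OF that(1)] wq[OF that(2)] by simp
          qed (use N[OF that] \<epsilon>(1)[of n] \<open>0 < e\<close> in auto)
          then show ?thesis using \<open>0 < e\<close> by (simp add: \<psi>_def)
        qed
        then show "\<exists>N. \<forall>n\<ge>N. norm (classical_grad (\<psi> n) x - ?l) < e" by blast
      qed
      then show ?case by (rule convergentI)
    qed
  qed
qed

lemma polys_Lipschitz_on_compact: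
  assumes "q \<in> polys r" "compact K" "convex K"
  shows "\<exists>L. L-lipschitz_on K q"
proof -
  have C: "C_k (Suc 0) q" using assms(1) by (rule polys_C_k)
  have "bounded (classical_grad q ` K)"
    using assms(2) classical_grad_continuous[OF C] by (intro compact_imp_bounded compact_continuous_image)
  then obtain L where L: "\<And>x. x \<in> K \<Longrightarrow> norm (classical_grad q x) \<le> L"
    using bounded_iff[of "classical_grad q ` K"] by (metis imageI)
  have "norm (q x - q y) \<le> max L 0 * norm (x - y)" if "x \<in> K" "y \<in> K" for x y
  proof (rule differentiable_bound[OF assms(3), where f' = "\<lambda>z h. classical_grad q z \<bullet> h"])
    fix z assume z: "z \<in> K"
    show "(q has_derivative (\<lambda>h. classical_grad q z \<bullet> h)) (at z within K)"
      by (rule has_derivative_at_withinI[OF has_derivative_classical_grad]) (use C in simp)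
    show "onorm (\<lambda>h. classical_grad q z \<bullet> h) \<le> max L 0"
    proof (rule onorm_le)
      fix h
      have "\<bar>classical_grad q z \<bullet> h\<bar> \<le> norm (classical_grad q z) * norm h" by (rule Cauchy_Schwarz_ineq2)
      also have "\<dots> \<le> max L 0 * norm h" using L[OF z] by (intro mult_right_mono) auto
      finally show "norm (classical_grad q z \<bullet> h) \<le> max L 0 * norm h" by simp
    qed
  qed (use that in auto)
  then have "(max L 0)-lipschitz_on K q" by (intro lipschitz_onI) (auto simp: dist_norm)
  then show ?thesis by blast
qed

text \<open>The pieces cut every segment into finitely many closed sets, which reduces the claim to
functions of one real variable.\<close>

lemma lipschitz_on_finite_closed_cover:
  fixes f :: "pt \<Rightarrow> real"
  assumes "finite \<F>" "\<And>S. S \<in> \<F> \<Longrightarrow> closed S" "\<Union>\<F> = UNIV" "\<And>S. S \<in> \<F> \<Longrightarrow> L-lipschitz_on S f" "0 \<le> L"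
  shows "L-lipschitz_on UNIV f"
proof (rule lipschitz_onI)
  fix x y :: pt
  define \<gamma> where "\<gamma> s = x + s *\<^sub>R (y - x)" for s :: real
  have \<gamma>: "continuous_on UNIV \<gamma>" unfolding \<gamma>_def by (intro continuous_intros)
  have "(L * norm (y - x))-lipschitz_on {0..1} (f \<circ> \<gamma>)"
  proof (rule lipschitz_on_closed_Union[where I = \<F> and U = "\<lambda>S. \<gamma> -` S"])
    fix S assume S: "S \<in> \<F>"
    show "closed (\<gamma> -` S)" using assms(2)[OF S] \<gamma> by (simp add: continuous_closed_vimage continuous_on_eq_continuous_at)
    show "(L * norm (y - x))-lipschitz_on (\<gamma> -` S) (f \<circ> \<gamma>)"
    proof (rule lipschitz_onI)
      fix s t assume "s \<in> \<gamma> -` S" "t \<in> \<gamma> -` S"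
      then have "dist (f (\<gamma> s)) (f (\<gamma> t)) \<le> L * dist (\<gamma> s) (\<gamma> t)"
        using lipschitz_onD[OF assms(4)[OF S]] by simp
      also have "dist (\<gamma> s) (\<gamma> t) = norm (y - x) * dist s t"
        by (simp add: \<gamma>_def dist_norm flip: scaleR_diff_left)
      finally show "dist ((f \<circ> \<gamma>) s) ((f \<circ> \<gamma>) t) \<le> L * norm (y - x) * dist s t" by simp
    qed (use assms(5) in simp)
  next
    show "{0..1} \<subseteq> (\<Union>S\<in>\<F>. \<gamma> -` S)"
    proof
      fix s
      have "\<gamma> s \<in> \<Union>\<F>" using assms(3) by simp
      then show "s \<in> (\<Union>S\<in>\<F>. \<gamma> -` S)" by blast
    qed
  qed (use assms in auto)
  from lipschitz_onD[OF this, of 0 1] show "dist (f x) (f y) \<le> L * dist x y"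
    by (simp add: \<gamma>_def dist_norm norm_minus_commute)
qed fact

lemma mesh_properties:
  assumes "tetrahedral_mesh \<Omega> \<T>"
  shows "finite \<T>" "\<And>K. K \<in> \<T> \<Longrightarrow> compact K" "\<And>K. K \<in> \<T> \<Longrightarrow> convex K"
    "\<Union>\<T> = closure \<Omega>" "\<And>K K'. K \<in> \<T> \<Longrightarrow> K' \<in> \<T> \<Longrightarrow> (K \<inter> K') face_of K"
  using assms compact_simplex convex_simplex unfolding tetrahedral_mesh_def triangulation_def by blast+

text \<open>A point in the interior of no element lies on the frontier of one, and the frontier of a convex
set is a null set.\<close>

lemma AE_interior_element:
  assumes "tetrahedral_mesh \<Omega> \<T>" "\<Omega> \<in> lmeasurable"
  shows "AE x in lebesgue_on \<Omega>. \<exists>K\<in>\<T>. x \<in> interior K"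
proof -
  note mesh = mesh_properties[OF assms(1)]
  have "negligible (\<Union>K\<in>\<T>. frontier K)"
    using mesh(1,3) by (intro negligible_Union) (auto intro!: negligible_convex_frontier)
  then have "AE x in lebesgue. x \<notin> (\<Union>K\<in>\<T>. frontier K)"
    by (intro AE_not_in) (simp add: negligible_iff_null_sets)
  then have "AE x in lebesgue_on \<Omega>. x \<notin> (\<Union>K\<in>\<T>. frontier K)"
    using assms(2) by (subst AE_restrict_space_iff) auto
  then show ?thesis
    using AE_space
  proof eventually_elim
    case (elim x)
    then have "x \<in> \<Omega>" by (simp add: space_restrict_space)
    then have "x \<in> \<Union>\<T>" using mesh(4) closure_subset[of \<Omega>] by blast
    then obtain K where K: "K \<in> \<T>" "x \<in> K" by blast
    then have "x \<in> interior K" using elim(1) closure_subset[of K] by (auto simp: frontier_def)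
    then show ?case using K by blast
  qed
qed

lemma H10_cong:
  assumes "\<And>x. x \<in> \<Omega> \<Longrightarrow> u x = v x"
  shows "u \<in> H10 \<Omega> \<longleftrightarrow> v \<in> H10 \<Omega>"
proof -
  have sp: "x \<in> space (lebesgue_on \<Omega>) \<Longrightarrow> u x = v x" for x using assms by (simp add: space_restrict_space)
  have grad: "has_weak_grad \<Omega> u = has_weak_grad \<Omega> v"
  proof
    fix g
    have "(LINT x|lebesgue_on \<Omega>. u x * f x) = (LINT x|lebesgue_on \<Omega>. v x * f x)" for f
      by (intro Bochner_Integration.integral_cong refl) (simp add: sp)
    then show "has_weak_grad \<Omega> u g = has_weak_grad \<Omega> v g" unfolding has_weak_grad_def by simp
  qed
  have "u \<in> borel_measurable (lebesgue_on \<Omega>) \<longleftrightarrow> v \<in> borel_measurable (lebesgue_on \<Omega>)"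
    by (rule measurable_cong) (rule sp)
  moreover have "integrable (lebesgue_on \<Omega>) (\<lambda>x. (norm (u x))\<^sup>2) \<longleftrightarrow> integrable (lebesgue_on \<Omega>) (\<lambda>x. (norm (v x))\<^sup>2)"
    by (intro Bochner_Integration.integrable_cong refl) (simp add: sp)
  ultimately have "u \<in> L2 \<Omega> \<longleftrightarrow> v \<in> L2 \<Omega>" by (simp add: L2_def)
  moreover have "L2_norm \<Omega> (\<lambda>x. u x - f x) = L2_norm \<Omega> (\<lambda>x. v x - f x)" for f
    unfolding L2_norm_def L2_inner_def
    by (intro arg_cong[where f = sqrt] Bochner_Integration.integral_cong refl) (simp add: sp)
  ultimately show ?thesis unfolding H10_def H1_def wgrad_def by (simp add: grad)
qed

text \<open>The extension by zero is Lipschitz: it is a polynomial on each of the finitely many closed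
elements and zero on the closed complement of \<open>\<Omega>\<close>, and the boundary condition makes
these prescriptions agree where the pieces meet.\<close>

lemma U_h0_subset_H10:
  assumes \<Omega>: "open \<Omega>" "bounded \<Omega>" and mesh: "tetrahedral_mesh \<Omega> \<T>"
  shows "U_h0 \<Omega> \<T> k \<subseteq> H10 \<Omega>"
proof
  fix u assume u: "u \<in> U_h0 \<Omega> \<T> k"
  have meas: "\<Omega> \<in> lmeasurable" using \<Omega> by (rule lmeasurable_open[rotated])
  interpret open_domain \<Omega> by standard (use \<Omega> meas in auto)
  note m = mesh_properties[OF mesh]
  define v where "v x = (if x \<in> \<Omega> then u x else 0)" for x
  have pw: "\<exists>q\<in>polys k. \<forall>x\<in>K. u x = q x" if "K \<in> \<T>" for K using u that by (auto simp: U_h0_def U_h_def)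
  have vu: "v x = u x" if "x \<in> closure \<Omega>" for x
  proof (cases "x \<in> \<Omega>")
    case False
    then have "x \<in> frontier \<Omega>" using that \<Omega>(1) by (simp add: frontier_def interior_open)
    then show ?thesis using u False by (simp add: U_h0_def v_def)
  qed (simp add: v_def)
  have "\<exists>L. L-lipschitz_on K v" if "K \<in> \<T>" for K
  proof -
    obtain q where q: "q \<in> polys k" "\<forall>x\<in>K. u x = q x" using pw[OF \<open>K \<in> \<T>\<close>] by blast
    have "K \<subseteq> closure \<Omega>" using m(4) that by blast
    then have "v x = q x" if "x \<in> K" for x using vu[of x] q(2) that by auto
    then show ?thesis
      using polys_Lipschitz_on_compact[OF q(1) m(2,3)[OF that]] lipschitz_on_transform by metis
  qed
  then obtain L where L: "\<And>K. K \<in> \<T> \<Longrightarrow> (L K)-lipschitz_on K v" by metis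
  define L' where "L' = Max (insert 0 (L ` \<T>))"
  have "v \<in> H10 \<Omega>"
  proof (rule H10_of_Lipschitz[OF \<Omega>, of L'])
    show "L'-lipschitz_on UNIV v"
    proof (rule lipschitz_on_finite_closed_cover[where \<F> = "insert (- \<Omega>) \<T>"])
      show "finite (insert (- \<Omega>) \<T>)" using m(1) by simp
      show "\<Union>(insert (- \<Omega>) \<T>) = UNIV" using m(4) closure_subset by auto
      show "0 \<le> L'" using m(1) by (simp add: L'_def)
      fix S assume S: "S \<in> insert (- \<Omega>) \<T>"
      then show "closed S" using m(2) \<Omega>(1) compact_imp_closed by auto
      show "L'-lipschitz_on S v"
      proof (cases "S \<in> \<T>")
        case True
        then have "L S \<le> L'" using m(1) by (simp add: L'_def)
        then show ?thesis using L[OF True] lipschitz_on_le by blast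
      next
        case False
        then show ?thesis using S \<open>0 \<le> L'\<close> by (auto simp: lipschitz_on_def v_def)
      qed
    qed
    show "v x = 0" if "x \<notin> \<Omega>" for x using that by (simp add: v_def)
    show "AE x in lebesgue_on \<Omega>. \<exists>q R. 0 < R \<and> ball x R \<subseteq> \<Omega> \<and> C_k (Suc 0) q \<and> (\<forall>y\<in>ball x R. v y = q y)"
      using AE_interior_element[OF mesh meas] AE_space
    proof eventually_elim
      case (elim x)
      then obtain K where K: "K \<in> \<T>" "x \<in> interior K" by blast
      obtain q where q: "q \<in> polys k" "\<forall>x\<in>K. u x = q x" using pw[OF K(1)] by blast
      have "open (\<Omega> \<inter> interior K)" using \<Omega>(1) by blast
      then obtain R where R: "0 < R" "ball x R \<subseteq> \<Omega> \<inter> interior K"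
        using elim K by (auto simp: space_restrict_space elim!: openE[of "\<Omega> \<inter> interior K" x])
      then have "\<forall>y\<in>ball x R. v y = q y" using q interior_subset[of K] by (auto simp: v_def)
      then show ?case using R polys_C_k[OF q(1)] by blast
    qed
  qed
  then show "u \<in> H10 \<Omega>" using H10_cong[of \<Omega> v u] by (simp add: v_def)
qed

section \<open>The finite element spaces as spaces of functions\<close>

lemma lin_closed_polys: "lin_closed (polys r)"
proof (rule lin_closedI)
  let ?m = "\<lambda>c x. \<Sum>\<alpha> \<in> {\<alpha>::3 \<Rightarrow> nat. (\<Sum>i\<in>UNIV. \<alpha> i) \<le> r}. c \<alpha> * (\<Prod>i\<in>UNIV. (x $ i) ^ \<alpha> i)"
  show "(\<lambda>x. 0) \<in> polys r" unfolding polys_def by (auto intro!: exI[of _ "\<lambda>_. 0"])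
  show "(\<lambda>x. f x + g x) \<in> polys r" if fg: "f \<in> polys r" "g \<in> polys r" for f g
  proof -
    obtain a where "\<forall>x. f x = ?m a x" using fg(1) unfolding polys_def by blast
    moreover obtain b where "\<forall>x. g x = ?m b x" using fg(2) unfolding polys_def by blast
    ultimately have "\<forall>x. f x + g x = ?m (\<lambda>\<alpha>. a \<alpha> + b \<alpha>) x" by (simp add: distrib_right sum.distrib)
    then show ?thesis unfolding polys_def mem_Collect_eq by (rule exI[of _ "\<lambda>\<alpha>. a \<alpha> + b \<alpha>"])
  qed
  show "(\<lambda>x. c *\<^sub>R f x) \<in> polys r" if f: "f \<in> polys r" for c f
  proof -
    obtain a where "\<forall>x. f x = ?m a x" using f unfolding polys_def by blast
    then have "\<forall>x. c *\<^sub>R f x = ?m (\<lambda>\<alpha>. c * a \<alpha>) x" by (simp add: sum_distrib_left mult.assoc)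
    then show ?thesis unfolding polys_def mem_Collect_eq by (rule exI[of _ "\<lambda>\<alpha>. c * a \<alpha>"])
  qed
qed

lemma lin_closed_piecewise_polys:
  "lin_closed {f. \<forall>K\<in>\<T>. \<exists>q\<in>polys r. \<forall>x\<in>D K. f x = q x}"
proof (rule lin_closedI, goal_cases)
  case 1
  show ?case using lin_closed_0[OF lin_closed_polys] by fastforce
next
  case (2 f g)
  show ?case
  proof (intro CollectI ballI)
    fix K assume "K \<in> \<T>"
    then obtain p q where "p \<in> polys r" "\<forall>x\<in>D K. f x = p x" "q \<in> polys r" "\<forall>x\<in>D K. g x = q x"
      using 2 by fastforce
    then show "\<exists>q\<in>polys r. \<forall>x\<in>D K. f x + g x = q x"
      using lin_closed_add[OF lin_closed_polys, of p r q] by (intro bexI[of _ "\<lambda>x. p x + q x"]) auto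
  qed
next
  case (3 c f)
  show ?case
  proof (intro CollectI ballI)
    fix K assume "K \<in> \<T>"
    then obtain p where "p \<in> polys r" "\<forall>x\<in>D K. f x = p x" using 3 by fastforce
    then show "\<exists>q\<in>polys r. \<forall>x\<in>D K. c *\<^sub>R f x = q x"
      using lin_closed_scale[OF lin_closed_polys, of p r c] by (intro bexI[of _ "\<lambda>x. c *\<^sub>R p x"]) auto
  qed
qed

lemma lin_closed_X_h3: "lin_closed (X_h3 \<T> d)"
  unfolding X_h3_def X_h_def by (intro lin_closed_componentwise lin_closed_piecewise_polys)

definition monomial :: "(3 \<Rightarrow> nat) \<Rightarrow> pt \<Rightarrow> real" where
  "monomial \<alpha> x = (\<Prod>i\<in>UNIV. (x $ i) ^ \<alpha> i)"

definition exponents :: "nat \<Rightarrow> (3 \<Rightarrow> nat) set" where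
  "exponents r = {\<alpha>. (\<Sum>i\<in>UNIV. \<alpha> i) \<le> r}"

lemma polys_iff: "q \<in> polys r \<longleftrightarrow> (\<exists>c. \<forall>x. q x = (\<Sum>\<alpha>\<in>exponents r. c \<alpha> * monomial \<alpha> x))"
  by (simp add: polys_def monomial_def exponents_def)

lemma finite_exponents: "finite (exponents r)"
proof (rule finite_subset)
  show "exponents r \<subseteq> (UNIV :: 3 set) \<rightarrow>\<^sub>E {..r}"
  proof
    fix \<alpha> assume "\<alpha> \<in> exponents r"
    then have "\<alpha> i \<le> r" for i
      using member_le_sum[of i UNIV \<alpha>] by (auto simp: exponents_def intro: order_trans)
    then show "\<alpha> \<in> (UNIV :: 3 set) \<rightarrow>\<^sub>E {..r}" by auto
  qed
qed (simp add: finite_PiE)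

lemma monomial_in_polys:
  assumes "\<alpha> \<in> exponents r"
  shows "monomial \<alpha> \<in> polys r"
  unfolding polys_iff
proof (intro exI allI)
  fix x
  show "monomial \<alpha> x = (\<Sum>\<beta>\<in>exponents r. of_bool (\<beta> = \<alpha>) * monomial \<beta> x)"
    using assms finite_exponents[of r] by (simp add: sum.delta of_bool_def if_distrib[of "\<lambda>t. t * _"] cong: if_cong)
qed

lemma interiors_disjoint:
  assumes "tetrahedral_mesh \<Omega> \<T>" "K \<in> \<T>" "K' \<in> \<T>" "x \<in> interior K" "x \<in> interior K'"
  shows "K = K'"
proof -
  have "A \<subseteq> B" if "A \<in> \<T>" "B \<in> \<T>" "x \<in> interior A" "x \<in> interior B" for A B
  proof -
    have "A \<subseteq> A \<inter> B"
    proof (rule subset_of_face_of[of "A \<inter> B" A A])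
      show "A \<inter> B face_of A" using mesh_properties(5)[OF assms(1)] that by blast
      show "A \<inter> B \<inter> rel_interior A \<noteq> {}"
        using that interior_subset[of A] interior_subset[of B] interior_subset_rel_interior[of A] by blast
    qed simp
    then show ?thesis by blast
  qed
  then show ?thesis using assms by blast
qed

text \<open>The basis functions are cut off to the interior of one element, where the values of a
discontinuous finite element function are prescribed.\<close>

definition element_basis :: "pt set \<times> (3 \<Rightarrow> nat) \<times> 3 \<Rightarrow> pt \<Rightarrow> real ^ 3" where
  "element_basis = (\<lambda>(K, \<alpha>, i) x. (indicator (interior K) x * monomial \<alpha> x) *\<^sub>R axis i 1)"

abbreviation basis_indices :: "pt set set \<Rightarrow> nat \<Rightarrow> (pt set \<times> (3 \<Rightarrow> nat) \<times> 3) set" where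
  "basis_indices \<T> d \<equiv> \<T> \<times> exponents d \<times> UNIV"

lemma element_basis_in_X_h3:
  assumes "tetrahedral_mesh \<Omega> \<T>" "t \<in> basis_indices \<T> d"
  shows "element_basis t \<in> X_h3 \<T> d"
proof -
  obtain K \<alpha> i where t: "t = (K, \<alpha>, i)" "K \<in> \<T>" "\<alpha> \<in> exponents d" using assms(2) by auto
  have "\<exists>q\<in>polys d. \<forall>x\<in>interior K'. element_basis t x $ j = q x" if K': "K' \<in> \<T>" for K' j
  proof (cases "K' = K \<and> j = i")
    case True
    then show ?thesis using monomial_in_polys[OF t(3)] by (auto simp: element_basis_def t axis_def)
  next
    case False
    have "element_basis t x $ j = 0" if x: "x \<in> interior K'" for x
    proof (cases "j = i")
      case True
      then have "x \<notin> interior K" using False interiors_disjoint[OF assms(1) t(2) K' _ x] by blast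
      then show ?thesis by (simp add: element_basis_def t)
    qed (simp add: element_basis_def t axis_def)
    then show ?thesis using lin_closed_0[OF lin_closed_polys] by (intro bexI[of _ "\<lambda>x. 0"]) auto
  qed
  then show ?thesis by (simp add: X_h3_def X_h_def)
qed

lemma X_h3_expansion:
  assumes mesh: "tetrahedral_mesh \<Omega> \<T>" and f: "f \<in> X_h3 \<T> d"
  shows "\<exists>c. \<forall>K\<in>\<T>. \<forall>x\<in>interior K. f x = (\<Sum>t\<in>basis_indices \<T> d. c t *\<^sub>R element_basis t x)"
proof -
  have "\<exists>a. \<forall>x\<in>interior K. f x $ i = (\<Sum>\<alpha>\<in>exponents d. a \<alpha> * monomial \<alpha> x)" if K: "K \<in> \<T>" for K i
  proof -
    obtain q where "q \<in> polys d" "\<forall>x\<in>interior K. f x $ i = q x"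
      using f K unfolding X_h3_def X_h_def by blast
    then show ?thesis unfolding polys_iff by metis
  qed
  then obtain a where a: "\<And>K i x. K \<in> \<T> \<Longrightarrow> x \<in> interior K \<Longrightarrow>
      f x $ i = (\<Sum>\<alpha>\<in>exponents d. a K i \<alpha> * monomial \<alpha> x)"
    by metis
  have fin: "finite \<T>" using mesh_properties(1)[OF mesh] .
  define c where "c = (\<lambda>(K, \<alpha>, i). a K i \<alpha>)"
  have "f x = (\<Sum>t\<in>basis_indices \<T> d. c t *\<^sub>R element_basis t x)" if K: "K \<in> \<T>" "x \<in> interior K" for K x
  proof -
    have ind: "indicator (interior K') x = (of_bool (K' = K) :: real)" if "K' \<in> \<T>" for K'
    proof (cases "K' = K")
      case False
      then have "x \<notin> interior K'" using interiors_disjoint[OF mesh that K(1) _ K(2)] by blast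
      then show ?thesis using False by simp
    qed (use K(2) in simp)
    have "(\<Sum>t\<in>basis_indices \<T> d. c t *\<^sub>R element_basis t x)
        = (\<Sum>K'\<in>\<T>. \<Sum>\<alpha>\<in>exponents d. \<Sum>i\<in>UNIV. (a K' i \<alpha> * (indicator (interior K') x * monomial \<alpha> x)) *\<^sub>R axis i 1)"
      unfolding sum.cartesian_product by (intro sum.cong) (auto simp: c_def element_basis_def)
    also have "\<dots> = (\<Sum>K'\<in>\<T>. of_bool (K' = K) *\<^sub>R (\<Sum>\<alpha>\<in>exponents d. \<Sum>i\<in>UNIV. (a K' i \<alpha> * monomial \<alpha> x) *\<^sub>R axis i 1))"
      by (intro sum.cong refl) (simp add: ind scaleR_sum_right mult_ac)
    also have "\<dots> = (\<Sum>\<alpha>\<in>exponents d. \<Sum>i\<in>UNIV. (a K i \<alpha> * monomial \<alpha> x) *\<^sub>R axis i 1)"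
      using fin K(1) by (simp add: of_bool_def if_distrib[of "\<lambda>t. t *\<^sub>R _"] sum.delta cong: if_cong)
    also have "\<dots> = (\<Sum>i\<in>UNIV. (f x $ i) *\<^sub>R axis i 1)"
      by (subst sum.swap) (simp add: a[OF K] scaleR_sum_left)
    also have "\<dots> = f x" using basis_expansion[of "f x"] by (simp add: scalar_mult_eq_scaleR)
    finally show ?thesis by simp
  qed
  then show ?thesis by blast
qed

context open_domain
begin

lemma measurable_cong_AE:
  fixes f g :: "pt \<Rightarrow> 'b::euclidean_space"
  assumes "f \<in> borel_measurable (lebesgue_on \<Omega>)" "AE x in lebesgue_on \<Omega>. f x = g x"
  shows "g \<in> borel_measurable (lebesgue_on \<Omega>)"
proof -
  have S: "\<Omega> \<inter> space lebesgue \<in> sets lebesgue" using meas_dom by auto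
  have "AE x in lebesgue. x \<in> \<Omega> \<longrightarrow> f x = g x"
    using assms(2) S by (subst (asm) AE_restrict_space_iff) auto
  then have "AE x in lebesgue. indicator \<Omega> x *\<^sub>R f x = indicator \<Omega> x *\<^sub>R g x"
    by eventually_elim (auto simp: indicator_def)
  then show ?thesis
    unfolding borel_measurable_restrict_space_iff[OF S]
    by (rule borel_measurable_AE[OF assms(1)[unfolded borel_measurable_restrict_space_iff[OF S]]])
qed

lemma element_basis_L2:
  assumes "bounded \<Omega>"
  shows "element_basis t \<in> L2 \<Omega>"
proof -
  obtain K \<alpha> i where t: "t = (K, \<alpha>, i)" by (cases t)
  have C: "continuous_on UNIV (monomial \<alpha>)"
    unfolding monomial_def by (intro continuous_intros)
  have "bounded (monomial \<alpha> ` closure \<Omega>)"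
    using assms C by (intro compact_imp_bounded compact_continuous_image) (auto intro: continuous_on_subset)
  then obtain B where B: "\<And>x. x \<in> closure \<Omega> \<Longrightarrow> \<bar>monomial \<alpha> x\<bar> \<le> B"
    using bounded_iff[of "monomial \<alpha> ` closure \<Omega>"] by (metis imageI real_norm_def)
  show ?thesis
  proof (rule L2_bounded[OF meas_dom, where M = B])
    show "element_basis t \<in> borel_measurable (lebesgue_on \<Omega>)"
      unfolding element_basis_def t split
      by (intro borel_measurable_scaleR borel_measurable_times indicator_measurable_lebesgue_on
          continuous_imp_measurable_lebesgue_on C borel_measurable_const) simp
    show "AE x in lebesgue_on \<Omega>. norm (element_basis t x) \<le> B"
    proof (rule AE_I2)
      fix x assume "x \<in> space (lebesgue_on \<Omega>)"
      then have "\<bar>monomial \<alpha> x\<bar> \<le> B" using B closure_subset[of \<Omega>] by (auto simp: space_restrict_space)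
      then show "norm (element_basis t x) \<le> B"
        by (auto simp: element_basis_def t abs_mult indicator_def)
    qed
  qed
qed

lemma X_h3_expansion_AE:
  assumes "bounded \<Omega>" "tetrahedral_mesh \<Omega> \<T>" "f \<in> X_h3 \<T> d"
  shows "f \<in> L2 \<Omega>"
    "\<exists>c. AE x in lebesgue_on \<Omega>. (\<Sum>t\<in>basis_indices \<T> d. c t *\<^sub>R element_basis t x) = f x"
proof -
  obtain c where c: "\<And>K x. K \<in> \<T> \<Longrightarrow> x \<in> interior K \<Longrightarrow>
      f x = (\<Sum>t\<in>basis_indices \<T> d. c t *\<^sub>R element_basis t x)"
    using X_h3_expansion[OF assms(2,3)] by blast
  have ae: "AE x in lebesgue_on \<Omega>. (\<Sum>t\<in>basis_indices \<T> d. c t *\<^sub>R element_basis t x) = f x"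
    using AE_interior_element[OF assms(2) meas_dom]
  proof eventually_elim
    case (elim x)
    then obtain K where "K \<in> \<T>" "x \<in> interior K" by blast
    then show ?case by (rule c[symmetric])
  qed
  have L: "(\<lambda>x. \<Sum>t\<in>basis_indices \<T> d. c t *\<^sub>R element_basis t x) \<in> L2 \<Omega>"
    by (rule L2.closed_sum) (rule element_basis_L2[OF assms(1)])
  show "f \<in> L2 \<Omega>" using L2_cong_AE[OF L measurable_cong_AE[OF L2_measurable[OF L] ae] ae] .
  show "\<exists>c. AE x in lebesgue_on \<Omega>. (\<Sum>t\<in>basis_indices \<T> d. c t *\<^sub>R element_basis t x) = f x"
    using ae by blast
qed

text \<open>The projection is defined by choice. The least squares solution in the span of the element
basis, which represents every finite element function almost everywhere, shows that there is
something to choose.\<close>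

lemma L2_proj_X_h3:
  assumes "bounded \<Omega>" "tetrahedral_mesh \<Omega> \<T>" "w \<in> L2 \<Omega>"
  shows "L2_proj \<Omega> (X_h3 \<T> d) w \<in> X_h3 \<T> d"
    "\<And>q. q \<in> X_h3 \<T> d \<Longrightarrow> L2_inner \<Omega> (\<lambda>x. w x - L2_proj \<Omega> (X_h3 \<T> d) w x) q = 0"
proof -
  let ?J = "basis_indices \<T> d"
  have fin: "finite ?J" using mesh_properties(1)[OF assms(2)] finite_exponents by (intro finite_cartesian_product) auto
  note bL = element_basis_L2[OF assms(1)]
  obtain c where c: "\<And>j. j \<in> ?J \<Longrightarrow>
      L2_inner \<Omega> (\<lambda>x. w x - (\<Sum>t\<in>?J. c t *\<^sub>R element_basis t x)) (element_basis j) = 0"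
    using L2.projection_exists_finite[OF fin, where g = element_basis and w = w] bL assms(3) by blast
  define p where "p x = (\<Sum>t\<in>?J. c t *\<^sub>R element_basis t x)" for x
  have pX: "p \<in> X_h3 \<T> d"
    unfolding p_def by (rule lin_closed_sum[OF lin_closed_X_h3 element_basis_in_X_h3[OF assms(2)]])
  have pL: "p \<in> L2 \<Omega>" using X_h3_expansion_AE(1)[OF assms(1,2) pX] .
  have wp: "(\<lambda>x. w x - p x) \<in> L2 \<Omega>" using assms(3) pL by (rule L2.closed_diff)
  have "L2_inner \<Omega> (\<lambda>x. w x - p x) q = 0" if q: "q \<in> X_h3 \<T> d" for q
  proof -
    obtain a where a: "AE x in lebesgue_on \<Omega>. (\<Sum>t\<in>?J. a t *\<^sub>R element_basis t x) = q x"
      using X_h3_expansion_AE(2)[OF assms(1,2) q] by blast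
    have sL: "(\<lambda>x. \<Sum>t\<in>?J. a t *\<^sub>R element_basis t x) \<in> L2 \<Omega>" by (rule L2.closed_sum) (rule bL)
    have qL: "q \<in> L2 \<Omega>" using X_h3_expansion_AE(1)[OF assms(1,2) q] .
    have "L2_inner \<Omega> (\<lambda>x. w x - p x) q = L2_inner \<Omega> q (\<lambda>x. w x - p x)"
      using wp qL by (rule L2.sym)
    also have "\<dots> = L2_inner \<Omega> (\<lambda>x. \<Sum>t\<in>?J. a t *\<^sub>R element_basis t x) (\<lambda>x. w x - p x)"
      using L2_inner_cong_AE[OF sL qL wp a] by simp
    also have "\<dots> = (\<Sum>t\<in>?J. a t * L2_inner \<Omega> (element_basis t) (\<lambda>x. w x - p x))"
      using bL wp by (intro L2.sum_left)
    also have "\<dots> = 0"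
    proof (rule sum.neutral, rule ballI)
      fix t assume "t \<in> ?J"
      then have "L2_inner \<Omega> (\<lambda>x. w x - p x) (element_basis t) = 0" using c[of t] by (simp add: p_def)
      then show "a t * L2_inner \<Omega> (element_basis t) (\<lambda>x. w x - p x) = 0"
        using L2.sym[OF bL wp] by simp
    qed
    finally show ?thesis .
  qed
  with pX have "\<exists>p. p \<in> X_h3 \<T> d \<and> (\<forall>q\<in>X_h3 \<T> d. L2_inner \<Omega> (\<lambda>x. w x - p x) q = 0)" by blast
  from someI_ex[OF this] show "L2_proj \<Omega> (X_h3 \<T> d) w \<in> X_h3 \<T> d"
    "\<And>q. q \<in> X_h3 \<T> d \<Longrightarrow> L2_inner \<Omega> (\<lambda>x. w x - L2_proj \<Omega> (X_h3 \<T> d) w x) q = 0"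
    unfolding L2_proj_def by blast+
qed

lemma lin_closed_V_h: "lin_closed (V_h \<Omega> \<T> k)"
proof -
  have "lin_closed {u :: pt \<Rightarrow> real. \<forall>x\<in>frontier \<Omega>. u x = 0}" by (rule lin_closedI) auto
  then have "lin_closed (H1 \<Omega> \<inter> {u. \<forall>K\<in>\<T>. \<exists>q\<in>polys k. \<forall>x\<in>K. u x = q x} \<inter> {u. \<forall>x\<in>frontier \<Omega>. u x = 0})"
    by (intro lin_closed_Int lin_closed_H1 lin_closed_piecewise_polys)
  moreover have "U_h0 \<Omega> \<T> k = H1 \<Omega> \<inter> {u. \<forall>K\<in>\<T>. \<exists>q\<in>polys k. \<forall>x\<in>K. u x = q x} \<inter> {u. \<forall>x\<in>frontier \<Omega>. u x = 0}"
    by (auto simp: U_h0_def U_h_def)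
  ultimately have "lin_closed (U_h0 \<Omega> \<T> k)" by simp
  moreover have "U_h0 \<Omega> \<T> k \<subseteq> H1 \<Omega>" by (auto simp: U_h0_def U_h_def)
  ultimately show ?thesis unfolding V_h_def by (rule lin_closed_solenoidal)
qed

lemma V_h_subset_V_space:
  assumes "bounded \<Omega>" "tetrahedral_mesh \<Omega> \<T>"
  shows "V_h \<Omega> \<T> k \<subseteq> V_space \<Omega>"
  using U_h0_subset_H10[OF open_dom assms] by (auto simp: V_h_def V_space_def)

section \<open>The Galerkin error\<close>

text \<open>The projection \<open>f\<close> of \<open>e\<close> splits \<open>e\<close> orthogonally into \<open>e - f\<close>, which \<open>C0\<close> controls, and
\<open>f\<close>. For an admissible stress \<open>p\<close> and any \<open>v\<close> in \<open>V_h\<close>,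
\<open>(f, f) = (f, e) = (p, \<nabla>e) = (p - \<nabla>v, \<nabla>e)\<close>, where the last step is the orthogonality
of \<open>e\<close>. Minimising over \<open>p\<close> and \<open>v\<close> bounds the length of \<open>f\<close> by \<open>\<kappa>\<close> times that of
\<open>\<nabla>e\<close>.\<close>

lemma galerkin_error:
  assumes bdd: "bounded \<Omega>" and mesh: "tetrahedral_mesh \<Omega> \<T>"
    and proj: "\<And>w. w \<in> V_space \<Omega> \<Longrightarrow>
      L2_norm \<Omega> (\<lambda>x. w x - L2_proj \<Omega> (X_h3 \<T> d) w x) \<le> C0 * L2_norm \<Omega> (tgrad \<Omega> w)"
    and kappa: "kappa_h \<Omega> \<T> k d m = ereal \<kappa>"
    and e: "e \<in> V_space \<Omega>" and orth: "\<And>v. v \<in> V_h \<Omega> \<T> k \<Longrightarrow> energy e v = 0"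
  shows "L2_inner \<Omega> e e \<le> (C0\<^sup>2 + \<kappa>\<^sup>2) * energy e e"
proof -
  have eH: "e \<in> H1v" using e V_space_H1v by blast
  note eL = H1v_L2[OF eH] and geL = tgrad_L2[OF eH]
  define f where "f = L2_proj \<Omega> (X_h3 \<T> d) e"
  have fX: "f \<in> X_h3 \<T> d" unfolding f_def by (rule L2_proj_X_h3[OF bdd mesh eL])
  have fL: "f \<in> L2 \<Omega>" using X_h3_expansion_AE(1)[OF bdd mesh fX] .
  have rL: "(\<lambda>x. e x - f x) \<in> L2 \<Omega>" using eL fL by (rule L2.closed_diff)
  have rf: "L2_inner \<Omega> (\<lambda>x. e x - f x) f = 0"
    using L2_proj_X_h3(2)[OF bdd mesh eL fX] by (simp add: f_def)
  then have ef: "L2_inner \<Omega> e f = L2_inner \<Omega> f f" using L2.diff_left[OF eL fL fL] by simp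
  then have fe: "L2_inner \<Omega> f e = L2_inner \<Omega> f f" using L2.sym[OF eL fL] by simp
  have "L2_inner \<Omega> (\<lambda>x. e x - f x) (\<lambda>x. e x - f x) = L2_inner \<Omega> e e - L2_inner \<Omega> f f"
    using L2.diff_right[OF eL fL rL] rf L2.diff_left[OF eL fL eL] fe by simp
  then have split: "L2_inner \<Omega> e e = (L2_norm \<Omega> (\<lambda>x. e x - f x))\<^sup>2 + (L2_norm \<Omega> f)\<^sup>2"
    using L2_norm_square[OF rL] L2_norm_square[OF fL] by simp
  have part1: "(L2_norm \<Omega> (\<lambda>x. e x - f x))\<^sup>2 \<le> C0\<^sup>2 * energy e e"
  proof -
    have "(L2_norm \<Omega> (\<lambda>x. e x - f x))\<^sup>2 \<le> (C0 * L2_norm \<Omega> (tgrad \<Omega> e))\<^sup>2"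
      using proj[OF e] L2_norm_nonneg[OF rL] by (intro power_mono) (auto simp: f_def)
    then show ?thesis by (simp add: power_mult_distrib L2_norm_square[OF geL])
  qed
  have part2: "(L2_norm \<Omega> f)\<^sup>2 \<le> \<kappa>\<^sup>2 * energy e e"
  proof (cases "L2_norm \<Omega> f = 0")
    case True
    then show ?thesis using energy.nonneg[OF eH] by simp
  next
    case False
    define N where "N = L2_norm \<Omega> f"
    define G where "G = L2_norm \<Omega> (tgrad \<Omega> e)"
    have N: "N > 0" using False L2_norm_nonneg[OF fL] by (simp add: N_def)
    have G: "G \<ge> 0" using L2_norm_nonneg[OF geL] by (simp add: G_def)
    have inf: "(INF (p, v) \<in> admissible \<Omega> \<T> k m f \<times> V_h \<Omega> \<T> k.
          ereal (L2_norm \<Omega> (\<lambda>x. p x - tgrad \<Omega> v x) / L2_norm \<Omega> f)) \<le> ereal \<kappa>"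
      unfolding kappa[symmetric] kappa_h_def by (rule SUP_upper) (use fX False in simp)
    have N_le: "N \<le> \<kappa> * G + \<epsilon> * G" if \<epsilon>: "\<epsilon> > 0" for \<epsilon>
    proof -
      have "(INF (p, v) \<in> admissible \<Omega> \<T> k m f \<times> V_h \<Omega> \<T> k.
          ereal (L2_norm \<Omega> (\<lambda>x. p x - tgrad \<Omega> v x) / L2_norm \<Omega> f)) < ereal (\<kappa> + \<epsilon>)"
        by (rule order_le_less_trans[OF inf]) (use \<epsilon> in simp)
      then obtain p v where p: "p \<in> admissible \<Omega> \<T> k m f" and v: "v \<in> V_h \<Omega> \<T> k"
        and le: "L2_norm \<Omega> (\<lambda>x. p x - tgrad \<Omega> v x) / N < \<kappa> + \<epsilon>"
        unfolding INF_less_iff N_def by auto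
      obtain \<phi> where \<phi>: "\<phi> \<in> U_h \<Omega> \<T> k" "AE x in lebesgue_on \<Omega>. tdiv \<Omega> p x + wgrad \<Omega> \<phi> x + f x = 0"
        using p by (auto simp: admissible_def)
      have "(\<lambda>x. p x $ i) \<in> Hdiv \<Omega>" for i using p by (auto simp: admissible_def RT_h3_def RT_h_def)
      moreover have "\<phi> \<in> H1 \<Omega>" using \<phi>(1) by (simp add: U_h_def)
      ultimately have pL: "p \<in> L2 \<Omega>" and fp: "L2_inner \<Omega> f e = L2_inner \<Omega> p (tgrad \<Omega> e)"
        using equilibrated_stress_identity fL e \<phi>(2) by blast+
      have vH: "v \<in> H1v" using v V_h_subset_V_space[OF bdd mesh] V_space_H1v by blast
      note gvL = tgrad_L2[OF vH]
      have "N\<^sup>2 = L2_inner \<Omega> p (tgrad \<Omega> e)" using fp fe L2_norm_square[OF fL] by (simp add: N_def)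
      also have "\<dots> = L2_inner \<Omega> (\<lambda>x. p x - tgrad \<Omega> v x) (tgrad \<Omega> e)"
        using L2.diff_left[OF pL gvL geL] orth[OF v] energy.sym[OF eH vH] by simp
      also have "\<dots> \<le> L2_norm \<Omega> (\<lambda>x. p x - tgrad \<Omega> v x) * G"
        unfolding L2_norm_def G_def by (rule L2.Cauchy_Schwarz_sqrt[OF L2.closed_diff[OF pL gvL] geL])
      also have "\<dots> \<le> ((\<kappa> + \<epsilon>) * N) * G"
        using le N G by (intro mult_right_mono) (simp_all add: field_simps)
      finally have "N * N \<le> N * ((\<kappa> + \<epsilon>) * G)" by (simp add: power2_eq_square mult_ac)
      then show ?thesis using N by (simp add: distrib_right)
    qed
    have "N \<le> \<kappa> * G + \<epsilon>" if "\<epsilon> > 0" for \<epsilon>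
    proof (cases "G = 0")
      case False
      then show ?thesis using N_le[of "\<epsilon> / G"] that G by simp
    qed (use N_le[of 1] that in simp)
    then have "N \<le> \<kappa> * G" by (rule field_le_epsilon)
    then have "N\<^sup>2 \<le> (\<kappa> * G)\<^sup>2" using N by (intro power_mono) auto
    then show ?thesis by (simp add: N_def G_def power_mult_distrib L2_norm_square[OF geL])
  qed
  show ?thesis using split part1 part2 by (simp add: distrib_right)
qed

section \<open>Orthonormal eigenfunctions\<close>

text \<open>A finite supremum of a nonempty set of extended natural numbers belongs to the set.\<close>

lemma L2_dim_attained:
  assumes "L2_dim \<Omega> S = enat m"
  shows "\<exists>u. (\<forall>i<m. u i \<in> S) \<and> L2_independent \<Omega> m u"
proof -
  let ?A = "{n. \<exists>u. (\<forall>i<n. u i \<in> S) \<and> L2_independent \<Omega> n u}"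
  have "0 \<in> ?A" by (auto simp: L2_independent_def)
  then have ne: "enat ` ?A \<noteq> {}" by blast
  have Sup: "Sup (enat ` ?A) = enat m" using assms by (simp add: L2_dim_def)
  then have fin: "finite (enat ` ?A)" using ne by (auto simp: Sup_enat_def split: if_splits)
  then have "Sup (enat ` ?A) = Max (enat ` ?A)" using ne by (simp only: Sup_enat_def if_True if_False)
  then have "Max (enat ` ?A) = enat m" using Sup by (simp only:)
  then have "enat m \<in> enat ` ?A" using Max_in[OF fin ne] by simp
  then show ?thesis by auto
qed

lemma L2_dim_upper:
  assumes "\<And>i. i < m \<Longrightarrow> u i \<in> S" "L2_independent \<Omega> m u"
  shows "enat m \<le> L2_dim \<Omega> S"
  unfolding L2_dim_def using assms by (intro SUP_upper) blast

lemma lin_closed_eigenspace: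
  assumes "lin_closed W" "W \<subseteq> H1v"
  shows "lin_closed (eigenspace \<Omega> W \<mu>)"
proof (rule lin_closedI)
  have H: "v \<in> H1v" and L: "v \<in> L2 \<Omega>" if "v \<in> W" for v using that assms(2) H1v_L2 by auto
  show "(\<lambda>x. 0) \<in> eigenspace \<Omega> W \<mu>"
    using lin_closed_0[OF assms(1)] energy.zero_left[OF H] L2.zero_left[OF L] by (simp add: eigenspace_def)
  show "(\<lambda>x. f x + g x) \<in> eigenspace \<Omega> W \<mu>" if "f \<in> eigenspace \<Omega> W \<mu>" "g \<in> eigenspace \<Omega> W \<mu>" for f g
    using that lin_closed_add[OF assms(1), of f g] energy.add_left[OF H H H] L2.add_left[OF L L L]
    by (auto simp: eigenspace_def distrib_left)
  show "(\<lambda>x. c *\<^sub>R f x) \<in> eigenspace \<Omega> W \<mu>" if "f \<in> eigenspace \<Omega> W \<mu>" for c f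
    using that lin_closed_scale[OF assms(1), of f c] energy.scale_left[OF H H] L2.scale_left[OF L L]
    by (auto simp: eigenspace_def)
qed

text \<open>Gram--Schmidt works inside each eigenspace; eigenfunctions of different eigenvalues are
orthogonal by the symmetry of both forms. The multiplicities are exactly large enough to
serve all indices with the same eigenvalue.\<close>

lemma orthonormal_eigenfunctions:
  assumes "lin_closed W" "W \<subseteq> H1v" "lists_eigenvalues \<Omega> W I ev"
  obtains u where "\<And>i. i \<in> I \<Longrightarrow> u i \<in> W"
    "\<And>i v. i \<in> I \<Longrightarrow> v \<in> W \<Longrightarrow> energy (u i) v = ev i * L2_inner \<Omega> (u i) v"
    "\<And>i j. i \<in> I \<Longrightarrow> j \<in> I \<Longrightarrow> L2_inner \<Omega> (u i) (u j) = of_bool (i = j)"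
proof -
  let ?I = "\<lambda>\<mu>. {i \<in> I. ev i = \<mu>}"
  let ?E = "\<lambda>\<mu>. eigenspace \<Omega> W \<mu>"
  have fin: "finite (?I \<mu>)" and dim: "L2_dim \<Omega> (?E \<mu>) = enat (card (?I \<mu>))" for \<mu>
    using assms(3) by (auto simp: lists_eigenvalues_def)
  have EW: "?E \<mu> \<subseteq> W" for \<mu> by (auto simp: eigenspace_def)
  have EL: "?E \<mu> \<subseteq> L2 \<Omega>" for \<mu> using EW assms(2) H1v_L2 by blast
  have ex: "\<exists>w. (\<forall>i\<in>?I \<mu>. w i \<in> ?E \<mu>) \<and> (\<forall>i\<in>?I \<mu>. \<forall>j\<in>?I \<mu>. L2_inner \<Omega> (w i) (w j) = of_bool (i = j))" for \<mu>
  proof -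
    let ?m = "card (?I \<mu>)"
    obtain w where w: "\<forall>i<?m. w i \<in> ?E \<mu>" "L2_independent \<Omega> ?m w"
      using L2_dim_attained[OF dim] by blast
    have "\<forall>l<?m. c l = 0"
      if "L2_inner \<Omega> (\<lambda>x. \<Sum>l<?m. c l *\<^sub>R w l x) (\<lambda>x. \<Sum>l<?m. c l *\<^sub>R w l x) = 0" for c
    proof -
      have "(\<lambda>x. \<Sum>l<?m. c l *\<^sub>R w l x) \<in> L2 \<Omega>"
        using w(1) EL by (intro L2.closed_sum) auto
      then have "AE x in lebesgue_on \<Omega>. (\<Sum>l<?m. c l *\<^sub>R w l x) = 0"
        using that L2_inner_self_eq_0 by blast
      then show ?thesis using w(2) by (simp add: L2_independent_def)
    qed
    then obtain e where e: "\<forall>l<?m. e l \<in> ?E \<mu>" "\<forall>l<?m. \<forall>j<?m. L2_inner \<Omega> (e l) (e j) = of_bool (l = j)"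
      using L2.orthonormalise[OF lin_closed_eigenspace[OF assms(1,2)] EL, of ?m w \<mu>] w(1) by blast
    obtain h where h: "bij_betw h (?I \<mu>) {0..<?m}" using ex_bij_betw_finite_nat[OF fin] by blast
    have "h i < ?m" if "i \<in> ?I \<mu>" for i using bij_betwE[OF h] that by auto
    moreover have "h i = h j \<longleftrightarrow> i = j" if "i \<in> ?I \<mu>" "j \<in> ?I \<mu>" for i j
      using bij_betw_imp_inj_on[OF h] that by (auto simp: inj_on_def)
    ultimately show ?thesis using e by (intro exI[of _ "\<lambda>i. e (h i)"]) simp
  qed
  define w where "w \<mu> = (SOME w. (\<forall>i\<in>?I \<mu>. w i \<in> ?E \<mu>) \<and>
    (\<forall>i\<in>?I \<mu>. \<forall>j\<in>?I \<mu>. L2_inner \<Omega> (w i) (w j) = of_bool (i = j)))" for \<mu>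
  have w: "i \<in> ?I \<mu> \<Longrightarrow> w \<mu> i \<in> ?E \<mu>"
    "i \<in> ?I \<mu> \<Longrightarrow> j \<in> ?I \<mu> \<Longrightarrow> L2_inner \<Omega> (w \<mu> i) (w \<mu> j) = of_bool (i = j)" for \<mu> i j
    using someI_ex[OF ex[of \<mu>], folded w_def] by blast+
  define u where "u i = w (ev i) i" for i
  have uE: "u i \<in> ?E (ev i)" if "i \<in> I" for i unfolding u_def by (rule w(1)) (simp add: that)
  have uW: "u i \<in> W" if "i \<in> I" for i using uE[OF that] EW by blast
  have eig: "energy (u i) v = ev i * L2_inner \<Omega> (u i) v" if "i \<in> I" "v \<in> W" for i v
    using uE[OF that(1)] that(2) by (simp add: eigenspace_def)
  have "L2_inner \<Omega> (u i) (u j) = of_bool (i = j)" if ij: "i \<in> I" "j \<in> I" for i j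
  proof (cases "ev i = ev j")
    case True
    then show ?thesis using w(2)[of i "ev i" j] ij by (simp add: u_def)
  next
    case False
    have "u i \<in> H1v" "u j \<in> H1v" using uW ij assms(2) by auto
    then have "energy (u i) (u j) = energy (u j) (u i)" "L2_inner \<Omega> (u i) (u j) = L2_inner \<Omega> (u j) (u i)"
      using energy.sym L2.sym H1v_L2 by blast+
    then have "ev i * L2_inner \<Omega> (u i) (u j) = ev j * L2_inner \<Omega> (u i) (u j)"
      using eig[OF ij(1) uW[OF ij(2)]] eig[OF ij(2) uW[OF ij(1)]] by simp
    then show ?thesis using False by auto
  qed
  then show ?thesis using that uW eig by blast
qed

text \<open>A residual of positive length would be an additional independent function.\<close>

lemma orthonormal_complete:
  assumes W: "lin_closed W" "W \<subseteq> L2 \<Omega>" and dim: "enat n = L2_dim \<Omega> W"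
    and u: "\<And>j. j \<in> {1..n} \<Longrightarrow> u j \<in> W"
    and orth: "\<And>i j. i \<in> {1..n} \<Longrightarrow> j \<in> {1..n} \<Longrightarrow> L2_inner \<Omega> (u i) (u j) = of_bool (i = j)"
    and v: "v \<in> W"
  shows "AE x in lebesgue_on \<Omega>. v x - (\<Sum>j\<in>{1..n}. L2_inner \<Omega> v (u j) *\<^sub>R u j x) = 0"
proof (rule ccontr)
  assume contr: "\<not> ?thesis"
  define r where "r = (\<lambda>x. v x - (\<Sum>j\<in>{1..n}. L2_inner \<Omega> v (u j) *\<^sub>R u j x))"
  have sW: "(\<lambda>x. \<Sum>j\<in>{1..n}. L2_inner \<Omega> v (u j) *\<^sub>R u j x) \<in> W" using u by (rule lin_closed_sum[OF W(1)])
  have rW: "r \<in> W" unfolding r_def by (rule lin_closed_diff[OF W(1) v sW])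
  have uL: "u j \<in> L2 \<Omega>" if "j \<in> {1..n}" for j using u[OF that] W(2) by blast
  have L: "v \<in> L2 \<Omega>" "r \<in> L2 \<Omega>" "(\<lambda>x. \<Sum>j\<in>{1..n}. L2_inner \<Omega> v (u j) *\<^sub>R u j x) \<in> L2 \<Omega>"
    using v rW sW W(2) by auto
  have rr: "L2_inner \<Omega> r r \<noteq> 0" using contr L2_inner_self_eq_0[OF L(2)] by (simp add: r_def)
  have ru: "L2_inner \<Omega> r (u k) = 0" if k: "k \<in> {1..n}" for k
  proof -
    have "L2_inner \<Omega> (\<lambda>x. \<Sum>j\<in>{1..n}. L2_inner \<Omega> v (u j) *\<^sub>R u j x) (u k)
        = (\<Sum>j\<in>{1..n}. L2_inner \<Omega> v (u j) * L2_inner \<Omega> (u j) (u k))"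
      by (rule L2.sum_left[OF uL uL[OF k]])
    also have "\<dots> = (\<Sum>j\<in>{1..n}. if j = k then L2_inner \<Omega> v (u j) else 0)"
      using orth[OF _ k] by (intro sum.cong) auto
    also have "\<dots> = L2_inner \<Omega> v (u k)" using k by (simp add: sum.delta)
    finally show ?thesis unfolding r_def using L2.diff_left[OF L(1) L(3) uL[OF k]] by simp
  qed
  define w where "w i = (if i < n then u (Suc i) else r)" for i
  have wW: "w i \<in> W" for i using u[of "Suc i"] rW by (simp add: w_def)
  then have wL: "w i \<in> L2 \<Omega>" for i using W(2) by blast
  have ww: "L2_inner \<Omega> (w i) (w j) = (if i = j then L2_inner \<Omega> (w j) (w j) else 0)"
    and w0: "L2_inner \<Omega> (w j) (w j) \<noteq> 0" if "i < Suc n" "j < Suc n" for i j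
    using that orth[of "Suc i" "Suc j"] orth[of "Suc j" "Suc j"] ru[of "Suc i"] ru[of "Suc j"] rr
      L2.sym[OF uL[of "Suc i"] L(2)]
    by (auto simp: w_def)
  have "L2_independent \<Omega> (Suc n) w"
    unfolding L2_independent_def
  proof (intro allI impI)
    fix c :: "nat \<Rightarrow> real" and j
    assume ae: "AE x in lebesgue_on \<Omega>. (\<Sum>i<Suc n. c i *\<^sub>R w i x) = 0" and j: "j < Suc n"
    have "L2_inner \<Omega> (\<lambda>x. \<Sum>i<Suc n. c i *\<^sub>R w i x) (w j) = L2_inner \<Omega> (\<lambda>x. 0) (w j)"
      by (rule L2_inner_cong_AE[OF L2.closed_sum[OF wL] L2.closed_0 wL ae])
    also have "\<dots> = 0" by (rule L2.zero_left[OF wL])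
    also have "L2_inner \<Omega> (\<lambda>x. \<Sum>i<Suc n. c i *\<^sub>R w i x) (w j) = (\<Sum>i<Suc n. c i * L2_inner \<Omega> (w i) (w j))"
      by (rule L2.sum_left[OF wL wL])
    finally have "(\<Sum>i<Suc n. c i * L2_inner \<Omega> (w i) (w j)) = 0" .
    moreover have "(\<Sum>i<Suc n. c i * L2_inner \<Omega> (w i) (w j))
        = (\<Sum>i<Suc n. if i = j then c i * L2_inner \<Omega> (w j) (w j) else 0)"
    proof (intro sum.cong refl)
      fix i assume "i \<in> {..<Suc n}"
      then show "c i * L2_inner \<Omega> (w i) (w j) = (if i = j then c i * L2_inner \<Omega> (w j) (w j) else 0)"
        using ww[of i j] j by (cases "i = j") simp_all
    qed
    ultimately have "c j * L2_inner \<Omega> (w j) (w j) = 0" using j by (simp only: sum.delta finite_lessThan) simp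
    then show "c j = 0" using w0[OF j j] by simp
  qed
  then have "enat (Suc n) \<le> L2_dim \<Omega> W" using wW by (intro L2_dim_upper)
  then show False using dim[symmetric] by simp
qed

end

section \<open>The lower eigenvalue bound\<close>

lemma two_times_le_of_square_le:
  fixes x a b :: real
  assumes "x\<^sup>2 \<le> a * b" "0 \<le> a" "0 \<le> b"
  shows "2 * x \<le> a + b"
proof (rule power2_le_imp_le)
  have "0 \<le> (a - b)\<^sup>2" by simp
  then show "(2 * x)\<^sup>2 \<le> (a + b)\<^sup>2" using assms(1) by (simp add: power2_eq_square algebra_simps)
qed (use assms in simp)

context open_domain
begin

text \<open>Let \<open>P\<close> be the energy projection of \<open>v\<close> onto \<open>W\<close>. Among the combinations \<open>v\<close> of the
first \<open>i\<close> eigenfunctions there is a nonzero one for which \<open>P\<close> has no component along the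
first \<open>i - 1\<close> discrete eigenfunctions, since these are \<open>i - 1\<close> linear conditions on \<open>i\<close>
coefficients. Then \<open>ev_h i (P, P)\<close> is at most the energy of \<open>P\<close>, the hypothesis bounds
the length of \<open>e = v - P\<close>, and the energies of \<open>P\<close> and \<open>e\<close> add up to that of \<open>v\<close>, which
is at most \<open>ev i (v, v)\<close>. The Cauchy--Schwarz inequality, with the weights \<open>1 / ev_h i\<close> and
\<open>K\<close>, combines the two lengths.\<close>

lemma eigenvalue_lower_bound:
  assumes V: "lin_closed V" "V \<subseteq> H1v" and W: "lin_closed W" "W \<subseteq> V"
    and ev: "lists_eigenvalues \<Omega> V {1..} ev"
    and dim: "enat n = L2_dim \<Omega> W" and ev_h: "lists_eigenvalues \<Omega> W {1..n} ev_h"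
    and i: "i \<in> {1..n}" and pos: "0 < ev_h i" and K: "0 \<le> K"
    and error: "\<And>e. e \<in> V \<Longrightarrow> (\<And>v. v \<in> W \<Longrightarrow> energy e v = 0) \<Longrightarrow> L2_inner \<Omega> e e \<le> K * energy e e"
  shows "1 \<le> (1 / ev_h i + K) * ev i"
proof -
  have WH: "W \<subseteq> H1v" using V W by blast
  obtain u where u: "\<And>i. i \<in> {1..} \<Longrightarrow> u i \<in> V"
    "\<And>i v. i \<in> {1..} \<Longrightarrow> v \<in> V \<Longrightarrow> energy (u i) v = ev i * L2_inner \<Omega> (u i) v"
    "\<And>i j. i \<in> {1..} \<Longrightarrow> j \<in> {1..} \<Longrightarrow> L2_inner \<Omega> (u i) (u j) = of_bool (i = j)"
    using orthonormal_eigenfunctions[OF V ev] by blast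
  obtain w where w: "\<And>i. i \<in> {1..n} \<Longrightarrow> w i \<in> W"
    "\<And>i v. i \<in> {1..n} \<Longrightarrow> v \<in> W \<Longrightarrow> energy (w i) v = ev_h i * L2_inner \<Omega> (w i) v"
    "\<And>i j. i \<in> {1..n} \<Longrightarrow> j \<in> {1..n} \<Longrightarrow> L2_inner \<Omega> (w i) (w j) = of_bool (i = j)"
    using orthonormal_eigenfunctions[OF W(1) WH ev_h] by blast
  have uH: "u l \<in> H1v" if "l \<in> {1..i}" for l using u(1)[of l] V(2) that by auto
  have wH: "w j \<in> H1v" if "j \<in> {1..n}" for j using w(1)[OF that] WH by blast
  have ww: "energy (w j) (w l) = (if j = l then ev_h j else 0)" if "j \<in> {1..n}" "l \<in> {1..n}" for j l
    using w(2)[OF that(1) w(1)[OF that(2)]] w(3)[OF that] by simp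
  have uu: "energy (u j) (u l) = (if j = l then ev j else 0)" if "j \<in> {1..i}" "l \<in> {1..i}" for j l
    using u(2)[of j "u l"] u(1)[of l] u(3)[of j l] that by simp
  have "card {1..<i} < card {1..i}" using i by simp
  then obtain c where c: "\<exists>l\<in>{1..i}. c l \<noteq> 0" "\<forall>j\<in>{1..<i}. (\<Sum>l\<in>{1..i}. energy (u l) (w j) * c l) = 0"
    using underdetermined_system[of "{1..<i}" "{1..i}" "\<lambda>j l. energy (u l) (w j)"] by auto
  define v where "v = (\<lambda>x. \<Sum>l\<in>{1..i}. c l *\<^sub>R u l x)"
  have vV: "v \<in> V" unfolding v_def using u(1) by (intro lin_closed_sum[OF V(1)]) auto
  then have vH: "v \<in> H1v" using V by blast
  define S where "S = (\<Sum>l\<in>{1..i}. (c l)\<^sup>2)"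
  have vv: "L2_inner \<Omega> v v = S"
  proof -
    have "L2_inner \<Omega> v (u l) = c l" if l: "l \<in> {1..i}" for l
    proof -
      have "L2_inner \<Omega> v (u l) = (\<Sum>j\<in>{1..i}. c j * L2_inner \<Omega> (u j) (u l))"
        unfolding v_def by (rule L2.sum_left) (use uH l H1v_L2 in auto)
      also have "\<dots> = (\<Sum>j\<in>{1..i}. if j = l then c j else 0)" using u(3) l by (intro sum.cong) auto
      finally show ?thesis using l by (simp add: sum.delta)
    qed
    moreover have "L2_inner \<Omega> v (\<lambda>x. \<Sum>l\<in>{1..i}. c l *\<^sub>R u l x) = (\<Sum>l\<in>{1..i}. c l * L2_inner \<Omega> v (u l))"
      by (rule L2.sum_right) (use uH vH H1v_L2 in auto)
    ultimately have "L2_inner \<Omega> v v = (\<Sum>l\<in>{1..i}. c l * c l)" by (simp flip: v_def del: One_nat_def)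
    then show ?thesis by (simp add: S_def power2_eq_square)
  qed
  have Evv: "energy v v \<le> ev i * S"
  proof -
    have "energy v (u l) = c l * ev l" if l: "l \<in> {1..i}" for l
    proof -
      have "energy v (u l) = (\<Sum>j\<in>{1..i}. c j * energy (u j) (u l))"
        unfolding v_def by (rule energy.sum_left) (use uH l in auto)
      also have "\<dots> = (\<Sum>j\<in>{1..i}. if j = l then c j * ev j else 0)" using uu l by (intro sum.cong) auto
      finally show ?thesis using l by (simp add: sum.delta)
    qed
    moreover have "energy v (\<lambda>x. \<Sum>l\<in>{1..i}. c l *\<^sub>R u l x) = (\<Sum>l\<in>{1..i}. c l * energy v (u l))"
      by (rule energy.sum_right) (use uH vH in auto)
    ultimately have "energy v v = (\<Sum>l\<in>{1..i}. c l * (c l * ev l))" by (simp flip: v_def del: One_nat_def)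
    also have "\<dots> \<le> (\<Sum>l\<in>{1..i}. ev i * (c l)\<^sup>2)"
    proof (rule sum_mono)
      fix l assume "l \<in> {1..i}"
      then have "ev l \<le> ev i" using ev by (auto simp: lists_eigenvalues_def mono_on_def)
      from mult_right_mono[OF this, of "(c l)\<^sup>2"] show "c l * (c l * ev l) \<le> ev i * (c l)\<^sup>2"
        by (simp add: power2_eq_square mult_ac)
    qed
    finally show ?thesis by (simp add: S_def sum_distrib_left)
  qed
  have Spos: "0 < S"
  proof -
    obtain l where "l \<in> {1..i}" "c l \<noteq> 0" using c(1) by blast
    then show ?thesis unfolding S_def by (intro sum_pos2[of _ l]) auto
  qed
  \<comment> \<open>If \<open>ev_h j = 0\<close>, then \<open>w j\<close> has no energy and the coefficient zero, which the division yields, is correct.\<close>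
  define b where "b j = energy v (w j) / ev_h j" for j
  define P where "P = (\<lambda>x. \<Sum>j\<in>{1..n}. b j *\<^sub>R w j x)"
  have PW: "P \<in> W" unfolding P_def using w(1) by (rule lin_closed_sum[OF W(1)])
  then have PH: "P \<in> H1v" using WH by blast
  have b_energy: "b j * ev_h j = energy v (w j)" if j: "j \<in> {1..n}" for j
  proof (cases "ev_h j = 0")
    case True
    then have "energy (w j) (w j) = 0" using ww[OF j j] by simp
    then show ?thesis using True energy.null_orthogonal[OF vH wH[OF j]] by simp
  qed (simp add: b_def)
  have Pw: "energy P (w j) = energy v (w j)" if j: "j \<in> {1..n}" for j
  proof -
    have "energy P (w j) = (\<Sum>l\<in>{1..n}. b l * energy (w l) (w j))"
      unfolding P_def by (rule energy.sum_left) (use wH j in auto)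
    also have "\<dots> = (\<Sum>l\<in>{1..n}. if l = j then b l * ev_h l else 0)" using ww j by (intro sum.cong) auto
    finally show ?thesis using j b_energy by (simp add: sum.delta)
  qed
  have b0: "b j = 0" if "j \<in> {1..<i}" for j
  proof -
    have "energy v (w j) = (\<Sum>l\<in>{1..i}. c l * energy (u l) (w j))"
      unfolding v_def by (rule energy.sum_left) (use uH wH[of j] that i in auto)
    also have "\<dots> = 0" using c(2) that by (simp add: mult.commute)
    finally show ?thesis by (simp add: b_def)
  qed
  define e where "e = (\<lambda>x. v x - P x)"
  have eV: "e \<in> V" unfolding e_def using lin_closed_diff[OF V(1) vV] PW W(2) by blast
  then have eH: "e \<in> H1v" using V by blast
  have ew: "energy e (w j) = 0" if "j \<in> {1..n}" for j
    unfolding e_def using energy.diff_left[OF vH PH wH[OF that]] Pw[OF that] by simp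
  have orth: "energy e z = 0" if z: "z \<in> W" for z
  proof -
    let ?s = "\<lambda>x. \<Sum>j\<in>{1..n}. L2_inner \<Omega> z (w j) *\<^sub>R w j x"
    have zH: "z \<in> H1v" using z WH by blast
    have sH: "?s \<in> H1v" using wH by (rule energy.closed_sum)
    have "W \<subseteq> L2 \<Omega>" using WH H1v_L2 by blast
    then have "AE x in lebesgue_on \<Omega>. z x - ?s x = 0"
      using orthonormal_complete[OF W(1) _ dim w(1) w(3) z] by blast
    then have "energy e (\<lambda>x. z x - ?s x) = 0"
      by (rule energy_null[OF eH energy.closed_diff[OF zH sH]])
    moreover have "energy e ?s = (\<Sum>j\<in>{1..n}. L2_inner \<Omega> z (w j) * energy e (w j))"
      by (rule energy.sum_right[OF wH eH])
    moreover have "(\<Sum>j\<in>{1..n}. L2_inner \<Omega> z (w j) * energy e (w j)) = 0"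
      using ew by (intro sum.neutral) simp
    ultimately show ?thesis using energy.diff_right[OF zH sH eH] by simp
  qed
  have eP: "energy e P = 0" using orth[OF PW] .
  have v_split: "v = (\<lambda>x. P x + e x)" by (simp add: e_def)
  have energy_split: "energy v v = energy P P + energy e e"
  proof -
    have "energy v v = energy P v + energy e v"
      using energy.add_left[OF PH eH vH] by (simp only: v_split[symmetric])
    also have "energy P v = energy P P + energy P e"
      using energy.add_right[OF PH eH PH] by (simp only: v_split[symmetric])
    also have "energy e v = energy e P + energy e e"
      using energy.add_right[OF PH eH eH] by (simp only: v_split[symmetric])
    finally show ?thesis using eP energy.sym[OF eH PH] by simp
  qed
  note L = H1v_L2[OF PH] H1v_L2[OF eH] H1v_L2[OF vH]
  have inner_split: "L2_inner \<Omega> v v = L2_inner \<Omega> P P + 2 * L2_inner \<Omega> P e + L2_inner \<Omega> e e"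
  proof -
    have "L2_inner \<Omega> v v = L2_inner \<Omega> P v + L2_inner \<Omega> e v"
      using L2.add_left[OF L(1,2,3)] by (simp only: v_split[symmetric])
    also have "L2_inner \<Omega> P v = L2_inner \<Omega> P P + L2_inner \<Omega> P e"
      using L2.add_right[OF L(1,2,1)] by (simp only: v_split[symmetric])
    also have "L2_inner \<Omega> e v = L2_inner \<Omega> e P + L2_inner \<Omega> e e"
      using L2.add_right[OF L(1,2,2)] by (simp only: v_split[symmetric])
    finally show ?thesis using L2.sym[OF L(1,2)] by simp
  qed
  have PP: "ev_h i * L2_inner \<Omega> P P \<le> energy P P"
  proof -
    have "L2_inner \<Omega> P (w l) = b l" if l: "l \<in> {1..n}" for l
    proof -
      have "L2_inner \<Omega> P (w l) = (\<Sum>j\<in>{1..n}. b j * L2_inner \<Omega> (w j) (w l))"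
        unfolding P_def by (rule L2.sum_left) (use wH l H1v_L2 in auto)
      also have "\<dots> = (\<Sum>j\<in>{1..n}. if j = l then b j else 0)" using w(3) l by (intro sum.cong) auto
      finally show ?thesis using l by (simp add: sum.delta)
    qed
    moreover have "L2_inner \<Omega> P (\<lambda>x. \<Sum>l\<in>{1..n}. b l *\<^sub>R w l x) = (\<Sum>l\<in>{1..n}. b l * L2_inner \<Omega> P (w l))"
      by (rule L2.sum_right) (use wH PH H1v_L2 in auto)
    ultimately have 1: "L2_inner \<Omega> P P = (\<Sum>l\<in>{1..n}. b l * b l)" by (simp flip: P_def del: One_nat_def)
    have "energy P (\<lambda>x. \<Sum>l\<in>{1..n}. b l *\<^sub>R w l x) = (\<Sum>l\<in>{1..n}. b l * energy P (w l))"
      by (rule energy.sum_right) (use wH PH in auto)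
    then have 2: "energy P P = (\<Sum>l\<in>{1..n}. b l * (b l * ev_h l))"
      using Pw b_energy by (simp flip: P_def del: One_nat_def)
    show ?thesis unfolding 1 2 sum_distrib_left
    proof (rule sum_mono)
      fix l assume l: "l \<in> {1..n}"
      show "ev_h i * (b l * b l) \<le> b l * (b l * ev_h l)"
      proof (cases "l < i")
        case True
        then show ?thesis using b0[of l] l by simp
      next
        case False
        then have "ev_h i \<le> ev_h l" using ev_h l i by (auto simp: lists_eigenvalues_def mono_on_def)
        from mult_right_mono[OF this, of "b l * b l"] show ?thesis by (simp add: mult_ac)
      qed
    qed
  qed
  define A where "A = energy P P"
  define E where "E = energy e e"
  have nn: "0 \<le> A" "0 \<le> E" using energy.nonneg PH eH by (simp_all add: A_def E_def)
  have ee: "L2_inner \<Omega> e e \<le> K * E" unfolding E_def by (rule error[OF eV orth])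
  have PP': "L2_inner \<Omega> P P \<le> A / ev_h i" using PP pos by (simp add: A_def field_simps)
  have "(L2_inner \<Omega> P e)\<^sup>2 \<le> L2_inner \<Omega> P P * L2_inner \<Omega> e e" by (rule L2.Cauchy_Schwarz[OF L(1,2)])
  also have "\<dots> \<le> (A / ev_h i) * (K * E)"
    using PP' ee L2.nonneg[OF L(2)] nn pos by (intro mult_mono) auto
  also have "\<dots> = (K * A) * (E / ev_h i)" by simp
  finally have "2 * L2_inner \<Omega> P e \<le> K * A + E / ev_h i"
    using nn pos K by (intro two_times_le_of_square_le) auto
  then have "S \<le> A / ev_h i + (K * A + E / ev_h i) + K * E" using inner_split vv PP' ee by linarith
  also have "\<dots> = (1 / ev_h i + K) * (A + E)" by (simp add: algebra_simps add_divide_distrib)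
  also have "\<dots> \<le> (1 / ev_h i + K) * (ev i * S)"
    using Evv energy_split pos K by (intro mult_left_mono) (auto simp: A_def E_def)
  finally have "S * 1 \<le> S * ((1 / ev_h i + K) * ev i)" by (simp add: mult_ac)
  then show ?thesis using Spos by (simp only: mult_le_cancel_left_pos)
qed

lemma eigenvalue_nonneg:
  assumes "lin_closed W" "W \<subseteq> H1v" "lists_eigenvalues \<Omega> W I ev" "i \<in> I"
  shows "0 \<le> ev i"
proof -
  obtain u where u: "\<And>i. i \<in> I \<Longrightarrow> u i \<in> W"
    "\<And>i v. i \<in> I \<Longrightarrow> v \<in> W \<Longrightarrow> energy (u i) v = ev i * L2_inner \<Omega> (u i) v"
    "\<And>i j. i \<in> I \<Longrightarrow> j \<in> I \<Longrightarrow> L2_inner \<Omega> (u i) (u j) = of_bool (i = j)"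
    using orthonormal_eigenfunctions[OF assms(1-3)] by blast
  have "energy (u i) (u i) = ev i" using u(2)[OF assms(4) u(1)] u(3) assms(4) by simp
  moreover have "0 \<le> energy (u i) (u i)" using u(1)[OF assms(4)] assms(2) by (intro energy.nonneg) auto
  ultimately show ?thesis by simp
qed

end

lemma C_h_finite:
  assumes "kappa_h \<Omega> \<T> k d m = ereal \<kappa>"
  shows "(C_h \<Omega> \<T> k d m C0)\<^sup>2 = ereal (C0\<^sup>2 + \<kappa>\<^sup>2)"
  unfolding C_h_def ereal_sqrt_def assms by (simp add: power2_eq_square)

text \<open>Both infinite values of \<open>kappa_h\<close> have the square \<open>\<infinity>\<close>.\<close>

lemma C_h_infinite:
  assumes "\<bar>kappa_h \<Omega> \<T> k d m\<bar> = \<infinity>"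
  shows "C_h \<Omega> \<T> k d m C0 = \<infinity>"
proof -
  have "kappa_h \<Omega> \<T> k d m = \<infinity> \<or> kappa_h \<Omega> \<T> k d m = - \<infinity>" using assms by (cases "kappa_h \<Omega> \<T> k d m") auto
  then have "(ereal C0)\<^sup>2 + (kappa_h \<Omega> \<T> k d m)\<^sup>2 = \<infinity>" by (auto simp: power2_eq_square)
  then show ?thesis by (simp add: C_h_def ereal_sqrt_def)
qed

theorem theorem3:
  fixes \<Omega> :: "(real ^ 3) set" and \<T> :: "(real ^ 3) set set"
    and k d m n i :: nat and C0 :: real and ev ev_h :: "nat \<Rightarrow> real"
  assumes "polyhedral_domain \<Omega>" and "lipschitz_boundary \<Omega>"
    and "tetrahedral_mesh \<Omega> \<T>"
    and "3 \<le> k" and "d = k - 1" and "m = k - 1"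
    and "\<And>w. w \<in> V_space \<Omega> \<Longrightarrow>
           L2_norm \<Omega> (\<lambda>x. w x - L2_proj \<Omega> (X_h3 \<T> d) w x) \<le> C0 * L2_norm \<Omega> (tgrad \<Omega> w)"
    and "lists_eigenvalues \<Omega> (V_space \<Omega>) {1..} ev"
    and "enat n = L2_dim \<Omega> (V_h \<Omega> \<T> k)"
    and "lists_eigenvalues \<Omega> (V_h \<Omega> \<T> k) {1..n} ev_h"
    and "i \<in> {1..n}"
  shows "ereal (ev i) \<ge>
    ereal (ev_h i) / (1 + (C_h \<Omega> \<T> k d m C0)\<^sup>2 * ereal (ev_h i))"
proof -
  have bdd: "bounded \<Omega>" and op: "open \<Omega>" using assms(1) by (auto simp: polyhedral_domain_def)
  interpret open_domain \<Omega> by standard (use op bdd lmeasurable_open in auto)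
  note V = lin_closed_V_space V_space_H1v
  note W = lin_closed_V_h[of \<T> k] V_h_subset_V_space[OF bdd assms(3), of k]
  have ev0: "0 \<le> ev i" using eigenvalue_nonneg[OF V assms(8)] assms(11) by simp
  have ev_h0: "0 \<le> ev_h i" using eigenvalue_nonneg[OF W(1) _ assms(10,11)] W(2) V(2) by blast
  let ?C = "C_h \<Omega> \<T> k d m C0"
  show ?thesis
  proof (cases "ev_h i = 0")
    \<comment> \<open>The right-hand side is zero here, and also below when the constant is infinite.\<close>
    case True
    then show ?thesis using ev0 by (simp flip: zero_ereal_def)
  next
    case False
    then have pos: "0 < ev_h i" using ev_h0 by simp
    show ?thesis
    proof (cases "kappa_h \<Omega> \<T> k d m")
      case (real \<kappa>)
      let ?K = "C0\<^sup>2 + \<kappa>\<^sup>2"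
      have "1 \<le> (1 / ev_h i + ?K) * ev i"
        by (rule eigenvalue_lower_bound[OF V W assms(8-11) pos])
          (auto intro: galerkin_error[OF bdd assms(3,7) real])
      then have "ev_h i \<le> ev_h i * ((1 / ev_h i + ?K) * ev i)" using pos by simp
      also have "\<dots> = ev i * (1 + ?K * ev_h i)" using pos by (simp add: field_simps)
      finally have "ev_h i / (1 + ?K * ev_h i) \<le> ev i"
        using pos by (simp add: pos_divide_le_eq add_pos_nonneg)
      moreover have "1 + ?C\<^sup>2 * ereal (ev_h i) = ereal (1 + ?K * ev_h i)"
        unfolding C_h_finite[OF real] by (simp add: one_ereal_def)
      moreover have "1 + ?K * ev_h i \<noteq> 0" using pos by (smt (verit) mult_nonneg_nonneg sum_power2_ge_zero)
      ultimately show ?thesis by simp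
    qed (use C_h_infinite[of \<Omega> \<T> k d m C0] pos ev0 in \<open>auto simp: power2_eq_square\<close>)
  qed
qed

end
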